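(* Let $r$ be an odd prime and $1\le n<r$. For every $a=(a_1,\dots,a_r)$ with $a_1\ge\dots\ge a_r\ge0$ integers and $\sum_ka_k=n$, and every $1\le s\le r$, $$N_{\zeta^s}(a)=\frac{(r-1)!}{\prod_{v\ge0}m_v(a)!}\,A_0(a),\qquad N_{-\zeta^s}(a)=\frac{(r-1)!}{\prod_{v\ge0}m_v(a)!}\,A_1(a),$$ where $m_v(a)=\#\{k:a_k=v\}$. Consequently $$N_{\zeta^s}(n)=\sum_{a}\frac{(r-1)!}{\prod_{v\ge0}m_v(a)!}\,A_0(a),\qquad N_{-\zeta^s}(n)=\sum_{a}\frac{(r-1)!}{\prod_{v\ge0}m_v(a)!}\,A_1(a),$$ the sums being over all integer sequences $a_1\ge\dots\ge a_r\ge0$ with $\sum_k a_k=n$.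
   Context: $G(n,r)=\mathbb{Z}_r^n\rtimes S_n$, where $\mathbb{Z}_r=\mathbb{Z}/r\mathbb{Z}$ and $S_n$ permutes coordinates; $G(0,r)$ is trivial. $P(n,r)$ is the set of $r$-tuples $\lambda=(\lambda_1,\dots,\lambda_r)$ of partitions (possibly empty) with $\sum_k|\lambda_k|=n$. Fix a primitive $r$-th root of unity $\zeta$; also write $\zeta$ for the character $\zeta(x;w)=\zeta^{x_1+\dots+x_n}$ of $G(n,r)$ and $\mathrm{sgn}(x;w)$ for the sign of $w$. For a partition $\mu$ of $m$, let $\rho_\mu$ be the corresponding irreducible complex representation of $S_m$, $\chi_\mu$ its character, $f_\mu$ its dimension, and $\rho_\mu^k(x;w)=\zeta^{k(x_1+\dots+x_m)}\rho_\mu(w)$ its extension to $G(m,r)$. For $\lambda\in P(n,r)$ with $b_k=|\lambda_k|$, the irreducible representation of $G(n,r)$ indexed by $\lambda$ is $$\rho_\lambda=\mathrm{Ind}_{G(b_1,r)\times\dots\times G(b_r,r)}^{G(n,r)}\ \rho_{\lambda_1}^{0}\boxtimes\rho_{\lambda_2}^{1}\boxtimes\dots\boxtimes\rho_{\lambda_r}^{r-1}.$$ $N_{\zeta^s}(n)$ (resp. $N_{-\zeta^s}(n)$) is the number of $\lambda\in P(n,r)$ such that the character $\det\rho_\lambda$ equals $\zeta^s$ (resp. $\zeta^s\cdot\mathrm{sgn}$). $N_{\zeta^s}(a)$ (resp. $N_{-\zeta^s}(a)$) is the number of those $\lambda$ for which moreover $(|\lambda_1|,\dots,|\lambda_r|)$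 is a rearrangement of $a$. For $n=1$, where $\mathrm{sgn}$ is trivial, $N_{-\zeta^s}=0$. Put $g_\mu=\frac{f_\mu-\chi_\mu(s_1)}2$ with $s_1=(1\,2)$ for $|\mu|\ge2$ and $g_\mu=0$ for $|\mu|<2$; $\widehat f_{\lambda_k}=\prod_{j\ne k}f_{\lambda_j}$; multinomial coefficients with a negative lower entry are $0$. For $n\ge2$ and $\lambda$ with $|\lambda_k|=b_k$, $$y_\lambda=f_{\lambda_1}\cdots f_{\lambda_r}\frac{(n-2)!}{b_1!\cdots b_r!}\sum_{1\le i<j\le r}b_ib_j+\sum_{k=1}^r g_{\lambda_k}\widehat f_{\lambda_k}\binom{n-2}{b_1,\dots,b_k-2,\dots,b_r},$$ and $y_\lambda=0$ for $n=1$. $A_0(a)$ (resp. $A_1(a)$) is the number of $\lambda\in P(n,r)$ with $|\lambda_k|=a_k$ for all $k$ (in this order) and $y_\lambda$ even (resp. odd). *)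

theory Defs
  imports
    Complex_Main
    "HOL-Library.Function_Algebras"
    "HOL-Library.Groups_Big_Fun"
    "HOL-Library.Multiset"
    "HOL-Computational_Algebra.Primes"
    "HOL-Algebra.Sym_Groups"
    "HOL-Algebra.Elementary_Groups"
    "HOL-Algebra.Product_Groups"
    "Jordan_Normal_Form.Determinant"
begin

text \<open>The semidirect product, written \<open>(x; w)\<close>, where \<open>w\<close> acts by
  \<open>(w x)\<^sub>i = x\<^sub>j\<close> with \<open>w j = i\<close>. Coordinates are indexed by \<open>{1..n}\<close>.\<close>

definition Gnr :: "nat \<Rightarrow> nat \<Rightarrow> ((nat \<Rightarrow> int) \<times> (nat \<Rightarrow> nat)) monoid" where
  "Gnr n r = (let Z = product_group {1..n} (\<lambda>_. integer_mod_group r) in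
     \<lparr> carrier = carrier Z \<times> carrier (sym_group n),
       mult = (\<lambda>(x, w) (y, v). (x \<otimes>\<^bsub>Z\<^esub> (\<lambda>i\<in>{1..n}. y (inv_into UNIV w i)), w \<circ> v)),
       one = (\<one>\<^bsub>Z\<^esub>, id) \<rparr>)"

definition primitive_root_of_unity :: "nat \<Rightarrow> complex \<Rightarrow> bool" where
  "primitive_root_of_unity r \<zeta> \<longleftrightarrow> \<zeta> ^ r = 1 \<and> (\<forall>k. 0 < k \<and> k < r \<longrightarrow> \<zeta> ^ k \<noteq> 1)"

definition zeta_char :: "complex \<Rightarrow> nat \<Rightarrow> (nat \<Rightarrow> int) \<times> (nat \<Rightarrow> nat) \<Rightarrow> complex" where
  "zeta_char \<zeta> n = (\<lambda>(x, w). \<zeta> powi (\<Sum>i\<in>{1..n}. x i))"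

definition sgn_char :: "(nat \<Rightarrow> int) \<times> (nat \<Rightarrow> nat) \<Rightarrow> complex" where
  "sgn_char = (\<lambda>(x, w). of_int (sign w))"

definition is_partition :: "nat list \<Rightarrow> bool" where
  "is_partition \<mu> \<longleftrightarrow> sorted_wrt (\<ge>) \<mu> \<and> 0 \<notin> set \<mu>"

abbreviation psize :: "nat list \<Rightarrow> nat" where
  "psize \<mu> \<equiv> sum_list \<mu>"

text \<open>The component \<open>\<lambda>\<^sub>k\<close> (for \<open>1 \<le> k \<le> r\<close>) is the list entry \<open>lam ! (k - 1)\<close>.\<close>

definition Pnr :: "nat \<Rightarrow> nat \<Rightarrow> nat list list set" where
  "Pnr n r = {lam. length lam = r \<and> (\<forall>\<mu>\<in>set lam. is_partition \<mu>) \<and> sum_list (map psize lam) = n}"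

text \<open>Cutting \<open>{1..sum_list bs}\<close> into consecutive intervals of lengths \<open>bs\<close>. These are the
  rows of the standard row-by-row filling of a Young diagram, and also the supports of the
  factors of \<open>G(b\<^sub>1,r) \<times> \<dots> \<times> G(b\<^sub>r,r)\<close>.\<close>

definition offset :: "nat list \<Rightarrow> nat \<Rightarrow> nat" where
  "offset bs k = sum_list (take k bs)"

definition block :: "nat list \<Rightarrow> nat \<Rightarrow> nat set" where
  "block bs k = {offset bs k + 1 .. offset bs k + bs ! k}"

definition column :: "nat list \<Rightarrow> nat \<Rightarrow> nat set" where
  "column \<mu> j = {offset \<mu> i + j + 1 | i. i < length \<mu> \<and> j < \<mu> ! i}"

text \<open>The group algebra of \<open>S\<^sub>m\<close> is realised inside the space of complex functions on
  \<open>nat \<Rightarrow> nat\<close>; the representation \<open>\<rho>\<^sub>\<mu>\<close> is left multiplication on the left ideal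
  generated by the Young symmetrizer \<open>(\<Sum>p. p) (\<Sum>q. sgn(q) q)\<close>, with \<open>p\<close> in the row group
  and \<open>q\<close> in the column group. In particular \<open>\<rho>\<close> is trivial for \<open>\<mu> = (m)\<close> and the sign
  for \<open>\<mu> = (1,\<dots>,1)\<close>.\<close>

interpretation fun_vs: vector_space "\<lambda>(c::complex) (f::'a \<Rightarrow> complex) x. c * f x"
  by unfold_locales (auto simp: fun_eq_iff algebra_simps)

definition row_group :: "nat list \<Rightarrow> (nat \<Rightarrow> nat) set" where
  "row_group \<mu> = {p. p permutes {1..psize \<mu>} \<and> (\<forall>i < length \<mu>. p ` block \<mu> i = block \<mu> i)}"

definition column_group :: "nat list \<Rightarrow> (nat \<Rightarrow> nat) set" where
  "column_group \<mu> = {q. q permutes {1..psize \<mu>} \<and> (\<forall>j. q ` column \<mu> j = column \<mu> j)}"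

definition young_symmetrizer :: "nat list \<Rightarrow> (nat \<Rightarrow> nat) \<Rightarrow> complex" where
  "young_symmetrizer \<mu> u =
     (\<Sum>p\<in>row_group \<mu>. \<Sum>q\<in>column_group \<mu>. if p \<circ> q = u then of_int (sign q) else 0)"

definition translate :: "(nat \<Rightarrow> nat) \<Rightarrow> ((nat \<Rightarrow> nat) \<Rightarrow> complex) \<Rightarrow> (nat \<Rightarrow> nat) \<Rightarrow> complex" where
  "translate w f = (\<lambda>u. f (inv_into UNIV w \<circ> u))"

definition specht :: "nat list \<Rightarrow> ((nat \<Rightarrow> nat) \<Rightarrow> complex) set" where
  "specht \<mu> = fun_vs.span {translate w (young_symmetrizer \<mu>) | w. w permutes {1..psize \<mu>}}"

definition specht_basis :: "nat list \<Rightarrow> ((nat \<Rightarrow> nat) \<Rightarrow> complex) list" where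
  "specht_basis \<mu> = (SOME bs. distinct bs \<and> fun_vs.independent (set bs) \<and>
                              fun_vs.span (set bs) = specht \<mu>)"

definition f_dim :: "nat list \<Rightarrow> nat" where
  "f_dim \<mu> = fun_vs.dim (specht \<mu>)"

definition rho_sym :: "nat list \<Rightarrow> (nat \<Rightarrow> nat) \<Rightarrow> complex mat" where
  "rho_sym \<mu> w = (let bs = specht_basis \<mu> in
     mat (f_dim \<mu>) (f_dim \<mu>)
       (\<lambda>(i, j). fun_vs.representation (set bs) (translate w (bs ! j)) (bs ! i)))"

definition chi :: "nat list \<Rightarrow> (nat \<Rightarrow> nat) \<Rightarrow> complex" where
  "chi \<mu> w = (\<Sum>i<f_dim \<mu>. rho_sym \<mu> w $$ (i, i))"

definition rho_ext ::
  "complex \<Rightarrow> nat list \<Rightarrow> nat \<Rightarrow> (nat \<Rightarrow> int) \<times> (nat \<Rightarrow> nat) \<Rightarrow> complex mat" where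
  "rho_ext \<zeta> \<mu> k = (\<lambda>(x, w). zeta_char \<zeta> (psize \<mu>) (x, w) ^ k \<cdot>\<^sub>m rho_sym \<mu> w)"

definition kronecker :: "complex mat \<Rightarrow> complex mat \<Rightarrow> complex mat" where
  "kronecker A B = mat (dim_row A * dim_row B) (dim_col A * dim_col B)
     (\<lambda>(i, j). A $$ (i div dim_row B, j div dim_col B) * B $$ (i mod dim_row B, j mod dim_col B))"

text \<open>\<open>G(b\<^sub>1,r) \<times> \<dots> \<times> G(b\<^sub>r,r)\<close> as a subgroup of \<open>G(n,r)\<close>, and its projections to the factors.\<close>

definition young_subgroup :: "nat list \<Rightarrow> nat \<Rightarrow> ((nat \<Rightarrow> int) \<times> (nat \<Rightarrow> nat)) set" where
  "young_subgroup bs r = {(x, w) \<in> carrier (Gnr (sum_list bs) r).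
     \<forall>k < length bs. w ` block bs k = block bs k}"

definition proj_factor ::
  "nat list \<Rightarrow> nat \<Rightarrow> (nat \<Rightarrow> int) \<times> (nat \<Rightarrow> nat) \<Rightarrow> (nat \<Rightarrow> int) \<times> (nat \<Rightarrow> nat)" where
  "proj_factor bs k = (\<lambda>(x, w).
     ((\<lambda>i\<in>{1..bs ! k}. x (offset bs k + i)),
      (\<lambda>i. if i \<in> {1..bs ! k} then w (offset bs k + i) - offset bs k else i)))"

definition rho_box ::
  "complex \<Rightarrow> nat list list \<Rightarrow> (nat \<Rightarrow> int) \<times> (nat \<Rightarrow> nat) \<Rightarrow> complex mat" where
  "rho_box \<zeta> lam h =
     foldr kronecker
       (map (\<lambda>k. rho_ext \<zeta> (lam ! k) k (proj_factor (map psize lam) k h)) [0..<length lam])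
       (1\<^sub>m 1)"

definition left_transversal :: "('g, 'm) monoid_scheme \<Rightarrow> 'g set \<Rightarrow> 'g list" where
  "left_transversal G H = (SOME ts. distinct ts \<and> set ts \<subseteq> carrier G \<and>
     (\<forall>g\<in>carrier G. \<exists>!t. t \<in> set ts \<and> g \<in> t <#\<^bsub>G\<^esub> H))"

text \<open>The representation induced from a matrix representation \<open>\<sigma>\<close> of the subgroup \<open>H\<close>,
  as block matrices whose \<open>(i,j)\<close> block is \<open>\<sigma> (t\<^sub>i\<inverse> g t\<^sub>j)\<close>, read as \<open>0\<close> off \<open>H\<close>.\<close>

definition induced_rep ::
  "('g, 'm) monoid_scheme \<Rightarrow> 'g set \<Rightarrow> ('g \<Rightarrow> complex mat) \<Rightarrow> 'g \<Rightarrow> complex mat" where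
  "induced_rep G H \<sigma> g =
    (let ts = left_transversal G H; d = dim_row (\<sigma> \<one>\<^bsub>G\<^esub>) in
     mat (length ts * d) (length ts * d)
       (\<lambda>(i, j). let h = inv\<^bsub>G\<^esub> (ts ! (i div d)) \<otimes>\<^bsub>G\<^esub> g \<otimes>\<^bsub>G\<^esub> (ts ! (j div d)) in
          if h \<in> H then \<sigma> h $$ (i mod d, j mod d) else 0))"

definition rho ::
  "complex \<Rightarrow> nat \<Rightarrow> nat \<Rightarrow> nat list list \<Rightarrow> (nat \<Rightarrow> int) \<times> (nat \<Rightarrow> nat) \<Rightarrow> complex mat" where
  "rho \<zeta> n r lam = induced_rep (Gnr n r) (young_subgroup (map psize lam) r) (rho_box \<zeta> lam)"

definition det_is_plus :: "complex \<Rightarrow> nat \<Rightarrow> nat \<Rightarrow> nat \<Rightarrow> nat list list \<Rightarrow> bool" where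
  "det_is_plus \<zeta> n r s lam \<longleftrightarrow>
     (\<forall>g\<in>carrier (Gnr n r). det (rho \<zeta> n r lam g) = zeta_char \<zeta> n g ^ s)"

definition det_is_minus :: "complex \<Rightarrow> nat \<Rightarrow> nat \<Rightarrow> nat \<Rightarrow> nat list list \<Rightarrow> bool" where
  "det_is_minus \<zeta> n r s lam \<longleftrightarrow>
     (\<forall>g\<in>carrier (Gnr n r). det (rho \<zeta> n r lam g) = zeta_char \<zeta> n g ^ s * sgn_char g)"

text \<open>For \<open>n = 1\<close> the character \<open>sgn\<close> is trivial, and the second kind of count is \<open>0\<close> by convention.\<close>

definition N_plus :: "complex \<Rightarrow> nat \<Rightarrow> nat \<Rightarrow> nat \<Rightarrow> nat" where
  "N_plus \<zeta> n r s = card {lam \<in> Pnr n r. det_is_plus \<zeta> n r s lam}"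

definition N_minus :: "complex \<Rightarrow> nat \<Rightarrow> nat \<Rightarrow> nat \<Rightarrow> nat" where
  "N_minus \<zeta> n r s = (if n = 1 then 0 else card {lam \<in> Pnr n r. det_is_minus \<zeta> n r s lam})"

definition N_plus_at :: "complex \<Rightarrow> nat \<Rightarrow> nat \<Rightarrow> nat \<Rightarrow> nat list \<Rightarrow> nat" where
  "N_plus_at \<zeta> n r s a =
     card {lam \<in> Pnr n r. det_is_plus \<zeta> n r s lam \<and> mset (map psize lam) = mset a}"

definition N_minus_at :: "complex \<Rightarrow> nat \<Rightarrow> nat \<Rightarrow> nat \<Rightarrow> nat list \<Rightarrow> nat" where
  "N_minus_at \<zeta> n r s a = (if n = 1 then 0 else
     card {lam \<in> Pnr n r. det_is_minus \<zeta> n r s lam \<and> mset (map psize lam) = mset a})"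

text \<open>The rational quantities below are kept in \<open>complex\<close>, because the character takes values
  there; evenness and oddness include being an integer.\<close>

definition g_num :: "nat list \<Rightarrow> complex" where
  "g_num \<mu> = (if psize \<mu> < 2 then 0 else (of_nat (f_dim \<mu>) - chi \<mu> (transpose 1 2)) / 2)"

definition multinom :: "nat \<Rightarrow> int list \<Rightarrow> complex" where
  "multinom m cs = (if \<exists>c\<in>set cs. c < 0 then 0 else fact m / (\<Prod>c\<leftarrow>cs. fact (nat c)))"

definition y_num :: "nat \<Rightarrow> nat \<Rightarrow> nat list list \<Rightarrow> complex" where
  "y_num n r lam = (if n < 2 then 0 else
     (let b = (\<lambda>k. psize (lam ! k)) in
      (\<Prod>k<r. of_nat (f_dim (lam ! k))) * (fact (n - 2) / (\<Prod>k<r. fact (b k)))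
          * (\<Sum>j<r. \<Sum>i<j. of_nat (b i * b j))
      + (\<Sum>k<r. g_num (lam ! k) * (\<Prod>j\<in>{..<r} - {k}. of_nat (f_dim (lam ! j)))
          * multinom (n - 2) (map (\<lambda>j. int (b j) - (if j = k then 2 else 0)) [0..<r]))))"

definition is_even_number :: "complex \<Rightarrow> bool" where
  "is_even_number z \<longleftrightarrow> (\<exists>m::int. z = of_int m \<and> even m)"

definition is_odd_number :: "complex \<Rightarrow> bool" where
  "is_odd_number z \<longleftrightarrow> (\<exists>m::int. z = of_int m \<and> odd m)"

definition A_zero :: "nat \<Rightarrow> nat \<Rightarrow> nat list \<Rightarrow> nat" where
  "A_zero n r a = card {lam \<in> Pnr n r. map psize lam = a \<and> is_even_number (y_num n r lam)}"

definition A_one :: "nat \<Rightarrow> nat \<Rightarrow> nat list \<Rightarrow> nat" where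
  "A_one n r a = card {lam \<in> Pnr n r. map psize lam = a \<and> is_odd_number (y_num n r lam)}"

definition decreasing_seqs :: "nat \<Rightarrow> nat \<Rightarrow> nat list set" where
  "decreasing_seqs n r = {a. length a = r \<and> sorted_wrt (\<ge>) a \<and> sum_list a = n}"

definition coeff_of :: "nat \<Rightarrow> nat list \<Rightarrow> real" where
  "coeff_of r a = fact (r - 1) / (\<Prod>v. fact (count_list a v))"

end

(* Every linear character of G(n,r) is determined by its values on the diagonal subgroup and on one
   transposition, so the determinant of rho_lambda is zeta^x sgn^y. On the diagonal subgroup the
   induced representation is diagonal, and counting cosets gives
     x b_1! ... b_r! = f_1 ... f_r (n-1)! (0 b_1 + 1 b_2 + ... + (r-1) b_r).
   A transposition acts as an involution, so its eigenvalue -1 has multiplicity y = (dim - trace)/2,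
   and the Frobenius formula for the trace identifies this with y_lambda, which depends only on the multiset of the
   partitions in lambda. Each f_k divides b_k! and n < r, so f_1 ... f_r n! is a unit modulo r;
   hence rotating lambda cyclically changes x by a fixed unit at each step and the r rotations take
   every value of x exactly once. So the exponents s are equidistributed, and what remains is the
   number of rearrangements of a, divided by r. *)

theory Submission
  imports Defs
    "Jordan_Normal_Form.Schur_Decomposition"
    "HOL-Algebra.Left_Coset"
    "HOL-Number_Theory.Cong"
    "HOL-Combinatorics.Multiset_Permutations"
begin

section \<open>Traces, Kronecker products and induced matrix representations\<close>

text \<open>Coset representatives and bases of Specht modules are arbitrary choices, so no matrix of
  \<open>rho\<close> is ever computed entry by entry. Counts over representatives become counts of
  permutations: a condition invariant under right multiplication by the Young subgroup H holds for
  |H| group elements per representative. The condition that matters is the label of a point j, the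
  index of the block containing w^{-1} j. Its sum over all cosets is the same for every j, which is
  why the determinant on diagonal elements sees only the sum of the coordinates.

  That f_k divides b_k! comes from the Young symmetrizer c: c^2 = kappa c, the trace of right
  multiplication by c yields kappa f = m!, and kappa is an integer because c has integer
  coefficients.

  The two summands of y_lambda arise by splitting the n(n-1) ordered pairs of distinct points into
  pairs inside one block and pairs in different blocks. The formula for x is never divided out: x is
  compared with s after multiplication by b_1! ... b_r!, a unit modulo r because every b_k is below
  the prime r.\<close>

definition mat_trace :: "'a::comm_monoid_add mat \<Rightarrow> 'a" where
  "mat_trace A = (\<Sum>i<dim_row A. A $$ (i, i))"

lemma mat_trace_comm:
  fixes A B :: "'a::comm_semiring_0 mat"
  assumes "A \<in> carrier_mat n m" "B \<in> carrier_mat m n"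
  shows "mat_trace (A * B) = mat_trace (B * A)"
proof -
  have "mat_trace (A * B) = (\<Sum>i<n. \<Sum>j<m. A $$ (i, j) * B $$ (j, i))"
    using assms by (simp add: mat_trace_def scalar_prod_def lessThan_atLeast0)
  also have "\<dots> = (\<Sum>j<m. \<Sum>i<n. B $$ (j, i) * A $$ (i, j))"
    by (subst sum.swap) (simp add: mult.commute)
  also have "\<dots> = mat_trace (B * A)"
    using assms by (simp add: mat_trace_def scalar_prod_def lessThan_atLeast0)
  finally show ?thesis .
qed

text \<open>Schur triangularization replaces A by a similar upper triangular B with B * B = 1. A
  diagonal entry of B * B is the square of that of B, so the diagonal of B consists of 1 and -1, and
  y counts the entries -1.\<close>

lemma involution_trace_det:
  fixes A :: "complex mat"
  assumes A: "A \<in> carrier_mat n n" and AA: "A * A = 1\<^sub>m n"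
  obtains y :: nat where "mat_trace A = of_nat n - 2 * of_nat y" "det A = (-1) ^ y"
proof -
  obtain as where "char_poly A = (\<Prod>a\<leftarrow>as. [:- a, 1:])" using char_poly_factorized[OF A] by blast
  from schur_decomposition_exists[OF A this]
  obtain B where B: "B \<in> carrier_mat n n" "upper_triangular B" "similar_mat A B" by blast
  then obtain P Q where wit: "similar_mat_wit A B P Q" by (auto simp: similar_mat_def)
  have PQ: "P \<in> carrier_mat n n" "Q \<in> carrier_mat n n"
    "P * Q = 1\<^sub>m n" "Q * P = 1\<^sub>m n" "A = P * B * Q"
    using similar_mat_witD2[OF A wit] by auto
  have "Q * (P * B * Q) * P = (Q * P) * B * (Q * P)"
    using PQ(1,2) B(1) by (simp add: assoc_mult_mat[of _ n n _ n _ n])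
  also have "\<dots> = B" using PQ(4) B(1) by simp
  finally have "Q * A * P = B" unfolding PQ(5) .
  then have "B * B = Q * A * P * (Q * A * P)" by simp
  also have "\<dots> = Q * (A * (P * Q) * A) * P"
    using PQ(1,2) A by (simp add: assoc_mult_mat[of _ n n _ n _ n])
  also have "\<dots> = 1\<^sub>m n"
    using PQ(1-4) A AA by simp
  finally have BB: "B * B = 1\<^sub>m n" .
  have tr: "mat_trace A = mat_trace B"
  proof -
    have "mat_trace A = mat_trace (Q * (P * B))"
      unfolding PQ(5) using PQ B by (intro mat_trace_comm[of _ n n]) auto
    also have "Q * (P * B) = B" using PQ(1,2,4) B(1) by (simp add: assoc_mult_mat[symmetric, of _ n n _ n _ n])
    finally show ?thesis .
  qed
  have dt: "det A = det B" using det_similar[OF B(3)] .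
  have diag: "B $$ (i, i) = 1 \<or> B $$ (i, i) = -1" if i: "i < n" for i
  proof -
    have "(B * B) $$ (i, i) = (\<Sum>j<n. B $$ (i, j) * B $$ (j, i))"
      using B(1) i by (simp add: scalar_prod_def lessThan_atLeast0)
    also have "\<dots> = (\<Sum>j<n. if j = i then B $$ (i, i) * B $$ (i, i) else 0)"
    proof (intro sum.cong refl)
      fix j assume "j \<in> {..<n}"
      then show "B $$ (i, j) * B $$ (j, i) = (if j = i then B $$ (i, i) * B $$ (i, i) else 0)"
        using upper_triangularD[OF B(2)] B(1) i by (cases "j < i"; cases "j = i") auto
    qed
    also have "\<dots> = B $$ (i, i) * B $$ (i, i)" using i by simp
    finally have "B $$ (i, i) * B $$ (i, i) = 1" using i by (simp add: BB)
    then show ?thesis by (simp add: square_eq_1_iff)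
  qed
  let ?N = "{i\<in>{..<n}. B $$ (i, i) \<noteq> 1}"
  have "mat_trace B = (\<Sum>i<n. 1 - 2 * (if B $$ (i, i) \<noteq> 1 then 1 else 0))"
    unfolding mat_trace_def using B(1) diag by (intro sum.cong) (fastforce simp: carrier_matD)+
  also have "\<dots> = of_nat n - 2 * of_nat (card ?N)"
    by (simp add: sum_subtractf sum_distrib_left[symmetric] sum.inter_filter[symmetric] del: mult_of_nat_commute)
  finally have 1: "mat_trace A = of_nat n - 2 * of_nat (card ?N)" using tr by simp
  have "det B = (\<Prod>i<n. B $$ (i, i))"
    using det_upper_triangular[OF B(2,1)] B(1)
    by (simp add: prod_list_diag_prod lessThan_atLeast0)
  also have "\<dots> = (\<Prod>i<n. if B $$ (i, i) \<noteq> 1 then -1 else 1)"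
    using diag by (intro prod.cong refl) auto
  also have "\<dots> = (-1) ^ card ?N"
    by (simp add: prod.inter_filter[symmetric])
  finally show ?thesis using that 1 dt by simp
qed

section \<open>Kronecker products\<close>

lemma mult_add_less_mult:
  fixes i j a b :: nat
  assumes "i < a" "j < b" shows "i * b + j < a * b"
  using mult_le_mono1[of "Suc i" a b] assms by simp

text \<open>The encoding of a pair of indices as quotient and remainder is shared by
  \<open>kronecker\<close> and by the block matrices of \<open>induced_rep\<close>; their products
  and traces are all split here.\<close>

lemma sum_div_mod:
  fixes h :: "nat \<Rightarrow> nat \<Rightarrow> 'a::comm_monoid_add"
  shows "(\<Sum>k<a * b. h (k div b) (k mod b)) = (\<Sum>i<a. \<Sum>j<b. h i j)"
proof (cases "b = 0")
  case False
  then show ?thesis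
    unfolding sum.cartesian_product
    by (intro sum.reindex_bij_witness[of _ "\<lambda>(i, j). i * b + j" "\<lambda>k. (k div b, k mod b)"])
      (auto simp: less_mult_imp_div_less mult_add_less_mult)
qed auto

lemma prod_div:
  fixes h :: "nat \<Rightarrow> 'a::comm_monoid_mult"
  shows "(\<Prod>k<a * b. h (k div b)) = (\<Prod>i<a. h i ^ b)"
proof -
  have "(\<Prod>k<a * b. h (k div b)) = (\<Prod>i<a. \<Prod>j<b. h i)"
  proof (cases "b = 0")
    case False
    then show ?thesis
      unfolding prod.cartesian_product
      by (intro prod.reindex_bij_witness[of _ "\<lambda>(i, j). i * b + j" "\<lambda>k. (k div b, k mod b)"])
        (auto simp: less_mult_imp_div_less mult_add_less_mult)
  qed auto
  then show ?thesis by simp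
qed

lemma kronecker_dim [simp]:
  "dim_row (kronecker A B) = dim_row A * dim_row B"
  "dim_col (kronecker A B) = dim_col A * dim_col B"
  by (simp_all add: kronecker_def)

lemma kronecker_carrier:
  "A \<in> carrier_mat a b \<Longrightarrow> B \<in> carrier_mat c d \<Longrightarrow> kronecker A B \<in> carrier_mat (a * c) (b * d)"
  by (intro carrier_matI) simp_all

lemma kronecker_index:
  "i < dim_row A * dim_row B \<Longrightarrow> j < dim_col A * dim_col B \<Longrightarrow>
   kronecker A B $$ (i, j) = A $$ (i div dim_row B, j div dim_col B) * B $$ (i mod dim_row B, j mod dim_col B)"
  by (simp add: kronecker_def)

lemma div_mod_bounds:
  fixes i a b :: nat
  assumes "i < a * b" shows "i div b < a" "i mod b < b"
proof -
  show "i div b < a" using assms by (rule less_mult_imp_div_less)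
  have "b \<noteq> 0" using assms by (intro notI) simp
  then show "i mod b < b" by simp
qed

lemma kronecker_mult:
  assumes "A \<in> carrier_mat a b" "B \<in> carrier_mat c d" "A' \<in> carrier_mat b e" "B' \<in> carrier_mat d f"
  shows "kronecker A B * kronecker A' B' = kronecker (A * A') (B * B')"
proof (rule eq_matI)
  fix i j assume "i < dim_row (kronecker (A * A') (B * B'))" "j < dim_col (kronecker (A * A') (B * B'))"
  then have ij: "i < a * c" "j < e * f" using assms by auto
  note b = div_mod_bounds[OF ij(1)] div_mod_bounds[OF ij(2)]
  have "(kronecker A B * kronecker A' B') $$ (i, j) =
    (\<Sum>k<b * d. (A $$ (i div c, k div d) * B $$ (i mod c, k mod d)) *
                (A' $$ (k div d, j div f) * B' $$ (k mod d, j mod f)))"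
    using ij assms by (simp add: scalar_prod_def kronecker_index lessThan_atLeast0)
  also have "\<dots> = (\<Sum>k<b. \<Sum>l<d. (A $$ (i div c, k) * B $$ (i mod c, l)) *
                (A' $$ (k, j div f) * B' $$ (l, j mod f)))"
    by (rule sum_div_mod)
  also have "\<dots> = (\<Sum>k<b. A $$ (i div c, k) * A' $$ (k, j div f)) *
                   (\<Sum>l<d. B $$ (i mod c, l) * B' $$ (l, j mod f))"
    by (simp add: sum_product mult.left_commute mult.assoc)
  also have "\<dots> = kronecker (A * A') (B * B') $$ (i, j)"
    using ij b assms by (simp add: kronecker_index scalar_prod_def lessThan_atLeast0)
  finally show "(kronecker A B * kronecker A' B') $$ (i, j) = kronecker (A * A') (B * B') $$ (i, j)" .
qed (use assms in auto)

lemma kronecker_scalar: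
  "kronecker (x \<cdot>\<^sub>m 1\<^sub>m a) (y \<cdot>\<^sub>m 1\<^sub>m b) = (x * y) \<cdot>\<^sub>m 1\<^sub>m (a * b)"
proof (rule eq_matI)
  fix i j assume "i < dim_row ((x * y) \<cdot>\<^sub>m 1\<^sub>m (a * b))" "j < dim_col ((x * y) \<cdot>\<^sub>m 1\<^sub>m (a * b))"
  then have ij: "i < a * b" "j < a * b" by auto
  have "i = j \<longleftrightarrow> i div b = j div b \<and> i mod b = j mod b" by (metis div_mult_mod_eq)
  then show "kronecker (x \<cdot>\<^sub>m 1\<^sub>m a) (y \<cdot>\<^sub>m 1\<^sub>m b) $$ (i, j) = ((x * y) \<cdot>\<^sub>m 1\<^sub>m (a * b)) $$ (i, j)"
    using ij div_mod_bounds[OF ij(1)] div_mod_bounds[OF ij(2)] by (auto simp: kronecker_index)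
qed auto

lemma kronecker_trace:
  assumes "A \<in> carrier_mat a a" "B \<in> carrier_mat b b"
  shows "mat_trace (kronecker A B) = mat_trace A * mat_trace B"
proof -
  have "mat_trace (kronecker A B) = (\<Sum>k<a * b. A $$ (k div b, k div b) * B $$ (k mod b, k mod b))"
    using assms by (simp add: mat_trace_def kronecker_index)
  also have "\<dots> = (\<Sum>i<a. \<Sum>j<b. A $$ (i, i) * B $$ (j, j))" by (rule sum_div_mod)
  also have "\<dots> = mat_trace A * mat_trace B"
    using assms by (simp add: mat_trace_def sum_product)
  finally show ?thesis .
qed

text \<open>The carrier H is separate from G, which supplies only product and unit: the same notion
  serves for a subgroup and, with H = \<open>carrier G\<close>, for the induced representation.
  Nothing is said about values outside H.\<close>

definition matrix_rep ::
  "('g, 'm) monoid_scheme \<Rightarrow> 'g set \<Rightarrow> nat \<Rightarrow> ('g \<Rightarrow> complex mat) \<Rightarrow> bool" where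
  "matrix_rep G H d \<sigma> \<longleftrightarrow> (\<forall>h\<in>H. \<sigma> h \<in> carrier_mat d d) \<and> \<sigma> \<one>\<^bsub>G\<^esub> = 1\<^sub>m d \<and>
     (\<forall>g\<in>H. \<forall>h\<in>H. \<sigma> (g \<otimes>\<^bsub>G\<^esub> h) = \<sigma> g * \<sigma> h)"

lemma foldr_kronecker_carrier:
  "(\<And>k. k \<in> set ks \<Longrightarrow> M k \<in> carrier_mat (d k) (d k)) \<Longrightarrow>
   foldr kronecker (map M ks) (1\<^sub>m 1) \<in> carrier_mat (\<Prod>k\<leftarrow>ks. d k) (\<Prod>k\<leftarrow>ks. d k)"
  by (induction ks) (auto intro!: kronecker_carrier)

lemma foldr_kronecker_trace:
  "(\<And>k. k \<in> set ks \<Longrightarrow> M k \<in> carrier_mat (d k) (d k)) \<Longrightarrow>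
   mat_trace (foldr kronecker (map M ks) (1\<^sub>m 1)) = (\<Prod>k\<leftarrow>ks. mat_trace (M k))"
proof (induction ks)
  case (Cons k ks)
  then show ?case
    using kronecker_trace[of "M k" "d k", OF _ foldr_kronecker_carrier[of ks M d]] by simp
qed (simp add: mat_trace_def)

lemma foldr_kronecker_scalar:
  "(\<And>k. k \<in> set ks \<Longrightarrow> M k = z k \<cdot>\<^sub>m 1\<^sub>m (d k)) \<Longrightarrow>
   foldr kronecker (map M ks) (1\<^sub>m 1) = (\<Prod>k\<leftarrow>ks. z k) \<cdot>\<^sub>m 1\<^sub>m (\<Prod>k\<leftarrow>ks. d k)"
proof (induction ks)
  case Nil
  show ?case by (intro eq_matI) auto
qed (simp add: kronecker_scalar)

lemma foldr_kronecker_mult: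
  assumes "\<And>k. k \<in> set ks \<Longrightarrow> M k \<in> carrier_mat (d k) (d k)"
    "\<And>k. k \<in> set ks \<Longrightarrow> M' k \<in> carrier_mat (d k) (d k)"
  shows "foldr kronecker (map (\<lambda>k. M k * M' k) ks) (1\<^sub>m 1) =
    foldr kronecker (map M ks) (1\<^sub>m 1) * foldr kronecker (map M' ks) (1\<^sub>m 1)"
  using assms
proof (induction ks)
  case (Cons k ks)
  then show ?case
    using kronecker_mult[of "M k" "d k" "d k" _ _ _ "M' k" "d k",
        OF _ foldr_kronecker_carrier[of ks M d] _ foldr_kronecker_carrier[of ks M' d]]
    by simp
qed simp

text \<open>All factors represent the same H. The external product over G(b_1,r) x ... x G(b_r,r)
  fits this form once each factor is pulled back along its projection.\<close>

lemma matrix_rep_kronecker: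
  assumes "\<And>k. k \<in> set ks \<Longrightarrow> matrix_rep G H (d k) (\<sigma> k)"
  shows "matrix_rep G H (\<Prod>k\<leftarrow>ks. d k) (\<lambda>h. foldr kronecker (map (\<lambda>k. \<sigma> k h) ks) (1\<^sub>m 1))"
proof -
  have one: "1 \<cdot>\<^sub>m 1\<^sub>m m = (1\<^sub>m m :: complex mat)" for m by (intro eq_matI) auto
  have "foldr kronecker (map (\<lambda>k. \<sigma> k \<one>\<^bsub>G\<^esub>) ks) (1\<^sub>m 1) = (\<Prod>k\<leftarrow>ks. 1) \<cdot>\<^sub>m 1\<^sub>m (\<Prod>k\<leftarrow>ks. d k)"
    using assms by (intro foldr_kronecker_scalar) (auto simp: matrix_rep_def one)
  then have "foldr kronecker (map (\<lambda>k. \<sigma> k \<one>\<^bsub>G\<^esub>) ks) (1\<^sub>m 1) = 1\<^sub>m (\<Prod>k\<leftarrow>ks. d k)"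
    by (simp add: map_replicate_const one)
  moreover have "foldr kronecker (map (\<lambda>k. \<sigma> k (g \<otimes>\<^bsub>G\<^esub> h)) ks) (1\<^sub>m 1) =
    foldr kronecker (map (\<lambda>k. \<sigma> k g) ks) (1\<^sub>m 1) * foldr kronecker (map (\<lambda>k. \<sigma> k h) ks) (1\<^sub>m 1)"
    if "g \<in> H" "h \<in> H" for g h
  proof -
    have "map (\<lambda>k. \<sigma> k (g \<otimes>\<^bsub>G\<^esub> h)) ks = map (\<lambda>k. \<sigma> k g * \<sigma> k h) ks"
      using assms that by (auto simp: matrix_rep_def)
    moreover have "foldr kronecker (map (\<lambda>k. \<sigma> k g * \<sigma> k h) ks) (1\<^sub>m 1) =
      foldr kronecker (map (\<lambda>k. \<sigma> k g) ks) (1\<^sub>m 1) * foldr kronecker (map (\<lambda>k. \<sigma> k h) ks) (1\<^sub>m 1)"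
      using assms that by (intro foldr_kronecker_mult) (auto simp: matrix_rep_def)
    ultimately show ?thesis by (simp only:)
  qed
  ultimately show ?thesis
    using assms foldr_kronecker_carrier[of ks _ d] unfolding matrix_rep_def by auto
qed

section \<open>Coset representatives\<close>

text \<open>Discharges the choice in the definition: picking one element from each left coset gives
  a finite set of representatives, so the chosen list has the stated properties.\<close>

lemma left_transversal:
  assumes "group G" "subgroup H G" "finite (carrier G)"
  shows "distinct (left_transversal G H)" "set (left_transversal G H) \<subseteq> carrier G"
    "\<And>g. g \<in> carrier G \<Longrightarrow> \<exists>!t. t \<in> set (left_transversal G H) \<and> g \<in> t <#\<^bsub>G\<^esub> H"
proof -
  interpret group G by fact
  let ?C = "(\<lambda>t. t <#\<^bsub>G\<^esub> H) ` carrier G"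
  define rep where "rep C = (SOME t. t \<in> C)" for C :: "'a set"
  have rep: "rep C \<in> C" "rep C \<in> carrier G" "rep C <#\<^bsub>G\<^esub> H = C" if C: "C \<in> ?C" for C
  proof -
    obtain x where x: "x \<in> carrier G" "C = x <#\<^bsub>G\<^esub> H" using C by auto
    have "x \<in> C" using x lcos_self[OF x(1) assms(2)] by simp
    then show r: "rep C \<in> C" unfolding rep_def by (rule someI)
    show "rep C \<in> carrier G"
      using r x l_coset_subset_G[OF subgroup.subset[OF assms(2)]] by auto
    show "rep C <#\<^bsub>G\<^esub> H = C" using l_repr_independence[OF _ x(1) assms(2), of "rep C"] r x(2) by simp
  qed
  have fin: "finite (rep ` ?C)"
    using assms(3) by simp
  obtain ts where "set ts = rep ` ?C \<and> distinct ts" using finite_distinct_list[OF fin] ..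
  then have ts: "set ts = rep ` ?C" "distinct ts" by auto
  have "\<exists>!t. t \<in> set ts \<and> g \<in> t <#\<^bsub>G\<^esub> H" if g: "g \<in> carrier G" for g
  proof (rule ex1I[of _ "rep (g <#\<^bsub>G\<^esub> H)"])
    have gC: "g <#\<^bsub>G\<^esub> H \<in> ?C" using g by auto
    then show "rep (g <#\<^bsub>G\<^esub> H) \<in> set ts \<and> g \<in> rep (g <#\<^bsub>G\<^esub> H) <#\<^bsub>G\<^esub> H"
      using rep(3)[OF gC] ts lcos_self[OF g assms(2)] by auto
    fix t assume t: "t \<in> set ts \<and> g \<in> t <#\<^bsub>G\<^esub> H"
    then obtain C where C: "C \<in> ?C" "t = rep C" using ts by auto
    have "C = g <#\<^bsub>G\<^esub> H"
      using l_repr_independence[of g t H] t C rep[OF C(1)] assms(2) by simp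
    then show "t = rep (g <#\<^bsub>G\<^esub> H)" using C by simp
  qed
  moreover have "set ts \<subseteq> carrier G" unfolding ts(1) using rep(2) by (rule image_subsetI)
  ultimately have "\<exists>ts. distinct ts \<and> set ts \<subseteq> carrier G \<and>
     (\<forall>g\<in>carrier G. \<exists>!t. t \<in> set ts \<and> g \<in> t <#\<^bsub>G\<^esub> H)" using ts(2) by blast
  from someI_ex[OF this] show "distinct (left_transversal G H)" "set (left_transversal G H) \<subseteq> carrier G"
    "\<And>g. g \<in> carrier G \<Longrightarrow> \<exists>!t. t \<in> set (left_transversal G H) \<and> g \<in> t <#\<^bsub>G\<^esub> H"
    unfolding left_transversal_def by auto
qed

lemma mem_l_coset_iff:
  assumes "group G" "subgroup H G" "t \<in> carrier G" "g \<in> carrier G"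
  shows "g \<in> t <#\<^bsub>G\<^esub> H \<longleftrightarrow> inv\<^bsub>G\<^esub> t \<otimes>\<^bsub>G\<^esub> g \<in> H"
proof -
  interpret group G by fact
  interpret H: subgroup H G by fact
  show ?thesis
  proof
    assume "g \<in> t <#\<^bsub>G\<^esub> H"
    then obtain h where h: "h \<in> H" "g = t \<otimes>\<^bsub>G\<^esub> h" by (auto simp: l_coset_def)
    moreover have "inv\<^bsub>G\<^esub> t \<otimes>\<^bsub>G\<^esub> (t \<otimes>\<^bsub>G\<^esub> h) = h"
      using h(1) assms by (simp add: m_assoc[symmetric])
    ultimately show "inv\<^bsub>G\<^esub> t \<otimes>\<^bsub>G\<^esub> g \<in> H" by (simp only:)
  next
    assume *: "inv\<^bsub>G\<^esub> t \<otimes>\<^bsub>G\<^esub> g \<in> H"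
    have "t \<otimes>\<^bsub>G\<^esub> (inv\<^bsub>G\<^esub> t \<otimes>\<^bsub>G\<^esub> g) = g" using assms by (simp add: m_assoc[symmetric])
    with * show "g \<in> t <#\<^bsub>G\<^esub> H"
      unfolding l_coset_def by (intro UN_I[of "inv\<^bsub>G\<^esub> t \<otimes>\<^bsub>G\<^esub> g"]) simp_all
  qed
qed

text \<open>Applied to g t_j, this says that every block column of an induced matrix has exactly one
  block whose argument lies in H.\<close>

lemma unique_coset_index:
  assumes "group G" "subgroup H G" "finite (carrier G)" "g \<in> carrier G"
  obtains l where "l < length (left_transversal G H)"
    "\<And>i. i < length (left_transversal G H) \<Longrightarrow>
      inv\<^bsub>G\<^esub> (left_transversal G H ! i) \<otimes>\<^bsub>G\<^esub> g \<in> H \<longleftrightarrow> i = l"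
proof -
  let ?ts = "left_transversal G H"
  note ts = left_transversal[OF assms(1-3)]
  obtain t where t: "t \<in> set ?ts" "g \<in> t <#\<^bsub>G\<^esub> H"
    "\<And>t'. t' \<in> set ?ts \<Longrightarrow> g \<in> t' <#\<^bsub>G\<^esub> H \<Longrightarrow> t' = t"
    using ts(3)[OF assms(4)] by blast
  from t(1) obtain l where l: "l < length ?ts" "?ts ! l = t" by (auto simp: in_set_conv_nth)
  have "inv\<^bsub>G\<^esub> (?ts ! i) \<otimes>\<^bsub>G\<^esub> g \<in> H \<longleftrightarrow> i = l" if i: "i < length ?ts" for i
  proof -
    have "inv\<^bsub>G\<^esub> (?ts ! i) \<otimes>\<^bsub>G\<^esub> g \<in> H \<longleftrightarrow> g \<in> ?ts ! i <#\<^bsub>G\<^esub> H"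
      using mem_l_coset_iff[OF assms(1,2) _ assms(4)] ts(2) nth_mem[OF i] by blast
    also have "\<dots> \<longleftrightarrow> ?ts ! i = t" using t nth_mem[OF i] by metis
    also have "\<dots> \<longleftrightarrow> i = l" using nth_eq_iff_index_eq[OF ts(1) i l(1)] l(2) by simp
    finally show ?thesis .
  qed
  then show ?thesis using that l(1) by blast
qed

lemma transversal_orthogonal:
  assumes "group G" "subgroup H G" "finite (carrier G)"
    and i: "i < length (left_transversal G H)" and j: "j < length (left_transversal G H)"
  shows "inv\<^bsub>G\<^esub> (left_transversal G H ! i) \<otimes>\<^bsub>G\<^esub> left_transversal G H ! j \<in> H \<longleftrightarrow> i = j"
proof -
  let ?ts = "left_transversal G H"
  have "?ts ! j \<in> carrier G"
    using left_transversal(2)[OF assms(1-3)] nth_mem[OF j] by blast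
  moreover from this have "inv\<^bsub>G\<^esub> (?ts ! j) \<otimes>\<^bsub>G\<^esub> ?ts ! j \<in> H"
    using assms(1,2) by (simp add: group.l_inv subgroup.one_closed)
  ultimately show ?thesis
    using unique_coset_index[OF assms(1-3), of "?ts ! j"] i j by metis
qed

text \<open>G is the disjoint union of the cosets t_i H and P is constant on each of them, so every
  index satisfying P accounts for |H| elements of G. This removes the unknown transversal from all
  later counts.\<close>

lemma card_transversal_filter:
  assumes "group G" "subgroup H G" "finite (carrier G)"
    and P: "\<And>g h. g \<in> carrier G \<Longrightarrow> h \<in> H \<Longrightarrow> P (g \<otimes>\<^bsub>G\<^esub> h) \<longleftrightarrow> P g"
  shows "card {i. i < length (left_transversal G H) \<and> P (left_transversal G H ! i)} * card H =
    card {g \<in> carrier G. P g}"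
proof -
  interpret group G by fact
  interpret H: subgroup H G by fact
  let ?ts = "left_transversal G H"
  let ?I = "{i. i < length ?ts \<and> P (?ts ! i)}"
  have tc: "?ts ! i \<in> carrier G" if "i < length ?ts" for i
    using left_transversal(2)[OF assms(1-3)] nth_mem[OF that] by blast
  have "bij_betw (\<lambda>(i, h). ?ts ! i \<otimes>\<^bsub>G\<^esub> h) (?I \<times> H) {g \<in> carrier G. P g}"
    unfolding bij_betw_def
  proof
    show "inj_on (\<lambda>(i, h). ?ts ! i \<otimes>\<^bsub>G\<^esub> h) (?I \<times> H)"
    proof (rule inj_onI, clarify)
      fix i h j k
      assume ij: "i < length ?ts" "j < length ?ts" and hk: "h \<in> H" "k \<in> H"
        and eq: "?ts ! i \<otimes>\<^bsub>G\<^esub> h = ?ts ! j \<otimes>\<^bsub>G\<^esub> k"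
      have "inv\<^bsub>G\<^esub> (?ts ! i) \<otimes>\<^bsub>G\<^esub> ?ts ! j = inv\<^bsub>G\<^esub> (?ts ! i) \<otimes>\<^bsub>G\<^esub> (?ts ! j \<otimes>\<^bsub>G\<^esub> k) \<otimes>\<^bsub>G\<^esub> inv\<^bsub>G\<^esub> k"
        using tc ij hk by (simp add: m_assoc)
      also have "\<dots> = h \<otimes>\<^bsub>G\<^esub> inv\<^bsub>G\<^esub> k"
        unfolding eq[symmetric] using tc ij hk by (simp add: m_assoc[symmetric])
      finally have "i = j"
        using transversal_orthogonal[OF assms(1-3) ij] hk by simp
      then show "i = j \<and> h = k" using eq tc ij hk by simp
    qed
    show "(\<lambda>(i, h). ?ts ! i \<otimes>\<^bsub>G\<^esub> h) ` (?I \<times> H) = {g \<in> carrier G. P g}"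
    proof (rule equalityI; rule subsetI)
      fix g assume "g \<in> (\<lambda>(i, h). ?ts ! i \<otimes>\<^bsub>G\<^esub> h) ` (?I \<times> H)"
      then show "g \<in> {g \<in> carrier G. P g}" using tc P by auto
    next
      fix g assume g: "g \<in> {g \<in> carrier G. P g}"
      then obtain l where l: "l < length ?ts" "inv\<^bsub>G\<^esub> (?ts ! l) \<otimes>\<^bsub>G\<^esub> g \<in> H"
        using unique_coset_index[OF assms(1-3), of g] by blast
      have e: "?ts ! l \<otimes>\<^bsub>G\<^esub> (inv\<^bsub>G\<^esub> (?ts ! l) \<otimes>\<^bsub>G\<^esub> g) = g"
        using g tc[OF l(1)] by (simp add: m_assoc[symmetric])
      then have "P (?ts ! l)" using P[OF tc[OF l(1)] l(2)] g by simp
      then show "g \<in> (\<lambda>(i, h). ?ts ! i \<otimes>\<^bsub>G\<^esub> h) ` (?I \<times> H)"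
        using l e by (intro image_eqI[of _ _ "(l, inv\<^bsub>G\<^esub> (?ts ! l) \<otimes>\<^bsub>G\<^esub> g)"]) auto
    qed
  qed
  from bij_betw_same_card[OF this] show ?thesis by (simp add: card_cartesian_product)
qed

section \<open>Induced representations as block matrices\<close>

context
  fixes G :: "('g, 'm) monoid_scheme" and H :: "'g set" and \<sigma> :: "'g \<Rightarrow> complex mat" and d :: nat
  assumes grp: "group G" and sub: "subgroup H G" and fin: "finite (carrier G)"
    and rep: "matrix_rep G H d \<sigma>"
begin

private abbreviation "reps \<equiv> left_transversal G H"

lemma induced_rep_carrier: "induced_rep G H \<sigma> g \<in> carrier_mat (length reps * d) (length reps * d)"
proof -
  have "dim_row (\<sigma> \<one>\<^bsub>G\<^esub>) = d" using rep by (simp add: matrix_rep_def)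
  then show ?thesis by (simp add: induced_rep_def Let_def)
qed

lemma induced_rep_index:
  assumes "i < length reps * d" "j < length reps * d"
  shows "induced_rep G H \<sigma> g $$ (i, j) =
    (let h = inv\<^bsub>G\<^esub> (reps ! (i div d)) \<otimes>\<^bsub>G\<^esub> g \<otimes>\<^bsub>G\<^esub> (reps ! (j div d)) in
      if h \<in> H then \<sigma> h $$ (i mod d, j mod d) else 0)"
proof -
  have "dim_row (\<sigma> \<one>\<^bsub>G\<^esub>) = d" using rep by (simp add: matrix_rep_def)
  then show ?thesis using assms by (simp add: induced_rep_def Let_def)
qed

private lemma reps_carrier: "i < length reps \<Longrightarrow> reps ! i \<in> carrier G"
  using left_transversal(2)[OF grp sub fin] nth_mem by blast

text \<open>In the sum over intermediate blocks only the representative t_m of the coset of g' u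
  survives, and there the two arguments \<open>h m\<close> and \<open>h' m\<close> multiply to
  t^{-1} g g' u.\<close>

lemma induced_rep_mult:
  assumes g: "g \<in> carrier G" and g': "g' \<in> carrier G"
  shows "induced_rep G H \<sigma> (g \<otimes>\<^bsub>G\<^esub> g') = induced_rep G H \<sigma> g * induced_rep G H \<sigma> g'"
proof (rule eq_matI)
  interpret group G by (rule grp)
  interpret H: subgroup H G by (rule sub)
  let ?A = "induced_rep G H \<sigma>"
  fix i j assume "i < dim_row (?A g * ?A g')" "j < dim_col (?A g * ?A g')"
  then have ij: "i < length reps * d" "j < length reps * d"
    using carrier_matD[OF induced_rep_carrier[of g]] carrier_matD[OF induced_rep_carrier[of g']] by auto
  note b = div_mod_bounds[OF ij(1)] div_mod_bounds[OF ij(2)]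
  define t where "t = reps ! (i div d)"
  define u where "u = reps ! (j div d)"
  have tu: "t \<in> carrier G" "u \<in> carrier G" using b reps_carrier by (auto simp: t_def u_def)
  define h where "h l = inv\<^bsub>G\<^esub> t \<otimes>\<^bsub>G\<^esub> g \<otimes>\<^bsub>G\<^esub> reps ! l" for l
  define h' where "h' l = inv\<^bsub>G\<^esub> (reps ! l) \<otimes>\<^bsub>G\<^esub> g' \<otimes>\<^bsub>G\<^esub> u" for l
  obtain m where m: "m < length reps" "\<And>l. l < length reps \<Longrightarrow> h' l \<in> H \<longleftrightarrow> l = m"
  proof (rule unique_coset_index[OF grp sub fin, of "g' \<otimes>\<^bsub>G\<^esub> u"])
    show "g' \<otimes>\<^bsub>G\<^esub> u \<in> carrier G" using g' tu by simp
    fix m assume "m < length reps" "\<And>i. i < length reps \<Longrightarrow> (inv\<^bsub>G\<^esub> (reps ! i) \<otimes>\<^bsub>G\<^esub> (g' \<otimes>\<^bsub>G\<^esub> u) \<in> H) = (i = m)"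
    then show thesis using that[of m] g' tu reps_carrier by (simp add: h'_def m_assoc)
  qed
  have hm': "h' m \<in> H" using m by blast
  have hh: "h m \<otimes>\<^bsub>G\<^esub> h' m = inv\<^bsub>G\<^esub> t \<otimes>\<^bsub>G\<^esub> (g \<otimes>\<^bsub>G\<^esub> g') \<otimes>\<^bsub>G\<^esub> u"
  proof -
    have "h m \<otimes>\<^bsub>G\<^esub> h' m =
      inv\<^bsub>G\<^esub> t \<otimes>\<^bsub>G\<^esub> g \<otimes>\<^bsub>G\<^esub> (reps ! m \<otimes>\<^bsub>G\<^esub> inv\<^bsub>G\<^esub> (reps ! m)) \<otimes>\<^bsub>G\<^esub> (g' \<otimes>\<^bsub>G\<^esub> u)"
      unfolding h_def h'_def using g g' tu reps_carrier[OF m(1)] by (simp add: m_assoc del: r_inv l_inv Units_r_inv Units_l_inv)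
    then show ?thesis using g g' tu reps_carrier[OF m(1)] by (simp add: m_assoc)
  qed
  have hm: "h m \<in> carrier G" using g tu reps_carrier[OF m(1)] by (simp add: h_def)
  \<comment> \<open>Since \<open>h' m\<close> is in H, the entries on both sides vanish under the
    same condition.\<close>
  have mem: "h m \<otimes>\<^bsub>G\<^esub> h' m \<in> H \<longleftrightarrow> h m \<in> H"
  proof
    assume "h m \<otimes>\<^bsub>G\<^esub> h' m \<in> H"
    then have "h m \<otimes>\<^bsub>G\<^esub> h' m \<otimes>\<^bsub>G\<^esub> inv\<^bsub>G\<^esub> h' m \<in> H" using hm' by simp
    then show "h m \<in> H" using hm hm' by (simp add: m_assoc)
  qed (use hm' in simp)
  have "(?A g * ?A g') $$ (i, j) =
    (\<Sum>k<length reps * d. (if h (k div d) \<in> H then \<sigma> (h (k div d)) $$ (i mod d, k mod d) else 0) *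
      (if h' (k div d) \<in> H then \<sigma> (h' (k div d)) $$ (k mod d, j mod d) else 0))"
    unfolding h_def h'_def t_def u_def
    using ij carrier_matD[OF induced_rep_carrier[of g]] carrier_matD[OF induced_rep_carrier[of g']]
    by (simp add: scalar_prod_def induced_rep_index Let_def lessThan_atLeast0)
  also have "\<dots> = (\<Sum>l<length reps. \<Sum>c<d. (if h l \<in> H then \<sigma> (h l) $$ (i mod d, c) else 0) *
      (if h' l \<in> H then \<sigma> (h' l) $$ (c, j mod d) else 0))"
    by (rule sum_div_mod)
  also have "\<dots> = (\<Sum>l<length reps. if l = m then
      (\<Sum>c<d. (if h m \<in> H then \<sigma> (h m) $$ (i mod d, c) else 0) * \<sigma> (h' m) $$ (c, j mod d)) else 0)"
    using m(2) by (intro sum.cong refl) auto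
  also have "\<dots> = (\<Sum>c<d. (if h m \<in> H then \<sigma> (h m) $$ (i mod d, c) else 0) * \<sigma> (h' m) $$ (c, j mod d))"
    using m(1) by simp
  also have "\<dots> = (if h m \<in> H then \<sigma> (h m \<otimes>\<^bsub>G\<^esub> h' m) $$ (i mod d, j mod d) else 0)"
  proof (cases "h m \<in> H")
    case True
    then have "\<sigma> (h m) \<in> carrier_mat d d" "\<sigma> (h' m) \<in> carrier_mat d d"
      "\<sigma> (h m \<otimes>\<^bsub>G\<^esub> h' m) = \<sigma> (h m) * \<sigma> (h' m)"
      using rep hm' by (auto simp: matrix_rep_def)
    then show ?thesis using True b by (simp add: scalar_prod_def lessThan_atLeast0)
  qed simp
  also have "\<dots> = ?A (g \<otimes>\<^bsub>G\<^esub> g') $$ (i, j)"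
    using ij by (simp add: induced_rep_index Let_def mem[symmetric] hh t_def[symmetric] u_def[symmetric])
  finally show "?A (g \<otimes>\<^bsub>G\<^esub> g') $$ (i, j) = (?A g * ?A g') $$ (i, j)" ..
qed (simp_all add: carrier_matD[OF induced_rep_carrier])

lemma induced_rep_one: "induced_rep G H \<sigma> \<one>\<^bsub>G\<^esub> = 1\<^sub>m (length reps * d)"
proof (rule eq_matI)
  interpret group G by (rule grp)
  fix i j assume "i < dim_row (1\<^sub>m (length reps * d) :: complex mat)" "j < dim_col (1\<^sub>m (length reps * d) :: complex mat)"
  then have ij: "i < length reps * d" "j < length reps * d" by auto
  note b = div_mod_bounds[OF ij(1)] div_mod_bounds[OF ij(2)]
  have s1: "\<sigma> \<one>\<^bsub>G\<^esub> = 1\<^sub>m d" using rep by (simp add: matrix_rep_def)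
  have "i = j \<longleftrightarrow> i div d = j div d \<and> i mod d = j mod d" by (metis div_mult_mod_eq)
  then show "induced_rep G H \<sigma> \<one>\<^bsub>G\<^esub> $$ (i, j) = 1\<^sub>m (length reps * d) $$ (i, j)"
    using ij b transversal_orthogonal[OF grp sub fin b(1) b(3)] reps_carrier[OF b(1)] reps_carrier[OF b(3)] s1
    by (auto simp: induced_rep_index Let_def)
qed (simp_all add: carrier_matD[OF induced_rep_carrier])

lemma matrix_rep_induced: "matrix_rep G (carrier G) (length reps * d) (induced_rep G H \<sigma>)"
  unfolding matrix_rep_def using induced_rep_carrier induced_rep_one induced_rep_mult by auto

lemma induced_rep_trace:
  "mat_trace (induced_rep G H \<sigma> g) = (\<Sum>i<length reps.
     let h = inv\<^bsub>G\<^esub> (reps ! i) \<otimes>\<^bsub>G\<^esub> g \<otimes>\<^bsub>G\<^esub> reps ! i in if h \<in> H then mat_trace (\<sigma> h) else 0)"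
proof -
  define h where "h i = inv\<^bsub>G\<^esub> (reps ! i) \<otimes>\<^bsub>G\<^esub> g \<otimes>\<^bsub>G\<^esub> reps ! i" for i
  have "mat_trace (induced_rep G H \<sigma> g) =
    (\<Sum>k<length reps * d. if h (k div d) \<in> H then \<sigma> (h (k div d)) $$ (k mod d, k mod d) else 0)"
    unfolding h_def using carrier_matD[OF induced_rep_carrier[of g]]
    by (simp add: mat_trace_def induced_rep_index Let_def)
  also have "\<dots> = (\<Sum>i<length reps. \<Sum>a<d. if h i \<in> H then \<sigma> (h i) $$ (a, a) else 0)"
    by (rule sum_div_mod)
  also have "\<dots> = (\<Sum>i<length reps. if h i \<in> H then mat_trace (\<sigma> (h i)) else 0)"
    using rep by (intro sum.cong refl) (auto simp: mat_trace_def matrix_rep_def)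
  finally show ?thesis unfolding h_def Let_def .
qed

text \<open>Tailored to the diagonal subgroup: all conjugates of g by representatives stay in H and
  act there by scalars, which forces the whole induced matrix to be diagonal.\<close>

lemma induced_rep_det_scalar:
  assumes g: "g \<in> carrier G"
    and mem: "\<And>i. i < length reps \<Longrightarrow> inv\<^bsub>G\<^esub> (reps ! i) \<otimes>\<^bsub>G\<^esub> g \<otimes>\<^bsub>G\<^esub> reps ! i \<in> H"
    and scal: "\<And>i. i < length reps \<Longrightarrow>
      \<sigma> (inv\<^bsub>G\<^esub> (reps ! i) \<otimes>\<^bsub>G\<^esub> g \<otimes>\<^bsub>G\<^esub> reps ! i) = z i \<cdot>\<^sub>m 1\<^sub>m d"
  shows "det (induced_rep G H \<sigma> g) = (\<Prod>i<length reps. z i ^ d)"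
proof -
  interpret group G by (rule grp)
  interpret H: subgroup H G by (rule sub)
  let ?A = "induced_rep G H \<sigma> g"
  \<comment> \<open>With a = t_i^{-1} g, both a t_i and a t_j lie in H, hence so does (a t_i)^{-1}
    (a t_j) = t_i^{-1} t_j.\<close>
  have off: "i = j" if "i < length reps" "j < length reps"
    "inv\<^bsub>G\<^esub> (reps ! i) \<otimes>\<^bsub>G\<^esub> g \<otimes>\<^bsub>G\<^esub> reps ! j \<in> H" for i j
  proof -
    let ?t = "reps ! i" and ?u = "reps ! j"
    note c = reps_carrier[OF that(1)] reps_carrier[OF that(2)]
    define a where "a = inv\<^bsub>G\<^esub> ?t \<otimes>\<^bsub>G\<^esub> g"
    have a: "a \<in> carrier G" using c g by (simp add: a_def)
    have "inv\<^bsub>G\<^esub> ?t \<otimes>\<^bsub>G\<^esub> ?u = inv\<^bsub>G\<^esub> ?t \<otimes>\<^bsub>G\<^esub> (inv\<^bsub>G\<^esub> a \<otimes>\<^bsub>G\<^esub> a) \<otimes>\<^bsub>G\<^esub> ?u"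
      using c a by simp
    also have "\<dots> = inv\<^bsub>G\<^esub> (a \<otimes>\<^bsub>G\<^esub> ?t) \<otimes>\<^bsub>G\<^esub> (a \<otimes>\<^bsub>G\<^esub> ?u)"
      using c a by (simp add: inv_mult_group m_assoc del: l_inv Units_l_inv)
    also have "\<dots> = inv\<^bsub>G\<^esub> (inv\<^bsub>G\<^esub> ?t \<otimes>\<^bsub>G\<^esub> g \<otimes>\<^bsub>G\<^esub> ?t) \<otimes>\<^bsub>G\<^esub> (inv\<^bsub>G\<^esub> ?t \<otimes>\<^bsub>G\<^esub> g \<otimes>\<^bsub>G\<^esub> ?u)"
      by (simp only: a_def)
    also have "\<dots> \<in> H" using that(3) mem[OF that(1)] by blast
    finally show ?thesis using transversal_orthogonal[OF grp sub fin that(1,2)] by blast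
  qed
  have entry: "?A $$ (i, j) = (if i = j then z (i div d) else 0)"
    if ij: "i < length reps * d" "j < length reps * d" for i j
  proof -
    note b = div_mod_bounds[OF ij(1)] div_mod_bounds[OF ij(2)]
    have "i = j \<longleftrightarrow> i div d = j div d \<and> i mod d = j mod d" by (metis div_mult_mod_eq)
    then show ?thesis
      using ij b mem[OF b(1)] scal[OF b(1)] off[OF b(1) b(3)]
      by (cases "i div d = j div d") (auto simp: induced_rep_index Let_def)
  qed
  have "upper_triangular ?A"
    using carrier_matD[OF induced_rep_carrier[of g]] by (auto simp: entry)
  then have "det ?A = (\<Prod>k<length reps * d. ?A $$ (k, k))"
    using det_upper_triangular[OF _ induced_rep_carrier] carrier_matD[OF induced_rep_carrier[of g]]
    by (simp add: prod_list_diag_prod lessThan_atLeast0)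
  also have "\<dots> = (\<Prod>k<length reps * d. z (k div d))" by (intro prod.cong refl) (simp add: entry)
  also have "\<dots> = (\<Prod>i<length reps. z i ^ d)" by (rule prod_div)
  finally show ?thesis .
qed

end

section \<open>Specht modules\<close>

text \<open>With n = \<open>card A\<close>, the elements of A outside {..<n} and the gaps of A
  inside {..<n} are equally many. The former are at least n and the latter are below n, so any gap
  makes the sum strictly larger.\<close>

lemma sum_ge_initial_segment:
  fixes A :: "nat set"
  assumes "finite A"
  shows "\<Sum>{..<card A} \<le> \<Sum>A"
    and "\<Sum>A \<le> \<Sum>{..<card A} \<Longrightarrow> A = {..<card A}"
proof -
  define n where "n = card A"
  define N where "N = {..<n}"
  have fN: "finite N" "card N = n" by (auto simp: N_def)
  have card_eq: "card (A - N) = card (N - A)"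
    using card_Diff_subset_Int[of A N] card_Diff_subset_Int[of N A] assms fN
    by (simp add: n_def Int_commute)
  have sA: "\<Sum>A = \<Sum>(A \<inter> N) + \<Sum>(A - N)"
    using sum.Int_Diff[OF assms] by blast
  have sN: "\<Sum>N = \<Sum>(A \<inter> N) + \<Sum>(N - A)"
    using sum.Int_Diff[OF fN(1), of "\<lambda>x. x" A] by (simp add: Int_commute)
  have lo: "card (A - N) * n \<le> \<Sum>(A - N)"
    using sum_bounded_below[of "A - N" n "\<lambda>x. x"] by (auto simp: N_def not_less)
  have hi: "\<Sum>(N - A) \<le> card (N - A) * n"
    using sum_bounded_above[of "N - A" "\<lambda>x. x" n] by (auto simp: N_def)
  show "\<Sum>{..<card A} \<le> \<Sum>A"
    using sA sN lo hi card_eq by (simp add: N_def n_def)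
  assume le: "\<Sum>A \<le> \<Sum>{..<card A}"
  have "N - A = {}"
  proof (rule ccontr)
    assume ne: "N - A \<noteq> {}"
    have "\<Sum>(N - A) < card (N - A) * n"
      using sum_bounded_above_strict[of "N - A" "\<lambda>x. x" n] ne fN
      by (auto simp: N_def card_gt_0_iff)
    with le sA sN lo card_eq show False by (simp add: N_def n_def)
  qed
  moreover have "A - N = {}"
    using calculation card_eq assms by (metis card_0_eq card.empty finite_Diff)
  ultimately show "A = {..<card A}" by (auto simp: N_def n_def)
qed

text \<open>If no two points share both a row and a column of the permuted filling, then in each row the
  columns hit are pairwise distinct, so their indices sum to at least those of the left-justified
  row. The total over all rows is the same, hence equality holds row by row, and each row can be
  rearranged to make the columns match.\<close>

lemma row_column_factorization:
  fixes row :: "'a \<Rightarrow> 'b" and col :: "'a \<Rightarrow> nat"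
  assumes fin: "finite X"
    and left_justified: "\<And>i. bij_betw col {x \<in> X. row x = i} {..<card {x \<in> X. row x = i}}"
    and u: "u permutes X"
    and sep: "\<And>x y. x \<in> X \<Longrightarrow> y \<in> X \<Longrightarrow> x \<noteq> y \<Longrightarrow> row x = row y \<Longrightarrow>
                col (inv' u x) \<noteq> col (inv' u y)"
  obtains p q where "p permutes X" "q permutes X" "\<And>x. x \<in> X \<Longrightarrow> row (p x) = row x"
    "\<And>x. x \<in> X \<Longrightarrow> col (q x) = col x" "u = p \<circ> q"
proof -
  define R where "R i = {x \<in> X. row x = i}" for i
  define c where "c x = col (inv' u x)" for x
  have iu: "inv' u permutes X" using u by (rule permutes_inv)
  have finR: "finite (R i)" for i using fin by (auto simp: R_def)
  have bR: "bij_betw col (R i) {..<card (R i)}" for i using left_justified by (simp add: R_def)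
  have inj_c: "inj_on c (R i)" for i
  proof (rule inj_onI, rule ccontr)
    fix x y assume "x \<in> R i" "y \<in> R i" "c x = c y" "x \<noteq> y"
    then show False using sep[of x y] by (simp add: c_def R_def)
  qed
  have cc: "card (c ` R i) = card (R i)" for i by (rule card_image[OF inj_c])
  have ge: "(\<Sum>x\<in>R i. col x) \<le> (\<Sum>x\<in>R i. c x)" for i
  proof -
    have "(\<Sum>x\<in>R i. col x) = \<Sum>{..<card (R i)}"
      by (rule sum.reindex_bij_betw[OF bR])
    also have "\<dots> \<le> \<Sum>(c ` R i)"
      using sum_ge_initial_segment(1)[of "c ` R i"] finR cc by simp
    also have "\<dots> = (\<Sum>x\<in>R i. c x)"
      by (simp add: sum.reindex[OF inj_c])
    finally show ?thesis .
  qed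
  have grp: "(\<Sum>i\<in>row ` X. \<Sum>x\<in>R i. h x) = (\<Sum>x\<in>X. h x)" for h :: "'a \<Rightarrow> nat"
    unfolding R_def by (rule sum.group) (auto simp: fin)
  have tot: "(\<Sum>i\<in>row ` X. \<Sum>x\<in>R i. c x) = (\<Sum>i\<in>row ` X. \<Sum>x\<in>R i. col x)"
    unfolding grp c_def using sum.permute[OF iu, of col] by (simp add: o_def)
  have eq: "(\<Sum>x\<in>R i. col x) = (\<Sum>x\<in>R i. c x)" if "i \<in> row ` X" for i
    using sum_mono_inv[OF tot[symmetric] ge that] fin by simp
  have img: "c ` R i = {..<card (R i)}" if "i \<in> row ` X" for i
  proof -
    have "\<Sum>(c ` R i) = (\<Sum>x\<in>R i. col x)"
      by (simp add: sum.reindex[OF inj_c] eq[OF that])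
    also have "\<dots> = \<Sum>{..<card (R i)}"
      by (rule sum.reindex_bij_betw[OF bR])
    finally show ?thesis
      using sum_ge_initial_segment(2)[of "c ` R i"] finR cc by simp
  qed
  \<comment> \<open>\<open>p'\<close> moves x inside its own row to the cell whose column is that of
    \<open>inv' u x\<close>. Then \<open>p' \<circ> u\<close> preserves columns, and the row factor
    of u is the inverse of \<open>p'\<close>.\<close>
  define p' where "p' x = (if x \<in> X then inv_into (R (row x)) col (c x) else x)" for x
  have p'1: "p' x \<in> R (row x)" "col (p' x) = c x" if "x \<in> X" for x
  proof -
    have "c x \<in> col ` R (row x)"
      using img[of "row x"] bR[of "row x"] that
      by (auto simp: bij_betw_def R_def)
    then show "p' x \<in> R (row x)" "col (p' x) = c x"
      unfolding p'_def using that by (auto intro: inv_into_into f_inv_into_f)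
  qed
  have "inj_on p' X"
  proof (rule inj_onI)
    fix x y assume xy: "x \<in> X" "y \<in> X" "p' x = p' y"
    then have "row x = row y" "c x = c y" using p'1[of x] p'1[of y] by (auto simp: R_def)
    then show "x = y" using inj_c[of "row x"] xy by (auto simp: inj_on_def R_def)
  qed
  moreover have "p' ` X \<subseteq> X" using p'1 by (auto simp: R_def)
  ultimately have "bij_betw p' X X"
    using fin by (simp add: bij_betw_def endo_inj_surj)
  then have pp: "p' permutes X"
    by (rule bij_imp_permutes) (simp add: p'_def)
  show ?thesis
  proof
    show "inv' p' permutes X" using pp by (rule permutes_inv)
    show "p' \<circ> u permutes X" using u pp by (rule permutes_compose)
    show "row (inv' p' x) = row x" if "x \<in> X" for x
      using p'1(1)[of "inv' p' x"] permutes_in_image[OF permutes_inv[OF pp], of x] that pp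
      by (simp add: R_def permutes_inverses)
    show "col ((p' \<circ> u) x) = col x" if "x \<in> X" for x
      using p'1(2)[of "u x"] that u by (simp add: c_def permutes_in_image permutes_inverses)
    show "u = inv' p' \<circ> (p' \<circ> u)"
      using pp by (simp add: fun_eq_iff permutes_inverses)
  qed
qed

section \<open>Consecutive blocks and coordinates of cells\<close>

lemma offset_Suc: "k < length bs \<Longrightarrow> offset bs (Suc k) = offset bs k + bs ! k"
  by (simp add: offset_def take_Suc_conv_app_nth)

lemma offset_mono: "i \<le> j \<Longrightarrow> offset bs i \<le> offset bs j"
  unfolding offset_def
  by (metis le_add1 le_add_diff_inverse sum_list_append take_add)

lemma offset_length: "offset bs (length bs) = sum_list bs"
  by (simp add: offset_def)

lemma offset_le: "offset bs k \<le> sum_list bs"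
  by (metis append_take_drop_id le_add1 offset_def sum_list_append)

lemma block_subset: "k < length bs \<Longrightarrow> block bs k \<subseteq> {1..sum_list bs}"
  using offset_le[of bs "Suc k"] by (auto simp: block_def offset_Suc)

lemma block_disjoint:
  assumes "i < length bs" "j < length bs" "x \<in> block bs i" "x \<in> block bs j"
  shows "i = j"
proof (rule ccontr)
  assume "i \<noteq> j"
  then consider "i < j" | "j < i" by linarith
  then show False
  proof cases
    case 1
    then show ?thesis using assms offset_mono[of "Suc i" j bs] by (auto simp: block_def offset_Suc)
  next
    case 2
    then show ?thesis using assms offset_mono[of "Suc j" i bs] by (auto simp: block_def offset_Suc)
  qed
qed

lemma block_cover:
  assumes "x \<in> {1..sum_list bs}"
  shows "\<exists>k<length bs. x \<in> block bs k"
proof -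
  have "\<exists>k<K. x \<in> block bs k" if "x \<in> {1..offset bs K}" "K \<le> length bs" for K
    using that
  proof (induction K)
    case 0
    then show ?case by (simp add: offset_def)
  next
    case (Suc K)
    show ?case
    proof (cases "x \<le> offset bs K")
      case True
      with Suc show ?thesis by (auto simp: less_Suc_eq)
    next
      case False
      with Suc.prems show ?thesis
        by (intro exI[of _ K]) (auto simp: block_def offset_Suc)
    qed
  qed
  from this[of "length bs"] assms show ?thesis by (simp add: offset_length)
qed

text \<open>Stabilizing every block becomes invariance of this one function, a condition that
  composes and inverts pointwise. Its value is meaningful only on {1..sum_list bs}.\<close>

definition block_index :: "nat list \<Rightarrow> nat \<Rightarrow> nat" where
  "block_index bs x = (THE k. k < length bs \<and> x \<in> block bs k)"

lemma block_indexI: "k < length bs \<Longrightarrow> x \<in> block bs k \<Longrightarrow> block_index bs x = k"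
  unfolding block_index_def using block_disjoint by (intro the_equality) auto

lemma block_index:
  assumes "x \<in> {1..sum_list bs}"
  shows "block_index bs x < length bs" "x \<in> block bs (block_index bs x)"
  using block_cover[OF assms] block_indexI by auto

lemma block_eq: "k < length bs \<Longrightarrow> block bs k = {x \<in> {1..sum_list bs}. block_index bs x = k}"
  using block_subset[of k bs] block_index block_indexI by blast

definition column_index :: "nat list \<Rightarrow> nat \<Rightarrow> nat" where
  "column_index \<mu> x = x - offset \<mu> (block_index \<mu> x) - 1"

lemma column_eq: "column \<mu> j = {x \<in> {1..sum_list \<mu>}. column_index \<mu> x = j}"
proof (rule equalityI; rule subsetI)
  fix x assume "x \<in> column \<mu> j"
  then obtain i where i: "x = offset \<mu> i + j + 1" "i < length \<mu>" "j < \<mu> ! i"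
    by (auto simp: column_def)
  then have "x \<in> block \<mu> i" by (auto simp: block_def)
  then show "x \<in> {x \<in> {1..sum_list \<mu>}. column_index \<mu> x = j}"
    using i block_indexI[of i \<mu> x] block_subset[of i \<mu>] by (auto simp: column_index_def)
next
  fix x assume "x \<in> {x \<in> {1..sum_list \<mu>}. column_index \<mu> x = j}"
  then show "x \<in> column \<mu> j"
    using block_index[of x \<mu>]
    by (auto simp: column_def column_index_def block_def intro!: exI[of _ "block_index \<mu> x"])
qed

text \<open>Invariance of h gives only an inclusion of each image in its fibre; finiteness and
  injectivity turn it into equality. The set K allows both the finitely many rows and the columns
  indexed by all naturals.\<close>

lemma preserves_fibres_iff:
  assumes p: "p permutes X" and "finite X"
  shows "(\<forall>k\<in>K. p ` {x \<in> X. h x = k} = {x \<in> X. h x = k}) \<longleftrightarrow> (\<forall>x\<in>X. h x \<in> K \<longrightarrow> h (p x) = h x)"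
    (is "?L \<longleftrightarrow> ?R")
proof
  assume ?L
  show ?R
  proof (intro ballI impI)
    fix x assume "x \<in> X" "h x \<in> K"
    then have "p x \<in> p ` {y \<in> X. h y = h x}" by auto
    with \<open>?L\<close> \<open>h x \<in> K\<close> show "h (p x) = h x" by auto
  qed
next
  assume ?R
  show ?L
  proof
    fix k assume "k \<in> K"
    then have "p ` {x \<in> X. h x = k} \<subseteq> {x \<in> X. h x = k}"
      using \<open>?R\<close> p by (auto simp: permutes_in_image)
    then show "p ` {x \<in> X. h x = k} = {x \<in> X. h x = k}"
      using assms permutes_inj_on[OF p] by (intro endo_inj_surj) auto
  qed
qed

lemma preserves_blocks_iff:
  assumes p: "p permutes {1..sum_list bs}"
  shows "(\<forall>k<length bs. p ` block bs k = block bs k) \<longleftrightarrow>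
         (\<forall>x\<in>{1..sum_list bs}. block_index bs (p x) = block_index bs x)"
  using preserves_fibres_iff[OF p, of "{..<length bs}" "block_index bs"] block_index(1)[of _ bs]
  by (auto simp: block_eq)

lemma row_group_iff:
  "p \<in> row_group \<mu> \<longleftrightarrow> p permutes {1..sum_list \<mu>} \<and>
     (\<forall>x\<in>{1..sum_list \<mu>}. block_index \<mu> (p x) = block_index \<mu> x)"
  unfolding row_group_def using preserves_blocks_iff[of p \<mu>] by auto

lemma column_group_iff:
  "q \<in> column_group \<mu> \<longleftrightarrow> q permutes {1..sum_list \<mu>} \<and>
     (\<forall>x\<in>{1..sum_list \<mu>}. column_index \<mu> (q x) = column_index \<mu> x)"
  unfolding column_group_def column_eq
  using preserves_fibres_iff[of q "{1..sum_list \<mu>}" UNIV "column_index \<mu>"] by auto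

text \<open>This is the hypothesis \<open>left_justified\<close> of
  \<open>row_column_factorization\<close> for the standard filling; indices i beyond the last row
  give empty rows.\<close>

lemma column_index_bij_betw_row:
  "bij_betw (column_index \<mu>) {x \<in> {1..sum_list \<mu>}. block_index \<mu> x = i}
     {..<card {x \<in> {1..sum_list \<mu>}. block_index \<mu> x = i}}"
proof (cases "i < length \<mu>")
  case True
  have "bij_betw (\<lambda>x. x - offset \<mu> i - 1) (block \<mu> i) {..<\<mu> ! i}"
    by (rule bij_betwI[where g = "\<lambda>j. offset \<mu> i + j + 1"]) (auto simp: block_def)
  moreover have "column_index \<mu> x = x - offset \<mu> i - 1" if "x \<in> block \<mu> i" for x
    using block_indexI[OF True that] by (simp add: column_index_def)
  moreover have "card (block \<mu> i) = \<mu> ! i" by (simp add: block_def)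
  ultimately have "bij_betw (column_index \<mu>) (block \<mu> i) {..<card (block \<mu> i)}"
    using bij_betw_cong[of "block \<mu> i" "column_index \<mu>" "\<lambda>x. x - offset \<mu> i - 1"] by simp
  then show ?thesis unfolding block_eq[OF True] .
next
  case False
  then have empty: "{x \<in> {1..sum_list \<mu>}. block_index \<mu> x = i} = {}" using block_index(1)[of _ \<mu>] by auto
  show ?thesis unfolding empty by (simp add: bij_betw_def)
qed

lemma cell_eqI:
  assumes "x \<in> {1..sum_list \<mu>}" "y \<in> {1..sum_list \<mu>}"
    "block_index \<mu> x = block_index \<mu> y" "column_index \<mu> x = column_index \<mu> y"
  shows "x = y"
  using column_index_bij_betw_row[of \<mu> "block_index \<mu> x"] assms
  by (auto simp: bij_betw_def inj_on_def)

section \<open>Row group, column group and Young symmetrizer\<close>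

abbreviation Sym :: "nat \<Rightarrow> (nat \<Rightarrow> nat) set" where
  "Sym m \<equiv> {w. w permutes {1..m}}"

lemma finite_row_group: "finite (row_group \<mu>)" and finite_column_group: "finite (column_group \<mu>)"
  by (auto intro: finite_subset[OF _ finite_permutations[of "{1..sum_list \<mu>}"]]
      simp: row_group_def column_group_def)

lemma row_group_comp: "p \<in> row_group \<mu> \<Longrightarrow> p' \<in> row_group \<mu> \<Longrightarrow> p \<circ> p' \<in> row_group \<mu>"
  by (simp add: row_group_iff permutes_compose permutes_in_image del: atLeastAtMost_iff)

lemma column_group_comp: "p \<in> column_group \<mu> \<Longrightarrow> p' \<in> column_group \<mu> \<Longrightarrow> p \<circ> p' \<in> column_group \<mu>"
  by (simp add: column_group_iff permutes_compose permutes_in_image del: atLeastAtMost_iff)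

lemma row_group_inv:
  assumes "p \<in> row_group \<mu>" shows "inv' p \<in> row_group \<mu>"
  unfolding row_group_iff
proof (intro conjI ballI)
  have p: "p permutes {1..sum_list \<mu>}" using assms by (simp add: row_group_iff)
  show "inv' p permutes {1..sum_list \<mu>}" using p by (rule permutes_inv)
  fix x assume "x \<in> {1..sum_list \<mu>}"
  then have "inv' p x \<in> {1..sum_list \<mu>}" using permutes_in_image[OF permutes_inv[OF p]] by blast
  then have "block_index \<mu> (p (inv' p x)) = block_index \<mu> (inv' p x)"
    using assms by (simp add: row_group_iff)
  then show "block_index \<mu> (inv' p x) = block_index \<mu> x" using p by (simp add: permutes_inverses)
qed

lemma column_group_inv:
  assumes "p \<in> column_group \<mu>" shows "inv' p \<in> column_group \<mu>"
  unfolding column_group_iff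
proof (intro conjI ballI)
  have p: "p permutes {1..sum_list \<mu>}" using assms by (simp add: column_group_iff)
  show "inv' p permutes {1..sum_list \<mu>}" using p by (rule permutes_inv)
  fix x assume "x \<in> {1..sum_list \<mu>}"
  then have "inv' p x \<in> {1..sum_list \<mu>}" using permutes_in_image[OF permutes_inv[OF p]] by blast
  then have "column_index \<mu> (p (inv' p x)) = column_index \<mu> (inv' p x)"
    using assms by (simp add: column_group_iff)
  then show "column_index \<mu> (inv' p x) = column_index \<mu> x" using p by (simp add: permutes_inverses)
qed

lemma row_column_id:
  assumes "p \<in> row_group \<mu>" "p \<in> column_group \<mu>" shows "p = id"
proof
  fix x show "p x = id x"
  proof (cases "x \<in> {1..sum_list \<mu>}")
    case True
    then show ?thesis using assms cell_eqI[of "p x" \<mu> x]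
      by (simp add: row_group_iff column_group_iff permutes_in_image del: atLeastAtMost_iff)
  next
    case False
    then show ?thesis using assms by (metis row_group_iff permutes_not_in id_apply)
  qed
qed

lemma permutes_comp_inverses:
  assumes "p permutes S" shows "inv' p \<circ> p = id" "p \<circ> inv' p = id"
  using permutes_inv_o[OF assms] by auto

text \<open>From p' q' = p q one gets p^{-1} p' = q q'^{-1}, an element of both groups. It fixes the
  row and the column of every cell, hence is the identity.\<close>

lemma row_column_unique:
  assumes "p \<in> row_group \<mu>" "p' \<in> row_group \<mu>" "q \<in> column_group \<mu>" "q' \<in> column_group \<mu>"
    and eq: "p' \<circ> q' = p \<circ> q"
  shows "p' = p" "q' = q"
proof -
  have perm: "p permutes {1..sum_list \<mu>}" "p' permutes {1..sum_list \<mu>}"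
    "q permutes {1..sum_list \<mu>}" "q' permutes {1..sum_list \<mu>}"
    using assms by (auto simp: row_group_iff column_group_iff)
  have "inv' p \<circ> p' = inv' p \<circ> (p' \<circ> q') \<circ> inv' q'"
    by (simp add: o_assoc[symmetric] permutes_comp_inverses[OF perm(4)])
  also have "\<dots> = q \<circ> inv' q'"
    by (simp add: eq o_assoc permutes_comp_inverses[OF perm(1)])
  finally have e: "inv' p \<circ> p' = q \<circ> inv' q'" .
  have "inv' p \<circ> p' = id"
    using row_group_comp[OF row_group_inv[OF assms(1)] assms(2)]
      column_group_comp[OF assms(3) column_group_inv[OF assms(4)]] e
    by (intro row_column_id) auto
  then have "p \<circ> (inv' p \<circ> p') = p" by simp
  then show 1: "p' = p"
    by (simp add: o_assoc permutes_comp_inverses[OF perm(1)])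
  have "inv' p \<circ> (p \<circ> q') = inv' p \<circ> (p \<circ> q)" using eq 1 by simp
  then show "q' = q"
    by (simp add: o_assoc permutes_comp_inverses[OF perm(1)])
qed

text \<open>The factorization p q is unique, so a single term of the defining double sum
  survives.\<close>

lemma young_symmetrizer_row_column:
  assumes "p \<in> row_group \<mu>" "q \<in> column_group \<mu>"
  shows "young_symmetrizer \<mu> (p \<circ> q) = of_int (sign q)"
proof -
  have "young_symmetrizer \<mu> (p \<circ> q) =
    (\<Sum>p'\<in>row_group \<mu>. \<Sum>q'\<in>column_group \<mu>. if p' = p \<and> q' = q then of_int (sign q) else 0)"
    unfolding young_symmetrizer_def
    using row_column_unique[OF assms(1) _ assms(2)] by (intro sum.cong refl) auto
  also have "\<dots> = (\<Sum>p'\<in>row_group \<mu>. if p' = p then of_int (sign q) else 0)"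
    using assms finite_column_group by (intro sum.cong refl) (auto simp: sum.delta)
  also have "\<dots> = of_int (sign q)"
    using assms finite_row_group by (auto simp: sum.delta)
  finally show ?thesis .
qed

lemma young_symmetrizer_eq_0:
  assumes "\<And>p q. p \<in> row_group \<mu> \<Longrightarrow> q \<in> column_group \<mu> \<Longrightarrow> u \<noteq> p \<circ> q"
  shows "young_symmetrizer \<mu> u = 0"
  unfolding young_symmetrizer_def using assms by (intro sum.neutral ballI) auto

lemma id_in_row_column_group: "id \<in> row_group \<mu>" "id \<in> column_group \<mu>"
  by (auto simp: row_group_iff column_group_iff permutes_id)

lemma young_symmetrizer_id: "young_symmetrizer \<mu> id = 1"
  using young_symmetrizer_row_column[OF id_in_row_column_group, of \<mu>] by simp

lemma young_symmetrizer_outside: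
  assumes "\<not> u permutes {1..sum_list \<mu>}" shows "young_symmetrizer \<mu> u = 0"
  using assms by (intro young_symmetrizer_eq_0) (auto simp: row_group_iff column_group_iff permutes_compose)

lemma young_symmetrizer_Ints: "young_symmetrizer \<mu> u \<in> \<int>"
  unfolding young_symmetrizer_def by (intro Ints_sum) auto

lemma sign_mult_column:
  "q \<in> column_group \<mu> \<Longrightarrow> q' \<in> column_group \<mu> \<Longrightarrow> sign (q' \<circ> q) = sign q' * sign q"
  unfolding column_group_iff
  by (meson finite_atLeastAtMost permutation_permutes sign_compose)

lemma young_symmetrizer_row_mult:
  assumes p: "p \<in> row_group \<mu>"
  shows "young_symmetrizer \<mu> (p \<circ> u) = young_symmetrizer \<mu> u"
proof (cases "\<exists>p'\<in>row_group \<mu>. \<exists>q\<in>column_group \<mu>. u = p' \<circ> q")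
  case True
  then show ?thesis
    using young_symmetrizer_row_column[OF row_group_comp[OF p]] young_symmetrizer_row_column
    by (auto simp: o_assoc)
next
  case False
  have perm: "p permutes {1..sum_list \<mu>}" using p by (simp add: row_group_iff)
  have "p \<circ> u \<noteq> p' \<circ> q" if "p' \<in> row_group \<mu>" "q \<in> column_group \<mu>" for p' q
  proof
    assume e: "p \<circ> u = p' \<circ> q"
    have "u = inv' p \<circ> (p \<circ> u)" by (simp add: o_assoc permutes_comp_inverses[OF perm])
    then have "u = (inv' p \<circ> p') \<circ> q" by (simp add: e o_assoc)
    then show False using False that row_group_comp[OF row_group_inv[OF p]] by blast
  qed
  then show ?thesis using False by (simp add: young_symmetrizer_eq_0)
qed

lemma young_symmetrizer_column_mult:
  assumes q: "q \<in> column_group \<mu>"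
  shows "young_symmetrizer \<mu> (u \<circ> q) = of_int (sign q) * young_symmetrizer \<mu> u"
proof (cases "\<exists>p\<in>row_group \<mu>. \<exists>q'\<in>column_group \<mu>. u = p \<circ> q'")
  case True
  then obtain p q' where u: "p \<in> row_group \<mu>" "q' \<in> column_group \<mu>" "u = p \<circ> q'" by blast
  show ?thesis
    using young_symmetrizer_row_column[OF u(1) column_group_comp[OF u(2) q]]
      young_symmetrizer_row_column[OF u(1,2)] sign_mult_column[OF q u(2)] u(3)
    by (simp add: o_assoc)
next
  case False
  have perm: "q permutes {1..sum_list \<mu>}" using q by (simp add: column_group_iff)
  have "u \<circ> q \<noteq> p \<circ> q'" if "p \<in> row_group \<mu>" "q' \<in> column_group \<mu>" for p q'
  proof
    assume e: "u \<circ> q = p \<circ> q'"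
    have "u = u \<circ> q \<circ> inv' q" by (simp add: o_assoc[symmetric] permutes_comp_inverses[OF perm])
    then have "u = p \<circ> (q' \<circ> inv' q)" by (simp add: e o_assoc)
    then show False using False that column_group_comp[OF _ column_group_inv[OF q]] by blast
  qed
  then show ?thesis using False by (simp add: young_symmetrizer_eq_0)
qed

section \<open>The Young symmetrizer is proportional to its square\<close>

text \<open>The coefficient of u in the convolution square c^2 of c =
  \<open>young_symmetrizer \<mu>\<close>. The value at \<open>id\<close> is the scalar kappa with
  c^2 = kappa c.\<close>

definition symmetrizer_square :: "nat list \<Rightarrow> (nat \<Rightarrow> nat) \<Rightarrow> complex" where
  "symmetrizer_square \<mu> u =
     (\<Sum>w\<in>Sym (sum_list \<mu>). young_symmetrizer \<mu> w * young_symmetrizer \<mu> (inv' w \<circ> u))"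

lemma inv_comp_permutes:
  "v permutes S \<Longrightarrow> w permutes S \<Longrightarrow> inv' (v \<circ> w) = inv' w \<circ> inv' v"
  by (intro o_inv_distrib permutes_bij)

text \<open>Substituting p w for w moves p into the first factor, where c absorbs it from the
  left.\<close>

lemma symmetrizer_square_row_mult:
  assumes p: "p \<in> row_group \<mu>"
  shows "symmetrizer_square \<mu> (p \<circ> u) = symmetrizer_square \<mu> u"
proof -
  have perm: "p permutes {1..sum_list \<mu>}" using p by (simp add: row_group_iff)
  have "inv' (p \<circ> w) \<circ> (p \<circ> u) = inv' w \<circ> u" if "w \<in> Sym (sum_list \<mu>)" for w
  proof -
    have "inv' (p \<circ> w) \<circ> (p \<circ> u) = inv' w \<circ> (inv' p \<circ> p) \<circ> u"
      using that by (simp add: inv_comp_permutes[OF perm] o_assoc)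
    then show ?thesis by (simp add: permutes_comp_inverses[OF perm])
  qed
  then have "(\<Sum>w\<in>Sym (sum_list \<mu>). young_symmetrizer \<mu> (p \<circ> w) *
      young_symmetrizer \<mu> (inv' (p \<circ> w) \<circ> (p \<circ> u))) = symmetrizer_square \<mu> u"
    unfolding symmetrizer_square_def
    by (intro sum.cong refl) (simp add: young_symmetrizer_row_mult[OF p])
  then show ?thesis
    unfolding symmetrizer_square_def by (subst setum_permutations_compose_left[OF perm])
qed

lemma symmetrizer_square_column_mult:
  assumes q: "q \<in> column_group \<mu>"
  shows "symmetrizer_square \<mu> (u \<circ> q) = of_int (sign q) * symmetrizer_square \<mu> u"
  unfolding symmetrizer_square_def o_assoc young_symmetrizer_column_mult[OF q]
  by (simp add: sum_distrib_left mult.left_commute)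

lemma transpose_comp_permutes:
  assumes "u permutes S"
  shows "transpose x y \<circ> u = u \<circ> transpose (inv' u x) (inv' u y)"
  using permutes_inverses[OF assms] permutes_inj[OF assms]
  by (auto simp: fun_eq_iff transpose_def)

text \<open>Off the product of row and column group, a transposition in the row group of \<open>\<mu>\<close> acts on \<open>u\<close> from
  the left like one in the column group from the right, which forces the value \<open>0\<close>.\<close>

lemma symmetrizer_square_eq:
  "symmetrizer_square \<mu> u = symmetrizer_square \<mu> id * young_symmetrizer \<mu> u"
proof (cases "\<exists>p\<in>row_group \<mu>. \<exists>q\<in>column_group \<mu>. u = p \<circ> q")
  case True
  then obtain p q where u: "p \<in> row_group \<mu>" "q \<in> column_group \<mu>" "u = p \<circ> q" by blast
  have "symmetrizer_square \<mu> u = symmetrizer_square \<mu> (id \<circ> q)"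
    by (simp only: u(3) symmetrizer_square_row_mult[OF u(1)] id_comp)
  then show ?thesis
    by (simp only: symmetrizer_square_column_mult[OF u(2)] u(3)
        young_symmetrizer_row_column[OF u(1,2)] mult.commute)
next
  case not_rc: False
  show ?thesis
  proof (cases "u permutes {1..sum_list \<mu>}")
    case False
    \<comment> \<open>These are functions on all maps of naturals. When u is not a permutation of
      {1..m}, neither is w^{-1} u, so every summand has its second factor outside the support of
      c.\<close>
    have "\<not> inv' w \<circ> u permutes {1..sum_list \<mu>}" if "w permutes {1..sum_list \<mu>}" for w
    proof
      assume "inv' w \<circ> u permutes {1..sum_list \<mu>}"
      then have "w \<circ> (inv' w \<circ> u) permutes {1..sum_list \<mu>}"
        using that by (rule permutes_compose)
      then show False using False by (simp add: o_assoc permutes_comp_inverses[OF that])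
    qed
    then have "symmetrizer_square \<mu> u = 0"
      unfolding symmetrizer_square_def
      by (intro sum.neutral ballI) (simp add: young_symmetrizer_outside del: One_nat_def)
    then show ?thesis by (simp only: young_symmetrizer_outside[OF False] mult_zero_right)
  next
    case True
    \<comment> \<open>Contrapositive of the row-column factorization: without such a pair, u would
      be a product p q.\<close>
    have "\<exists>x y. x \<in> {1..sum_list \<mu>} \<and> y \<in> {1..sum_list \<mu>} \<and> x \<noteq> y \<and>
      block_index \<mu> x = block_index \<mu> y \<and> column_index \<mu> (inv' u x) = column_index \<mu> (inv' u y)"
    proof (rule ccontr)
      assume *: "\<not> ?thesis"
      from row_column_factorization[OF finite_atLeastAtMost column_index_bij_betw_row True]
      obtain p q where "p permutes {1..sum_list \<mu>}" "q permutes {1..sum_list \<mu>}" "u = p \<circ> q"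
        "\<forall>x\<in>{1..sum_list \<mu>}. block_index \<mu> (p x) = block_index \<mu> x"
        "\<forall>x\<in>{1..sum_list \<mu>}. column_index \<mu> (q x) = column_index \<mu> x"
        using * by metis
      then have "p \<in> row_group \<mu>" "q \<in> column_group \<mu>"
        unfolding row_group_iff column_group_iff by blast+
      with \<open>u = p \<circ> q\<close> show False using not_rc by blast
    qed
    then obtain x y where xy: "x \<in> {1..sum_list \<mu>}" "y \<in> {1..sum_list \<mu>}" "x \<noteq> y"
      "block_index \<mu> x = block_index \<mu> y" "column_index \<mu> (inv' u x) = column_index \<mu> (inv' u y)"
      by blast
    define x' where "x' = inv' u x"
    define y' where "y' = inv' u y"
    have xy': "x' \<in> {1..sum_list \<mu>}" "y' \<in> {1..sum_list \<mu>}" "x' \<noteq> y'"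
      using xy permutes_in_image[OF permutes_inv[OF True]] permutes_inj[OF permutes_inv[OF True]]
      by (auto simp: x'_def y'_def inj_eq simp del: atLeastAtMost_iff)
    have "transpose x y \<in> row_group \<mu>"
      using xy by (auto simp: row_group_iff permutes_swap_id transpose_def simp del: atLeastAtMost_iff)
    moreover have q: "transpose x' y' \<in> column_group \<mu>"
      using xy' xy(5) by (auto simp: column_group_iff permutes_swap_id transpose_def x'_def y'_def
          simp del: atLeastAtMost_iff)
    ultimately have "symmetrizer_square \<mu> u = symmetrizer_square \<mu> (u \<circ> transpose x' y')"
      using symmetrizer_square_row_mult[of "transpose x y" \<mu> u]
      by (simp add: transpose_comp_permutes[OF True] x'_def y'_def)
    also have "\<dots> = - symmetrizer_square \<mu> u"
      using xy'(3) by (simp add: symmetrizer_square_column_mult[OF q] sign_swap_id)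
    finally have "symmetrizer_square \<mu> u = 0" by simp
    then show ?thesis using not_rc by (simp add: young_symmetrizer_eq_0)
  qed
qed

lemma sum_fun_apply: "(\<Sum>i\<in>I. (f i :: 'a \<Rightarrow> 'b::comm_monoid_add)) x = (\<Sum>i\<in>I. f i x)"
  by (induction I rule: infinite_finite_induct) auto

text \<open>The product f * c in the group algebra, written as a combination of the left translates
  w c.\<close>

definition right_mult :: "nat list \<Rightarrow> ((nat \<Rightarrow> nat) \<Rightarrow> complex) \<Rightarrow> (nat \<Rightarrow> nat) \<Rightarrow> complex" where
  "right_mult \<mu> f u = (\<Sum>w\<in>Sym (sum_list \<mu>). f w * translate w (young_symmetrizer \<mu>) u)"

lemma right_mult_young_symmetrizer:
  "right_mult \<mu> (young_symmetrizer \<mu>) u = symmetrizer_square \<mu> id * young_symmetrizer \<mu> u"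
  unfolding symmetrizer_square_eq[symmetric]
  by (simp add: right_mult_def symmetrizer_square_def translate_def)

lemma translate_comp:
  assumes "v permutes S" "w permutes S"
  shows "translate (v \<circ> w) f = translate v (translate w f)"
  by (simp add: translate_def inv_comp_permutes[OF assms] o_assoc)

text \<open>Left and right multiplication commute; in the sum this is the substitution of v w for
  w.\<close>

lemma right_mult_translate:
  assumes v: "v permutes {1..sum_list \<mu>}"
  shows "right_mult \<mu> (translate v f) = translate v (right_mult \<mu> f)"
proof
  fix u
  have "right_mult \<mu> (translate v f) u = (\<Sum>w\<in>Sym (sum_list \<mu>). f (inv' v \<circ> (v \<circ> w)) *
          translate (v \<circ> w) (young_symmetrizer \<mu>) u)"
    unfolding right_mult_def
    by (subst setum_permutations_compose_left[OF v]) (simp add: translate_def[of v f])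
  also have "\<dots> = (\<Sum>w\<in>Sym (sum_list \<mu>). f w * translate v (translate w (young_symmetrizer \<mu>)) u)"
    using translate_comp[OF v]
    by (intro sum.cong refl) (simp add: o_assoc permutes_comp_inverses[OF v])
  finally show "right_mult \<mu> (translate v f) u = translate v (right_mult \<mu> f) u"
    by (simp add: right_mult_def translate_def)
qed

text \<open>On the generator c this is c^2 = kappa c. It passes to the translates w c because right
  multiplication commutes with translation, and to their span by linearity.\<close>

lemma right_mult_specht:
  assumes "f \<in> specht \<mu>"
  shows "right_mult \<mu> f = (\<lambda>u. symmetrizer_square \<mu> id * f u)"
  using assms unfolding specht_def
proof (induction rule: fun_vs.span_induct_alt)
  case base
  show ?case by (simp add: right_mult_def fun_eq_iff)
next
  case (step c x y)
  then obtain w where w: "w permutes {1..sum_list \<mu>}" "x = translate w (young_symmetrizer \<mu>)" by auto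
  have x: "right_mult \<mu> x = (\<lambda>u. symmetrizer_square \<mu> id * x u)"
    using right_mult_young_symmetrizer[of \<mu>]
    unfolding w(2) right_mult_translate[OF w(1)] by (simp add: translate_def fun_eq_iff)
  have lin: "right_mult \<mu> ((\<lambda>u. c * x u) + y) u = c * right_mult \<mu> x u + right_mult \<mu> y u" for u
    by (simp add: right_mult_def sum.distrib sum_distrib_left algebra_simps)
  show ?case
    unfolding fun_eq_iff lin x step(2) by (simp add: algebra_simps)
qed

section \<open>Dimension and matrices of the Specht module\<close>

text \<open>A maximal independent subset of the finite set of translates witnesses the choice in the
  definition of \<open>specht_basis\<close>.\<close>

lemma specht_basis:
  shows "distinct (specht_basis \<mu>)" "fun_vs.independent (set (specht_basis \<mu>))"
    "fun_vs.span (set (specht_basis \<mu>)) = specht \<mu>" "length (specht_basis \<mu>) = f_dim \<mu>"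
proof -
  let ?S = "{translate w (young_symmetrizer \<mu>) | w. w permutes {1..sum_list \<mu>}}"
  have fin: "finite ?S" using finite_permutations[of "{1..sum_list \<mu>}"] by simp
  obtain B where B: "B \<subseteq> ?S" "fun_vs.independent B" "?S \<subseteq> fun_vs.span B"
    by (rule fun_vs.maximal_independent_subset)
  have "fun_vs.span B = specht \<mu>"
    unfolding specht_def
    using fun_vs.span_mono[OF B(1)] fun_vs.span_minimal[OF B(3) fun_vs.subspace_span] by (rule subset_antisym)
  moreover obtain bs where "set bs = B" "distinct bs"
    using finite_distinct_list[OF finite_subset[OF B(1) fin]] by blast
  ultimately have "\<exists>bs. distinct bs \<and> fun_vs.independent (set bs) \<and> fun_vs.span (set bs) = specht \<mu>"
    using B by blast
  from someI_ex[OF this] show *: "distinct (specht_basis \<mu>)"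
    "fun_vs.independent (set (specht_basis \<mu>))" "fun_vs.span (set (specht_basis \<mu>)) = specht \<mu>"
    unfolding specht_basis_def by auto
  show "length (specht_basis \<mu>) = f_dim \<mu>"
    using fun_vs.dim_span_eq_card_independent[OF *(2)]
    by (simp add: f_dim_def *(3) distinct_card[OF *(1)])
qed

abbreviation coord :: "nat list \<Rightarrow> ((nat \<Rightarrow> nat) \<Rightarrow> complex) \<Rightarrow> ((nat \<Rightarrow> nat) \<Rightarrow> complex) \<Rightarrow> complex" where
  "coord \<mu> \<equiv> fun_vs.representation (set (specht_basis \<mu>))"

lemma specht_expand:
  assumes "f \<in> specht \<mu>"
  shows "f u = (\<Sum>b\<in>set (specht_basis \<mu>). coord \<mu> f b * b u)"
proof -
  have "(\<Sum>b\<in>set (specht_basis \<mu>). (\<lambda>x. coord \<mu> f b * b x)) = f"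
    using fun_vs.sum_representation_eq[OF specht_basis(2), of f \<mu> "set (specht_basis \<mu>)"]
      assms specht_basis(3) by simp
  from fun_cong[OF this, of u] show ?thesis by (simp add: sum_fun_apply)
qed

lemma translate_in_specht:
  "w permutes {1..sum_list \<mu>} \<Longrightarrow> translate w (young_symmetrizer \<mu>) \<in> specht \<mu>"
  unfolding specht_def by (rule fun_vs.span_base) auto

lemma coord_sum:
  assumes "\<And>i. i \<in> I \<Longrightarrow> f i \<in> specht \<mu>"
  shows "coord \<mu> (\<Sum>i\<in>I. (\<lambda>u. c i * f i u)) b = (\<Sum>i\<in>I. c i * coord \<mu> (f i) b)"
proof -
  have f: "f i \<in> fun_vs.span (set (specht_basis \<mu>))" if "i \<in> I" for i
    using assms[OF that] by (simp add: specht_basis(3))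
  have "coord \<mu> (\<Sum>i\<in>I. (\<lambda>u. c i * f i u)) = (\<lambda>b. \<Sum>i\<in>I. coord \<mu> (\<lambda>u. c i * f i u) b)"
    by (intro fun_vs.representation_sum specht_basis(2) fun_vs.span_scale f)
  then show ?thesis
    by (simp add: fun_vs.representation_scale[OF specht_basis(2) f])
qed

text \<open>Right multiplication by the Young symmetrizer \<open>c\<close> maps the group algebra onto \<open>specht \<mu>\<close>,
  where it acts as the scalar \<open>\<kappa>\<close> with \<open>c\<^sup>2 = \<kappa> c\<close>; its trace is \<open>m!\<close>, since \<open>c\<close> has coefficient
  \<open>1\<close> at the identity.\<close>

lemma symmetrizer_square_times_f_dim:
  "symmetrizer_square \<mu> id * of_nat (f_dim \<mu>) = fact (sum_list \<mu>)"
proof -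
  let ?B = "set (specht_basis \<mu>)" and ?S = "Sym (sum_list \<mu>)" and ?k = "symmetrizer_square \<mu> id"
  let ?t = "\<lambda>w. translate w (young_symmetrizer \<mu>)"
  \<comment> \<open>The left side is the coordinate at b of b * c, which equals kappa b.\<close>
  have diag: "(\<Sum>w\<in>?S. b w * coord \<mu> (?t w) b) = ?k" if "b \<in> ?B" for b
  proof -
    have bs: "b \<in> specht \<mu>" using that fun_vs.span_base specht_basis(3) by blast
    have "(\<Sum>w\<in>?S. b w * coord \<mu> (?t w) b) = coord \<mu> (\<Sum>w\<in>?S. (\<lambda>u. b w * ?t w u)) b"
      by (rule coord_sum[symmetric]) (simp add: translate_in_specht)
    also have "(\<Sum>w\<in>?S. (\<lambda>u. b w * ?t w u)) = right_mult \<mu> b"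
      by (simp add: fun_eq_iff sum_fun_apply right_mult_def)
    also have "coord \<mu> (right_mult \<mu> b) b = ?k * coord \<mu> b b"
      using bs by (simp add: right_mult_specht fun_vs.representation_scale[OF specht_basis(2)] specht_basis(3))
    also have "coord \<mu> b b = 1"
      using fun_vs.representation_basis[OF specht_basis(2) that] by simp
    finally show ?thesis by (simp only: mult_1_right)
  qed
  have "fact (sum_list \<mu>) = (\<Sum>w\<in>?S. (1::complex))"
    using card_permutations[of "{1..sum_list \<mu>}" "sum_list \<mu>"] by simp
  \<comment> \<open>The coefficient of w in w c is c(id) = 1, so this is the trace of right
    multiplication by c in the basis of permutations. Expanding each w c in the basis of the Specht
    module regroups the same trace over that basis.\<close>
  also have "\<dots> = (\<Sum>w\<in>?S. ?t w w)"
    by (intro sum.cong refl) (simp add: translate_def permutes_comp_inverses young_symmetrizer_id)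
  also have "\<dots> = (\<Sum>w\<in>?S. \<Sum>b\<in>?B. coord \<mu> (?t w) b * b w)"
    by (intro sum.cong refl specht_expand translate_in_specht) simp
  also have "\<dots> = (\<Sum>b\<in>?B. \<Sum>w\<in>?S. b w * coord \<mu> (?t w) b)"
    by (subst sum.swap) (simp add: mult.commute)
  also have "\<dots> = ?k * of_nat (f_dim \<mu>)"
  proof -
    have "(\<Sum>b\<in>?B. \<Sum>w\<in>?S. b w * coord \<mu> (?t w) b) = (\<Sum>b\<in>?B. ?k)"
      by (intro sum.cong refl diag)
    then show ?thesis
      by (simp add: distinct_card[OF specht_basis(1)] specht_basis(4) mult.commute)
  qed
  finally show ?thesis by simp
qed

text \<open>The cofactor m!/f is the scalar kappa, a sum of products of integer coefficients of
  c.\<close>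

lemma f_dim_dvd_fact: "f_dim \<mu> dvd fact (sum_list \<mu>)"
proof -
  have "symmetrizer_square \<mu> id \<in> \<int>"
    unfolding symmetrizer_square_def using young_symmetrizer_Ints by (intro Ints_sum Ints_mult)
  then obtain k where k: "symmetrizer_square \<mu> id = of_int k" by (auto elim: Ints_cases)
  have "of_int (k * int (f_dim \<mu>)) = (of_int (fact (sum_list \<mu>)) :: complex)"
    using symmetrizer_square_times_f_dim[of \<mu>] by (simp add: k)
  then have "k * int (f_dim \<mu>) = int (fact (sum_list \<mu>))"
    by (simp only: of_int_eq_iff of_nat_fact)
  then show ?thesis by (metis dvd_triv_right of_nat_dvd_iff)
qed

lemma f_dim_pos: "f_dim \<mu> > 0"
  using symmetrizer_square_times_f_dim[of \<mu>] by (cases "f_dim \<mu> = 0") auto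

lemma translate_specht:
  assumes w: "w permutes {1..sum_list \<mu>}" and "f \<in> specht \<mu>"
  shows "translate w f \<in> specht \<mu>"
  using assms(2) unfolding specht_def
proof (induction rule: fun_vs.span_induct_alt)
  case base
  have "translate w 0 = 0" by (simp add: translate_def fun_eq_iff)
  then show ?case by (simp only: fun_vs.span_zero)
next
  case (step c x y)
  then obtain v where v: "v permutes {1..sum_list \<mu>}" "x = translate v (young_symmetrizer \<mu>)" by auto
  have "translate w x = translate (w \<circ> v) (young_symmetrizer \<mu>)"
    using v translate_comp[OF w] by simp
  then have "translate w x \<in> {translate w (young_symmetrizer \<mu>) |w. w permutes {1..sum_list \<mu>}}"
    using permutes_compose[OF v(1) w] by blast
  moreover have "translate w ((\<lambda>u. c * x u) + y) = (\<lambda>u. c * translate w x u) + translate w y"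
    by (simp add: translate_def fun_eq_iff)
  ultimately show ?case
    using fun_vs.span_add[OF fun_vs.span_scale[OF fun_vs.span_base] step(2), of "translate w x" c]
    by (simp only:)
qed

lemma basis_in_specht: "i < f_dim \<mu> \<Longrightarrow> specht_basis \<mu> ! i \<in> specht \<mu>"
  using specht_basis(3,4)[of \<mu>] fun_vs.span_base nth_mem by metis

lemma sum_specht_basis: "(\<Sum>b\<in>set (specht_basis \<mu>). h b) = (\<Sum>l<f_dim \<mu>. h (specht_basis \<mu> ! l))"
  using sum.reindex_bij_betw[OF bij_betw_nth[OF specht_basis(1) refl refl], of h \<mu>]
  by (simp add: specht_basis(4))

lemma rho_sym_carrier: "rho_sym \<mu> w \<in> carrier_mat (f_dim \<mu>) (f_dim \<mu>)"
  by (simp add: rho_sym_def Let_def)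

lemma rho_sym_index:
  "i < f_dim \<mu> \<Longrightarrow> j < f_dim \<mu> \<Longrightarrow>
   rho_sym \<mu> w $$ (i, j) = coord \<mu> (translate w (specht_basis \<mu> ! j)) (specht_basis \<mu> ! i)"
  by (simp add: rho_sym_def Let_def)

lemma rho_sym_mult:
  assumes v: "v permutes {1..sum_list \<mu>}" and w: "w permutes {1..sum_list \<mu>}"
  shows "rho_sym \<mu> (v \<circ> w) = rho_sym \<mu> v * rho_sym \<mu> w"
proof (rule eq_matI)
  fix i j assume "i < dim_row (rho_sym \<mu> v * rho_sym \<mu> w)" "j < dim_col (rho_sym \<mu> v * rho_sym \<mu> w)"
  then have ij: "i < f_dim \<mu>" "j < f_dim \<mu>"
    using carrier_matD[OF rho_sym_carrier[of \<mu> v]] carrier_matD[OF rho_sym_carrier[of \<mu> w]] by auto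
  define b where "b l = specht_basis \<mu> ! l" for l
  have "translate w (b j) = (\<Sum>l<f_dim \<mu>. (\<lambda>u. rho_sym \<mu> w $$ (l, j) * b l u))"
    using specht_expand[OF translate_specht[OF w basis_in_specht[OF ij(2)]]] ij
    by (simp add: fun_eq_iff sum_fun_apply sum_specht_basis rho_sym_index b_def)
  then have "translate v (translate w (b j)) =
      (\<Sum>l<f_dim \<mu>. (\<lambda>u. rho_sym \<mu> w $$ (l, j) * translate v (b l) u))"
    by (simp add: translate_def fun_eq_iff sum_fun_apply)
  then have "coord \<mu> (translate v (translate w (b j))) (b i) =
      (\<Sum>l<f_dim \<mu>. rho_sym \<mu> w $$ (l, j) * coord \<mu> (translate v (b l)) (b i))"
    using coord_sum[of "{..<f_dim \<mu>}" "\<lambda>l. translate v (b l)" \<mu>]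
      translate_specht[OF v basis_in_specht] by (simp add: b_def)
  then show "rho_sym \<mu> (v \<circ> w) $$ (i, j) = (rho_sym \<mu> v * rho_sym \<mu> w) $$ (i, j)"
    using ij carrier_matD[OF rho_sym_carrier[of \<mu> v]] carrier_matD[OF rho_sym_carrier[of \<mu> w]]
    by (simp add: rho_sym_index translate_comp[OF v w] b_def scalar_prod_def lessThan_atLeast0 mult.commute)
qed (simp_all add: carrier_matD[OF rho_sym_carrier])

lemma rho_sym_id: "rho_sym \<mu> id = 1\<^sub>m (f_dim \<mu>)"
proof (rule eq_matI)
  fix i j assume "i < dim_row (1\<^sub>m (f_dim \<mu>) :: complex mat)" "j < dim_col (1\<^sub>m (f_dim \<mu>) :: complex mat)"
  then have ij: "i < f_dim \<mu>" "j < f_dim \<mu>" by auto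
  then have "specht_basis \<mu> ! j \<in> set (specht_basis \<mu>)" using specht_basis(4) by simp
  from fun_vs.representation_basis[OF specht_basis(2) this]
  show "rho_sym \<mu> id $$ (i, j) = 1\<^sub>m (f_dim \<mu>) $$ (i, j)"
    using ij nth_eq_iff_index_eq[OF specht_basis(1), of i \<mu> j] specht_basis(4)[of \<mu>]
    by (auto simp: rho_sym_index translate_def inv_id)
qed (use rho_sym_carrier[of \<mu>] in auto)

section \<open>The group \<open>G(n,r)\<close> and its Young subgroups\<close>

lemma carrier_Gnr:
  "r > 0 \<Longrightarrow> (x, w) \<in> carrier (Gnr n r) \<longleftrightarrow> x \<in> {1..n} \<rightarrow>\<^sub>E {0..<int r} \<and> w permutes {1..n}"
  by (simp add: Gnr_def Let_def carrier_integer_mod_group sym_group_carrier)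

lemma mult_Gnr:
  "(x, w) \<otimes>\<^bsub>Gnr n r\<^esub> (y, v) = ((\<lambda>i\<in>{1..n}. (x i + y (inv' w i)) mod int r), w \<circ> v)"
  by (simp add: Gnr_def Let_def fun_eq_iff)

lemma one_Gnr: "\<one>\<^bsub>Gnr n r\<^esub> = ((\<lambda>i\<in>{1..n}. 0), id)"
  by (simp add: Gnr_def Let_def)

text \<open>The inverse of (x; w) is (-w^{-1} x; w^{-1}), and coordinate i of w^{-1} x is x (w
  i).\<close>

lemma Gnr_l_inv:
  assumes "r > 0" "(x, w) \<in> carrier (Gnr n r)"
  shows "((\<lambda>i\<in>{1..n}. (- x (w i)) mod int r), inv' w) \<in> carrier (Gnr n r)"
    "((\<lambda>i\<in>{1..n}. (- x (w i)) mod int r), inv' w) \<otimes>\<^bsub>Gnr n r\<^esub> (x, w) = \<one>\<^bsub>Gnr n r\<^esub>"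
proof -
  have w: "w permutes {1..n}" using assms by (simp add: carrier_Gnr)
  show "((\<lambda>i\<in>{1..n}. (- x (w i)) mod int r), inv' w) \<in> carrier (Gnr n r)"
    using assms(1) permutes_inv[OF w] by (auto simp: carrier_Gnr)
  show "((\<lambda>i\<in>{1..n}. (- x (w i)) mod int r), inv' w) \<otimes>\<^bsub>Gnr n r\<^esub> (x, w) = \<one>\<^bsub>Gnr n r\<^esub>"
    unfolding mult_Gnr one_Gnr permutes_inv_inv[OF w] permutes_comp_inverses[OF w]
    by (simp add: mod_add_left_eq cong: restrict_cong)
qed

lemma group_Gnr:
  assumes "r > 0"
  shows "group (Gnr n r)"
proof (rule groupI)
  fix g h k assume g: "g \<in> carrier (Gnr n r)" and h: "h \<in> carrier (Gnr n r)" and k: "k \<in> carrier (Gnr n r)"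
  obtain x w y v z u where e: "g = (x, w)" "h = (y, v)" "k = (z, u)" by (cases g; cases h; cases k) blast
  have p: "w permutes {1..n}" "v permutes {1..n}" using g h assms by (auto simp: e carrier_Gnr)
  show "g \<otimes>\<^bsub>Gnr n r\<^esub> h \<in> carrier (Gnr n r)"
    using p assms by (auto simp: e mult_Gnr carrier_Gnr permutes_compose)
  have "(x i + (y (inv' w i) + z (inv' v (inv' w i))) mod int r) mod int r =
    ((x i + y (inv' w i)) mod int r + z (inv' (w \<circ> v) i)) mod int r" for i
    by (simp add: inv_comp_permutes[OF p] mod_simps add.assoc)
  moreover have "inv' w i \<in> {1..n}" if "i \<in> {1..n}" for i
    using permutes_in_image[OF permutes_inv[OF p(1)]] that by blast
  ultimately show "g \<otimes>\<^bsub>Gnr n r\<^esub> h \<otimes>\<^bsub>Gnr n r\<^esub> k = g \<otimes>\<^bsub>Gnr n r\<^esub> (h \<otimes>\<^bsub>Gnr n r\<^esub> k)"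
    unfolding e mult_Gnr by (auto simp: o_assoc simp del: atLeastAtMost_iff intro!: restrict_ext)
next
  show "\<one>\<^bsub>Gnr n r\<^esub> \<in> carrier (Gnr n r)"
    using assms by (auto simp: one_Gnr carrier_Gnr permutes_id)
next
  fix g assume g: "g \<in> carrier (Gnr n r)"
  obtain x w where e: "g = (x, w)" by (cases g)
  have "(\<lambda>i\<in>{1..n}. x i mod int r) = x"
    using g assms unfolding e carrier_Gnr[OF assms]
    by (intro extensionalityI[of _ "{1..n}"]) (auto simp: PiE_iff)
  then show "\<one>\<^bsub>Gnr n r\<^esub> \<otimes>\<^bsub>Gnr n r\<^esub> g = g"
    unfolding e one_Gnr mult_Gnr by (simp add: inv_id cong: restrict_cong)
  show "\<exists>h\<in>carrier (Gnr n r). h \<otimes>\<^bsub>Gnr n r\<^esub> g = \<one>\<^bsub>Gnr n r\<^esub>"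
    using Gnr_l_inv[OF assms, of x w n] g e by blast
qed

lemma inv_Gnr:
  assumes "r > 0" "(x, w) \<in> carrier (Gnr n r)"
  shows "inv\<^bsub>Gnr n r\<^esub> (x, w) = ((\<lambda>i\<in>{1..n}. (- x (w i)) mod int r), inv' w)"
  by (rule group.inv_equality[OF group_Gnr[OF assms(1)] Gnr_l_inv(2)[OF assms] assms(2) Gnr_l_inv(1)[OF assms]])

lemma carrier_Gnr_Times:
  "r > 0 \<Longrightarrow> carrier (Gnr n r) = ({1..n} \<rightarrow>\<^sub>E {0..<int r}) \<times> Sym n"
  unfolding set_eq_iff split_paired_All by (simp add: carrier_Gnr)

lemma finite_Gnr: "r > 0 \<Longrightarrow> finite (carrier (Gnr n r))"
  by (simp add: carrier_Gnr_Times finite_permutations finite_PiE)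

lemma card_Gnr_filter:
  assumes "r > 0"
  shows "card {g \<in> carrier (Gnr n r). Q (snd g)} = r ^ n * card {w. w permutes {1..n} \<and> Q w}"
proof -
  have "{g \<in> carrier (Gnr n r). Q (snd g)} = ({1..n} \<rightarrow>\<^sub>E {0..<int r}) \<times> {w. w permutes {1..n} \<and> Q w}"
    using assms by (auto simp: carrier_Gnr_Times)
  then show ?thesis by (simp add: card_cartesian_product card_PiE)
qed

text \<open>The diagonal subgroup is abelian, so y cancels and w merely permutes the coordinates of
  x.\<close>

lemma conj_Gnr_diagonal:
  assumes "r > 0" "(x, id) \<in> carrier (Gnr n r)" "(y, w) \<in> carrier (Gnr n r)"
  shows "inv\<^bsub>Gnr n r\<^esub> (y, w) \<otimes>\<^bsub>Gnr n r\<^esub> (x, id) \<otimes>\<^bsub>Gnr n r\<^esub> (y, w) = ((\<lambda>i\<in>{1..n}. x (w i)), id)"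
proof -
  have w: "w permutes {1..n}" using assms by (simp add: carrier_Gnr)
  have "x (w i) mod int r = x (w i)" if "i \<in> {1..n}" for i
  proof -
    have "w i \<in> {1..n}" using w that by (simp add: permutes_in_image del: atLeastAtMost_iff)
    then have "x (w i) \<in> {0..<int r}" using assms unfolding carrier_Gnr[OF assms(1)] by (auto dest: PiE_mem)
    then show ?thesis by simp
  qed
  then show ?thesis
    unfolding inv_Gnr[OF assms(1,3)] mult_Gnr permutes_inv_inv[OF w] id_comp comp_id permutes_comp_inverses[OF w]
    by (auto simp: mod_simps simp del: atLeastAtMost_iff intro!: restrict_ext)
qed

text \<open>The diagonal part is the difference s y - y transported by w. Over a block stable under
  the conjugated permutation it sums to 0 modulo r, so for transpositions the powers of zeta later
  disappear.\<close>

lemma conj_Gnr_permutation: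
  assumes "r > 0" "s permutes {1..n}" "(y, w) \<in> carrier (Gnr n r)"
  shows "inv\<^bsub>Gnr n r\<^esub> (y, w) \<otimes>\<^bsub>Gnr n r\<^esub> ((\<lambda>i\<in>{1..n}. 0), s) \<otimes>\<^bsub>Gnr n r\<^esub> (y, w) =
    ((\<lambda>i\<in>{1..n}. (y (inv' s (w i)) - y (w i)) mod int r), inv' w \<circ> s \<circ> w)"
proof -
  have w: "w permutes {1..n}" using assms by (simp add: carrier_Gnr)
  have "w i \<in> {1..n}" if "i \<in> {1..n}" for i
    using w that by (simp add: permutes_in_image del: atLeastAtMost_iff)
  then show ?thesis
    unfolding inv_Gnr[OF assms(1,3)] mult_Gnr permutes_inv_inv[OF w]
    using inv_comp_permutes[OF permutes_inv[OF w] assms(2)] permutes_inv_inv[OF w]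
    by (auto simp: mod_simps simp del: atLeastAtMost_iff intro!: restrict_ext)
qed

lemma young_subgroup_iff:
  "(x, w) \<in> young_subgroup bs r \<longleftrightarrow> (x, w) \<in> carrier (Gnr (sum_list bs) r) \<and>
     (\<forall>i\<in>{1..sum_list bs}. block_index bs (w i) = block_index bs i)" if "r > 0"
  using preserves_blocks_iff[of w bs] that unfolding young_subgroup_def
  by (auto simp: carrier_Gnr simp del: atLeastAtMost_iff)

lemma block_preserving_inv:
  assumes w: "w permutes {1..sum_list bs}"
    and "\<forall>i\<in>{1..sum_list bs}. block_index bs (w i) = block_index bs i" "i \<in> {1..sum_list bs}"
  shows "block_index bs (inv' w i) = block_index bs i"
proof -
  have "inv' w i \<in> {1..sum_list bs}" using permutes_in_image[OF permutes_inv[OF w]] assms by blast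
  then have "block_index bs (w (inv' w i)) = block_index bs (inv' w i)" using assms by blast
  then show ?thesis using w by (simp add: permutes_inverses)
qed

lemma subgroup_young:
  assumes "r > 0"
  shows "subgroup (young_subgroup bs r) (Gnr (sum_list bs) r)"
proof -
  interpret group "Gnr (sum_list bs) r" using assms by (rule group_Gnr)
  show ?thesis
  proof (rule subgroupI)
    show "young_subgroup bs r \<subseteq> carrier (Gnr (sum_list bs) r)"
      by (auto simp: young_subgroup_def)
    have "\<one>\<^bsub>Gnr (sum_list bs) r\<^esub> \<in> young_subgroup bs r"
      using one_closed unfolding one_Gnr by (simp add: young_subgroup_iff[OF assms])
    then show "young_subgroup bs r \<noteq> {}" by blast
  next
    fix a assume a: "a \<in> young_subgroup bs r"
    obtain x w where e: "a = (x, w)" by (cases a)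
    have c: "(x, w) \<in> carrier (Gnr (sum_list bs) r)" using a by (simp add: e young_subgroup_iff[OF assms])
    then have w: "w permutes {1..sum_list bs}" by (simp add: carrier_Gnr[OF assms])
    show "inv\<^bsub>Gnr (sum_list bs) r\<^esub> a \<in> young_subgroup bs r"
      using block_preserving_inv[OF w] a Gnr_l_inv(1)[OF assms c]
      unfolding e inv_Gnr[OF assms c] by (simp add: young_subgroup_iff[OF assms])
  next
    fix a b assume ab: "a \<in> young_subgroup bs r" "b \<in> young_subgroup bs r"
    obtain x w y v where e: "a = (x, w)" "b = (y, v)" by (cases a; cases b)
    have c: "(x, w) \<in> carrier (Gnr (sum_list bs) r)" "(y, v) \<in> carrier (Gnr (sum_list bs) r)"
      using ab by (simp_all add: e young_subgroup_iff[OF assms])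
    then have v: "v permutes {1..sum_list bs}" by (simp add: carrier_Gnr[OF assms])
    have "v i \<in> {1..sum_list bs}" if "i \<in> {1..sum_list bs}" for i
      using v that by (simp add: permutes_in_image del: atLeastAtMost_iff)
    then show "a \<otimes>\<^bsub>Gnr (sum_list bs) r\<^esub> b \<in> young_subgroup bs r"
      using ab m_closed[OF c] unfolding e mult_Gnr
      by (simp add: young_subgroup_iff[OF assms] del: atLeastAtMost_iff)
  qed
qed

section \<open>Projections of a Young subgroup to its factors\<close>

text \<open>The permutation component of \<open>proj_factor\<close>, isolated because the diagonal
  component enters \<open>rho_ext\<close> only through a sum over the block.\<close>

definition block_restrict :: "nat list \<Rightarrow> nat \<Rightarrow> (nat \<Rightarrow> nat) \<Rightarrow> nat \<Rightarrow> nat" where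
  "block_restrict bs k w = (\<lambda>i. if i \<in> {1..bs ! k} then w (offset bs k + i) - offset bs k else i)"

lemma proj_factor_eq:
  "proj_factor bs k (x, w) = ((\<lambda>i\<in>{1..bs ! k}. x (offset bs k + i)), block_restrict bs k w)"
  by (simp add: proj_factor_def block_restrict_def)

lemma block_restrict_shift:
  assumes "w ` block bs k = block bs k" "i \<in> {1..bs ! k}"
  shows "block_restrict bs k w i \<in> {1..bs ! k}"
    "offset bs k + block_restrict bs k w i = w (offset bs k + i)"
proof -
  have "w (offset bs k + i) \<in> w ` block bs k" using assms(2) by (auto simp: block_def)
  then have "w (offset bs k + i) \<in> block bs k" using assms(1) by simp
  then show "block_restrict bs k w i \<in> {1..bs ! k}"
    "offset bs k + block_restrict bs k w i = w (offset bs k + i)"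
    using assms(2) by (auto simp: block_restrict_def block_def)
qed

lemma block_restrict_permutes:
  assumes "w permutes S" "w ` block bs k = block bs k"
  shows "block_restrict bs k w permutes {1..bs ! k}"
proof (rule bij_imp_permutes)
  have "inj_on (block_restrict bs k w) {1..bs ! k}"
  proof (rule inj_onI)
    fix i j assume ij: "i \<in> {1..bs ! k}" "j \<in> {1..bs ! k}" "block_restrict bs k w i = block_restrict bs k w j"
    then have "w (offset bs k + i) = w (offset bs k + j)"
      using block_restrict_shift(2)[OF assms(2)] by metis
    then show "i = j" using permutes_inj[OF assms(1)] by (simp add: inj_eq)
  qed
  moreover have "block_restrict bs k w ` {1..bs ! k} \<subseteq> {1..bs ! k}"
    using block_restrict_shift(1)[OF assms(2)] by blast
  ultimately show "bij_betw (block_restrict bs k w) {1..bs ! k} {1..bs ! k}"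
    by (simp add: bij_betw_def endo_inj_surj)
  show "block_restrict bs k w i = i" if "i \<notin> {1..bs ! k}" for i
    using that by (simp add: block_restrict_def del: atLeastAtMost_iff)
qed

lemma block_restrict_comp:
  assumes "v ` block bs k = block bs k"
  shows "block_restrict bs k (w \<circ> v) = block_restrict bs k w \<circ> block_restrict bs k v"
proof
  fix i show "block_restrict bs k (w \<circ> v) i = (block_restrict bs k w \<circ> block_restrict bs k v) i"
  proof (cases "i \<in> {1..bs ! k}")
    case True
    then show ?thesis
      using block_restrict_shift[OF assms True] by (simp add: block_restrict_def[of _ _ w]
          block_restrict_def[of _ _ "w \<circ> v"] del: atLeastAtMost_iff)
  qed (simp add: block_restrict_def del: atLeastAtMost_iff)
qed

lemma block_restrict_id: "block_restrict bs k id = id"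
  by (auto simp: block_restrict_def fun_eq_iff)

lemma block_restrict_eq_id:
  assumes "\<And>i. i \<in> block bs k \<Longrightarrow> w i = i"
  shows "block_restrict bs k w = id"
  using assms by (auto simp: block_restrict_def fun_eq_iff block_def)

lemma block_restrict_transpose:
  assumes "a \<in> block bs k" "b \<in> block bs k"
  shows "block_restrict bs k (transpose a b) = transpose (a - offset bs k) (b - offset bs k)"
  using assms by (auto simp: block_restrict_def fun_eq_iff block_def transpose_def)

lemma sum_shift_block:
  "(\<Sum>i\<in>{1..bs ! k}. h (offset bs k + i)) = (\<Sum>i\<in>block bs k. h i)"
  unfolding block_def
  by (rule sum.reindex_bij_witness[of _ "\<lambda>i. i - offset bs k" "\<lambda>i. offset bs k + i"]) auto

lemma powi_cong_mod:
  fixes \<zeta> :: complex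
  assumes "\<zeta> ^ r = 1" "r > 0" "a mod int r = b mod int r"
  shows "\<zeta> powi a = \<zeta> powi b"
proof -
  have z: "\<zeta> \<noteq> 0" using assms by (auto simp: power_0_left)
  obtain q where "a = b + int r * q" using assms(3) by (metis mod_eqE add_diff_cancel_left' diff_add_cancel diff_diff_eq2 minus_mult_right uminus_add_conv_diff)
  then show ?thesis using z assms(1) by (simp add: power_int_add power_int_mult)
qed

lemma powi_sum:
  fixes \<zeta> :: complex
  assumes "\<zeta> \<noteq> 0"
  shows "\<zeta> powi (\<Sum>i\<in>I. h i) = (\<Prod>i\<in>I. \<zeta> powi h i)"
  using assms by (induction I rule: infinite_finite_induct) (auto simp: power_int_add)

lemma rho_ext_proj_factor:
  assumes "bs ! k = sum_list \<mu>"
  shows "rho_ext \<zeta> \<mu> k (proj_factor bs k (x, w)) =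
    (\<zeta> powi (\<Sum>i\<in>block bs k. x i)) ^ k \<cdot>\<^sub>m rho_sym \<mu> (block_restrict bs k w)"
proof -
  have "(\<Sum>i\<in>{1..sum_list \<mu>}. (\<lambda>i\<in>{1..bs ! k}. x (offset bs k + i)) i) = (\<Sum>i\<in>block bs k. x i)"
    unfolding sum_shift_block[symmetric] assms by (intro sum.cong refl) simp
  then show ?thesis by (simp add: rho_ext_def proj_factor_eq zeta_char_def)
qed

lemma block_preserving_image:
  assumes "r > 0" "(x, w) \<in> young_subgroup bs r" "k < length bs"
  shows "w ` block bs k = block bs k" "w permutes {1..sum_list bs}"
  using assms unfolding young_subgroup_def by (auto simp: carrier_Gnr)

lemma matrix_rep_factor:
  assumes "r > 0" "\<zeta> ^ r = 1" "k < length bs" and b: "bs ! k = sum_list \<mu>"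
  shows "matrix_rep (Gnr (sum_list bs) r) (young_subgroup bs r) (f_dim \<mu>)
    (\<lambda>h. rho_ext \<zeta> \<mu> k (proj_factor bs k h))"
  unfolding matrix_rep_def
proof (intro conjI ballI)
  have z: "\<zeta> \<noteq> 0" using assms by (auto simp: power_0_left)
  fix g assume g: "g \<in> young_subgroup bs r"
  obtain x w where e: "g = (x, w)" by (cases g)
  show "rho_ext \<zeta> \<mu> k (proj_factor bs k g) \<in> carrier_mat (f_dim \<mu>) (f_dim \<mu>)"
    using rho_sym_carrier by (simp add: e rho_ext_proj_factor[OF b])
  fix h assume h: "h \<in> young_subgroup bs r"
  obtain y v where e': "h = (y, v)" by (cases h)
  note w = block_preserving_image[OF assms(1) g[unfolded e] assms(3)]
  note v = block_preserving_image[OF assms(1) h[unfolded e'] assms(3)]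
  have "bij_betw w (block bs k) (block bs k)"
    using w permutes_inj_on[OF w(2)] by (simp add: bij_betw_def)
  \<comment> \<open>Since w maps block k to itself, its action on y only reorders the summands; the
    block sums therefore add modulo r under multiplication.\<close>
  then have "(\<Sum>i\<in>block bs k. y (inv' w i)) = (\<Sum>i\<in>block bs k. y (inv' w (w i)))"
    by (rule sum.reindex_bij_betw[symmetric])
  then have y: "(\<Sum>i\<in>block bs k. y (inv' w i)) = (\<Sum>i\<in>block bs k. y i)"
    using w(2) by (simp add: permutes_inverses)
  have "(\<Sum>i\<in>block bs k. (\<lambda>i\<in>{1..sum_list bs}. (x i + y (inv' w i)) mod int r) i) =
    (\<Sum>i\<in>block bs k. (x i + y (inv' w i)) mod int r)"
    using block_subset[OF assms(3)] by (intro sum.cong refl) auto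
  then have "(\<Sum>i\<in>block bs k. (\<lambda>i\<in>{1..sum_list bs}. (x i + y (inv' w i)) mod int r) i) mod int r =
    ((\<Sum>i\<in>block bs k. x i) + (\<Sum>i\<in>block bs k. y i)) mod int r"
    by (simp add: mod_sum_eq sum.distrib y)
  from powi_cong_mod[OF assms(2,1) this]
  have "rho_ext \<zeta> \<mu> k (proj_factor bs k (g \<otimes>\<^bsub>Gnr (sum_list bs) r\<^esub> h)) =
    ((\<zeta> powi (\<Sum>i\<in>block bs k. x i)) ^ k * (\<zeta> powi (\<Sum>i\<in>block bs k. y i)) ^ k) \<cdot>\<^sub>m
    (rho_sym \<mu> (block_restrict bs k w) * rho_sym \<mu> (block_restrict bs k v))"
    unfolding e e' mult_Gnr rho_ext_proj_factor[OF b] block_restrict_comp[OF v(1)]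
    using rho_sym_mult block_restrict_permutes[OF w(2,1)] block_restrict_permutes[OF v(2,1)] z
    by (simp add: b power_int_add power_mult_distrib)
  also have "\<dots> = rho_ext \<zeta> \<mu> k (proj_factor bs k g) * rho_ext \<zeta> \<mu> k (proj_factor bs k h)"
    unfolding e e' rho_ext_proj_factor[OF b]
    using rho_sym_carrier[of \<mu> "block_restrict bs k w"] rho_sym_carrier[of \<mu> "block_restrict bs k v"]
    by (intro eq_matI) (auto simp: scalar_prod_def sum_distrib_left mult.assoc mult.left_commute)
  finally show "rho_ext \<zeta> \<mu> k (proj_factor bs k (g \<otimes>\<^bsub>Gnr (sum_list bs) r\<^esub> h)) =
    rho_ext \<zeta> \<mu> k (proj_factor bs k g) * rho_ext \<zeta> \<mu> k (proj_factor bs k h)" .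
next
  have "(\<Sum>i\<in>block bs k. (\<lambda>i\<in>{1..sum_list bs}. 0) i) = (0::int)"
    using block_subset[OF assms(3)] by (intro sum.neutral) auto
  then show "rho_ext \<zeta> \<mu> k (proj_factor bs k \<one>\<^bsub>Gnr (sum_list bs) r\<^esub>) = 1\<^sub>m (f_dim \<mu>)"
    unfolding one_Gnr rho_ext_proj_factor[OF b] block_restrict_id rho_sym_id
    by (intro eq_matI) auto
qed

section \<open>Counting permutations\<close>

text \<open>Composing with the transposition of j and p reduces to permutations fixing j, that is,
  to permutations of the other n - 1 points.\<close>

lemma card_permutes_fix_point:
  assumes "j \<in> {1..n}" "p \<in> {1..n}"
  shows "card {w. w permutes {1..n} \<and> w j = p} = fact (n - 1)"
proof -
  let ?u = "transpose j p"
  have u: "?u permutes {1..n}" using assms by (rule permutes_swap_id)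
  have "bij_betw (\<lambda>w. ?u \<circ> w) {w. w permutes {1..n} - {j}} {w. w permutes {1..n} \<and> w j = p}"
  proof (rule bij_betwI[where g = "\<lambda>w. ?u \<circ> w"])
    show "(\<lambda>w. ?u \<circ> w) \<in> {w. w permutes {1..n} - {j}} \<rightarrow> {w. w permutes {1..n} \<and> w j = p}"
    proof (rule Pi_I)
      fix w assume "w \<in> {w. w permutes {1..n} - {j}}"
      then have w: "w permutes {1..n} - {j}" by simp
      have "w j = j" using permutes_not_in[OF w] by simp
      moreover have "w permutes {1..n}" using w by (rule permutes_subset) blast
      ultimately show "?u \<circ> w \<in> {w. w permutes {1..n} \<and> w j = p}"
        using permutes_compose[OF _ u] by simp
    qed
    show "(\<lambda>w. ?u \<circ> w) \<in> {w. w permutes {1..n} \<and> w j = p} \<rightarrow> {w. w permutes {1..n} - {j}}"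
    proof (rule Pi_I)
      fix w assume "w \<in> {w. w permutes {1..n} \<and> w j = p}"
      then have "?u \<circ> w permutes {1..n}" "(?u \<circ> w) j = j"
        using permutes_compose[OF _ u] by simp_all
      then have "?u \<circ> w permutes {1..n} - {j}" by (elim permutes_superset) blast
      then show "?u \<circ> w \<in> {w. w permutes {1..n} - {j}}" by simp
    qed
  qed (auto simp: fun_eq_iff)
  then have "card {w. w permutes {1..n} \<and> w j = p} = card {w. w permutes {1..n} - {j}}"
    by (rule bij_betw_same_card[symmetric])
  also have "\<dots> = fact (n - 1)"
    using card_permutations[of "{1..n} - {j}" "n - 1"] assms(1) by simp
  finally show ?thesis .
qed

lemma card_permutes_fix_pair:
  assumes "2 \<le> n" "p \<in> {1..n}" "q \<in> {1..n}" "p \<noteq> q"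
  shows "card {w. w permutes {1..n} \<and> w 1 = p \<and> w 2 = q} = fact (n - 2)"
proof -
  \<comment> \<open>A permutation u with u 1 = p and u 2 = q is needed. Swapping 2 with the preimage
    q' of q under (1 p) does it without disturbing 1, because q differs from p and so q' is not
    1.\<close>
  define q' where "q' = transpose 1 p q"
  have q': "q' \<in> {1..n}" "q' \<noteq> 1" "transpose 1 p q' = q"
    using assms by (auto simp: q'_def transpose_def)
  define u where "u = transpose 1 p \<circ> transpose 2 q'"
  have u: "u permutes {1..n}"
    using assms q' by (auto simp: u_def intro!: permutes_compose permutes_swap_id)
  have u1: "u 1 = p" "u 2 = q" using q' by (auto simp: u_def transpose_def)
  have iu: "inv' u p = 1" "inv' u q = 2"
    using u1 permutes_inverses(2)[OF u, of 1] permutes_inverses(2)[OF u, of 2] by (simp_all only: )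
  have "bij_betw (\<lambda>w. u \<circ> w) {w. w permutes {1..n} - {1, 2}} {w. w permutes {1..n} \<and> w 1 = p \<and> w 2 = q}"
  proof (rule bij_betwI[where g = "\<lambda>w. inv' u \<circ> w"])
    show "(\<lambda>w. u \<circ> w) \<in> {w. w permutes {1..n} - {1, 2}} \<rightarrow> {w. w permutes {1..n} \<and> w 1 = p \<and> w 2 = q}"
    proof (rule Pi_I)
      fix w assume "w \<in> {w. w permutes {1..n} - {1, 2}}"
      then have w: "w permutes {1..n} - {1, 2}" by simp
      have "w 1 = 1" "w 2 = 2" using permutes_not_in[OF w] by simp_all
      moreover have "w permutes {1..n}" using w by (rule permutes_subset) auto
      ultimately show "u \<circ> w \<in> {w. w permutes {1..n} \<and> w 1 = p \<and> w 2 = q}"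
        using permutes_compose[OF _ u] u1 by simp
    qed
    show "(\<lambda>w. inv' u \<circ> w) \<in> {w. w permutes {1..n} \<and> w 1 = p \<and> w 2 = q} \<rightarrow> {w. w permutes {1..n} - {1, 2}}"
    proof (rule Pi_I)
      fix w assume "w \<in> {w. w permutes {1..n} \<and> w 1 = p \<and> w 2 = q}"
      then have "inv' u \<circ> w permutes {1..n}" "(inv' u \<circ> w) 1 = 1" "(inv' u \<circ> w) 2 = 2"
        using permutes_compose[OF _ permutes_inv[OF u]] iu by (simp_all only: mem_Collect_eq comp_apply)
      then have "inv' u \<circ> w permutes {1..n} - {1, 2}" by (elim permutes_superset) blast
      then show "inv' u \<circ> w \<in> {w. w permutes {1..n} - {1, 2}}" by (simp only: mem_Collect_eq)
    qed
  qed (simp_all only: o_assoc permutes_comp_inverses[OF u] id_comp)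
  then have "card {w. w permutes {1..n} \<and> w 1 = p \<and> w 2 = q} = card {w. w permutes {1..n} - {1, 2}}"
    by (rule bij_betw_same_card[symmetric])
  also have "\<dots> = fact (n - 2)"
    using assms(1) by (intro card_permutations) (simp_all add: card_Diff_subset)
  finally show ?thesis .
qed

lemma card_permutes_inv:
  "card {w. w permutes S \<and> Q (inv' w)} = card {w. w permutes S \<and> Q w}"
proof (rule bij_betw_same_card)
  show "bij_betw inv' {w. w permutes S \<and> Q (inv' w)} {w. w permutes S \<and> Q w}"
    by (rule bij_betwI[where g = inv']) (auto simp: permutes_inv permutes_inv_inv)
qed

lemma card_permutes_point_in:
  assumes "j \<in> {1..n}" "B \<subseteq> {1..n}"
  shows "card {w. w permutes {1..n} \<and> w j \<in> B} = card B * fact (n - 1)"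
proof -
  have fin: "finite B" using assms(2) finite_subset by blast
  have "{w. w permutes {1..n} \<and> w j \<in> B} = (\<Union>p\<in>B. {w. w permutes {1..n} \<and> w j = p})" by auto
  then have "card {w. w permutes {1..n} \<and> w j \<in> B} = (\<Sum>p\<in>B. card {w. w permutes {1..n} \<and> w j = p})"
    using fin finite_permutations[of "{1..n}"]
    by (simp only:) (intro card_UN_disjoint, auto)
  also have "\<dots> = (\<Sum>p\<in>B. fact (n - 1))"
    using assms card_permutes_fix_point by (intro sum.cong refl) blast
  finally show ?thesis by simp
qed

lemma card_permutes_pair_in:
  assumes "2 \<le> n" "B \<subseteq> {1..n}"
  shows "card {w. w permutes {1..n} \<and> w 1 \<in> B \<and> w 2 \<in> B} = card B * (card B - 1) * fact (n - 2)"
proof -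
  have fin: "finite B" using assms(2) finite_subset by blast
  let ?D = "{(p, q) \<in> B \<times> B. p \<noteq> q}"
  have fD: "finite ?D" using fin by (auto intro: finite_subset[of _ "B \<times> B"])
  have "?D = (SIGMA p:B. B - {p})" by auto
  then have cD: "card ?D = card B * (card B - 1)"
    using fin by (simp add: card_SigmaI)
  have "w 1 \<noteq> w 2" if "w permutes {1..n}" for w
    using permutes_inj[OF that] by (simp add: inj_eq)
  then have "{w. w permutes {1..n} \<and> w 1 \<in> B \<and> w 2 \<in> B} =
    (\<Union>pq\<in>?D. {w. w permutes {1..n} \<and> w 1 = fst pq \<and> w 2 = snd pq})" by force
  then have "card {w. w permutes {1..n} \<and> w 1 \<in> B \<and> w 2 \<in> B} =
    (\<Sum>pq\<in>?D. card {w. w permutes {1..n} \<and> w 1 = fst pq \<and> w 2 = snd pq})"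
    using fD finite_permutations[of "{1..n}"]
    by (simp only:) (intro card_UN_disjoint, auto simp: prod_eq_iff)
  also have "\<dots> = (\<Sum>pq\<in>?D. fact (n - 2))"
    using assms by (intro sum.cong refl) (auto intro!: card_permutes_fix_pair[unfolded One_nat_def])
  finally show ?thesis by (simp only: sum_constant cD of_nat_id)
qed

text \<open>A block-preserving permutation amounts to an independent choice of one permutation per
  block; \<open>glue\<close> and \<open>cut\<close> are the two directions of this
  bijection.\<close>

lemma card_block_preserving:
  "card {w. w permutes {1..sum_list bs} \<and> (\<forall>i\<in>{1..sum_list bs}. block_index bs (w i) = block_index bs i)} =
   (\<Prod>k<length bs. fact (bs ! k))"
proof -
  let ?X = "{1..sum_list bs}" and ?K = "{..<length bs}"
  let ?A = "{w. w permutes ?X \<and> (\<forall>i\<in>?X. block_index bs (w i) = block_index bs i)}"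
  let ?P = "\<Pi>\<^sub>E k\<in>?K. {p. p permutes block bs k}"
  define glue where "glue p i = (if i \<in> ?X then p (block_index bs i) i else i)" for p :: "nat \<Rightarrow> nat \<Rightarrow> nat" and i
  define cut where "cut w = (\<lambda>k\<in>?K. \<lambda>i. if i \<in> block bs k then w i else i)" for w :: "nat \<Rightarrow> nat"
  have sub: "block bs k \<subseteq> ?X" if "k \<in> ?K" for k using block_subset that by blast
  have glue_block: "glue p i = p k i" if "i \<in> block bs k" "k \<in> ?K" for p i k
    using that sub[OF that(2)] block_indexI[of k bs i] by (auto simp: glue_def)
  have glue_in: "glue p i \<in> block bs (block_index bs i)" if "p \<in> ?P" "i \<in> ?X" for p i
  proof -
    have "block_index bs i \<in> ?K" using block_index(1)[OF that(2)] by simp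
    then have "p (block_index bs i) permutes block bs (block_index bs i)" using that(1) by (auto dest: PiE_mem)
    then show ?thesis using that(2) block_index(2)[OF that(2)] by (simp add: glue_def permutes_in_image)
  qed
  have glue_idx: "block_index bs (glue p i) = block_index bs i" if "p \<in> ?P" "i \<in> ?X" for p i
    using glue_in[OF that] block_index(1)[OF that(2)] block_indexI by blast
  have "bij_betw glue ?P ?A"
  proof (rule bij_betwI[where g = cut])
    show "glue \<in> ?P \<rightarrow> ?A"
    proof (rule Pi_I)
      fix p assume p: "p \<in> ?P"
      have "inj_on (glue p) ?X"
      proof (rule inj_onI)
        fix i j assume ij: "i \<in> ?X" "j \<in> ?X" "glue p i = glue p j"
        then have e: "block_index bs i = block_index bs j" using glue_idx[OF p] by metis
        have "p (block_index bs i) permutes block bs (block_index bs i)"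
          using p block_index(1)[OF ij(1)] by (auto dest: PiE_mem)
        from permutes_inj[OF this] show "i = j"
          using ij e by (simp add: glue_def inj_eq del: atLeastAtMost_iff)
      qed
      moreover have "glue p ` ?X \<subseteq> ?X"
        using glue_in[OF p] block_index(1) sub by blast
      ultimately have "bij_betw (glue p) ?X ?X" by (simp add: bij_betw_def endo_inj_surj)
      then have "glue p permutes ?X" by (rule bij_imp_permutes) (simp add: glue_def del: atLeastAtMost_iff)
      then show "glue p \<in> ?A" using glue_idx[OF p] by blast
    qed
    show "cut \<in> ?A \<rightarrow> ?P"
    proof (rule Pi_I)
      fix w assume "w \<in> ?A"
      then have w: "w permutes ?X" "\<forall>i\<in>?X. block_index bs (w i) = block_index bs i" by auto
      have "(\<lambda>i. if i \<in> block bs k then w i else i) permutes block bs k" if k: "k \<in> ?K" for k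
      proof (rule bij_imp_permutes)
        have "w ` block bs k = block bs k" using w preserves_blocks_iff[OF w(1)] k by blast
        then have "bij_betw w (block bs k) (block bs k)"
          using permutes_inj_on[OF w(1)] by (simp add: bij_betw_def)
        then show "bij_betw (\<lambda>i. if i \<in> block bs k then w i else i) (block bs k) (block bs k)"
          by (simp cong: bij_betw_cong)
      qed simp
      then show "cut w \<in> ?P" unfolding cut_def by auto
    qed
    show "cut (glue p) = p" if p: "p \<in> ?P" for p
    proof (rule extensionalityI[of _ ?K])
      show "cut (glue p) \<in> extensional ?K" by (simp add: cut_def)
      show "p \<in> extensional ?K" using p by (simp add: PiE_iff)
      fix k assume k: "k \<in> ?K"
      then have "p k permutes block bs k" using p by (auto dest: PiE_mem)
      then show "cut (glue p) k = p k"
        using k glue_block[of _ k p] by (auto simp: cut_def fun_eq_iff permutes_not_in)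
    qed
    show "glue (cut w) = w" if "w \<in> ?A" for w
    proof
      fix i show "glue (cut w) i = w i"
      proof (cases "i \<in> ?X")
        case True
        then show ?thesis using block_index[OF True] by (simp add: glue_def cut_def del: atLeastAtMost_iff)
      next
        case False
        then show ?thesis using that by (auto simp: glue_def permutes_not_in simp del: atLeastAtMost_iff)
      qed
    qed
  qed
  then have "card ?A = card ?P" by (rule bij_betw_same_card[symmetric])
  also have "\<dots> = (\<Prod>k<length bs. fact (bs ! k))"
    unfolding card_PiE[OF finite_lessThan]
    by (intro prod.cong refl card_permutations) (simp_all add: block_def)
  finally show ?thesis .
qed

lemma card_young_subgroup:
  assumes "r > 0"
  shows "card (young_subgroup bs r) = r ^ sum_list bs * (\<Prod>k<length bs. fact (bs ! k))"
proof -
  have "young_subgroup bs r = {g \<in> carrier (Gnr (sum_list bs) r).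
    (\<lambda>w. \<forall>i\<in>{1..sum_list bs}. block_index bs (w i) = block_index bs i) (snd g)}"
    using young_subgroup_iff[OF assms] by (auto simp del: atLeastAtMost_iff)
  then show ?thesis
    using card_Gnr_filter[OF assms, of "sum_list bs"
        "\<lambda>w. \<forall>i\<in>{1..sum_list bs}. block_index bs (w i) = block_index bs i"]
    by (simp only: card_block_preserving)
qed

section \<open>Characters at transpositions\<close>

lemma conj_transpose:
  assumes "w permutes S"
  shows "inv' w \<circ> transpose a b \<circ> w = transpose (inv' w a) (inv' w b)"
  using transpose_comp_permutes[OF assms, of a b] permutes_comp_inverses[OF assms]
  by (metis comp_assoc id_comp)

lemma chi_id: "chi \<mu> id = of_nat (f_dim \<mu>)"
  by (simp add: chi_def rho_sym_id)

lemma chi_eq_trace: "chi \<mu> w = mat_trace (rho_sym \<mu> w)"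
  by (simp add: chi_def mat_trace_def carrier_matD[OF rho_sym_carrier])

lemma chi_conj:
  assumes "u permutes {1..sum_list \<mu>}" "w permutes {1..sum_list \<mu>}"
  shows "chi \<mu> (inv' u \<circ> w \<circ> u) = chi \<mu> w"
proof -
  note iu = permutes_inv[OF assms(1)]
  have "chi \<mu> (inv' u \<circ> w \<circ> u) = mat_trace (rho_sym \<mu> (inv' u \<circ> w) * rho_sym \<mu> u)"
    using rho_sym_mult[OF permutes_compose[OF assms(2) iu] assms(1)] by (simp add: chi_eq_trace)
  also have "\<dots> = mat_trace (rho_sym \<mu> u * rho_sym \<mu> (inv' u \<circ> w))"
    using rho_sym_carrier by (rule mat_trace_comm) (rule rho_sym_carrier)
  also have "\<dots> = chi \<mu> (u \<circ> (inv' u \<circ> w))"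
    using rho_sym_mult[OF assms(1) permutes_compose[OF assms(2) iu]] by (simp add: chi_eq_trace)
  also have "u \<circ> (inv' u \<circ> w) = w" by (simp add: o_assoc permutes_comp_inverses[OF assms(1)])
  finally show ?thesis .
qed

text \<open>Existence is read off from the count \<open>fact (n - 2)\<close>, which is
  non-zero.\<close>

lemma exists_permutes_pair:
  fixes n :: nat
  assumes "a \<in> {1..n}" "b \<in> {1..n}" "a \<noteq> b"
  shows "\<exists>w. w permutes {1..n} \<and> w 1 = a \<and> w 2 = b"
proof -
  have "2 \<le> n" using assms by auto
  from card_permutes_fix_pair[OF this assms]
  have "card {w. w permutes {1..n} \<and> w 1 = a \<and> w 2 = b} \<noteq> 0" by simp
  then show ?thesis by (metis (mono_tags, lifting) Collect_empty_eq card.empty)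
qed

lemma chi_transpose:
  assumes "a \<in> {1..sum_list \<mu>}" "b \<in> {1..sum_list \<mu>}" "a \<noteq> b"
  shows "chi \<mu> (transpose a b) = chi \<mu> (transpose 1 2)"
proof -
  obtain w where w: "w permutes {1..sum_list \<mu>}" "w 1 = a" "w 2 = b"
    using exists_permutes_pair[OF assms] by blast
  have "inv' w a = 1" "inv' w b = 2" using w permutes_inverses(2)[OF w(1)] by auto
  then have "inv' w \<circ> transpose a b \<circ> w = transpose 1 2"
    by (simp add: conj_transpose[OF w(1)])
  then show ?thesis using chi_conj[OF w(1) permutes_swap_id[OF assms(1,2)]] by simp
qed

section \<open>The determinant of the induced representation\<close>

lemma prod_list_upt: "(\<Prod>k\<leftarrow>[0..<r]. h k) = (\<Prod>k<r. h k)"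
  using prod.distinct_set_conv_list[of "[0..<r]" h] by (simp add: lessThan_atLeast0)

lemma sum_blocks:
  "(\<Sum>k<length bs. \<Sum>i\<in>block bs k. h i) = (\<Sum>i\<in>{1..sum_list bs}. h i)"
proof -
  have "(\<Sum>k<length bs. \<Sum>i\<in>block bs k. h i) =
    (\<Sum>k<length bs. \<Sum>i\<in>{i \<in> {1..sum_list bs}. block_index bs i = k}. h i)"
    by (intro sum.cong refl) (simp only: block_eq lessThan_iff)
  also have "\<dots> = (\<Sum>i\<in>{1..sum_list bs}. h i)"
    using block_index(1) by (intro sum.group) blast+
  finally show ?thesis .
qed

lemma sum_nat_by_value:
  fixes f :: "'a \<Rightarrow> nat"
  assumes "finite I" "\<And>i. i \<in> I \<Longrightarrow> f i < r"
  shows "(\<Sum>i\<in>I. f i) = (\<Sum>k<r. k * card {i \<in> I. f i = k})"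
proof -
  have "(\<Sum>i\<in>I. f i) = (\<Sum>k<r. \<Sum>i\<in>{i \<in> I. f i = k}. f i)"
    using assms by (intro sum.group[symmetric]) auto
  then show ?thesis by (simp add: mult.commute)
qed

text \<open>For block sizes b with sum n this sorts the n(n-1) ordered pairs of distinct points by
  whether both lie in one block. It merges the two summands of \<open>y_num\<close>.\<close>

lemma square_sum_pairs:
  fixes b :: "nat \<Rightarrow> 'a::comm_ring_1"
  shows "(\<Sum>k<r. b k) * ((\<Sum>k<r. b k) - 1) = (\<Sum>k<r. b k * (b k - 1)) + 2 * (\<Sum>j<r. \<Sum>i<j. b i * b j)"
proof (induction r)
  case (Suc r)
  have e: "(\<Sum>i<r. b i * b r) = (\<Sum>i<r. b i) * b r" by (simp add: sum_distrib_right)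
  show ?case unfolding sum.lessThan_Suc e using Suc by (simp add: algebra_simps)
qed simp

lemma powi_power: "(z powi a) ^ k = z powi (int k * a)" for z :: "'a::field"
  by (metis mult.commute power_int_mult power_int_of_nat)

text \<open>The right side is visibly half of dimension minus trace at a transposition, and it is
  symmetric in the components of \<open>lam\<close>. Each \<open>g_num\<close> term contributes a
  multiple of b_k (b_k - 1) (1 - chi/f); the terms without chi combine with the sum over i < j to
  n(n-1).\<close>

lemma y_num_eq:
  assumes n: "2 \<le> n" and lam: "lam \<in> Pnr n r"
  defines "b \<equiv> \<lambda>k. sum_list (lam ! k)"
  shows "y_num n r lam = (\<Prod>k<r. of_nat (f_dim (lam ! k))) * fact (n - 2) / (\<Prod>k<r. fact (b k)) *
    (of_nat (n * (n - 1)) - (\<Sum>k<r. of_nat (b k * (b k - 1)) *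
       (chi (lam ! k) (transpose 1 2) / of_nat (f_dim (lam ! k))))) / 2"
proof -
  let ?F = "\<Prod>k<r. of_nat (f_dim (lam ! k)) :: complex" and ?B = "\<Prod>k<r. fact (b k) :: complex"
  let ?f = "\<lambda>k. of_nat (f_dim (lam ! k)) :: complex" and ?c = "\<lambda>k. chi (lam ! k) (transpose 1 2)"
  let ?m = "\<lambda>k. multinom (n - 2) (map (\<lambda>j. int (b j) - (if j = k then 2 else 0)) [0..<r])"
  have B0: "?B \<noteq> 0" by simp
  have f0: "?f k \<noteq> 0" for k using f_dim_pos[of "lam ! k"] by simp
  have len: "length lam = r" and nb: "n = (\<Sum>k<r. b k)"
    using lam by (auto simp: Pnr_def b_def sum_list_sum_nth lessThan_atLeast0)
  \<comment> \<open>Replacing (b_k - 2)! by b_k! in the denominator costs the factor b_k (b_k -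
    1).\<close>
  have m: "?m k = of_nat (b k * (b k - 1)) * fact (n - 2) / ?B" if k: "k < r" "2 \<le> b k" for k
  proof -
    have "?m k = fact (n - 2) / (\<Prod>j<r. fact (nat (int (b j) - (if j = k then 2 else 0))))"
      using k(2) by (auto simp: multinom_def prod_list_upt o_def)
    also have "(\<Prod>j<r. fact (nat (int (b j) - (if j = k then 2 else 0))) :: complex) =
        (\<Prod>j\<in>{..<r} - {k}. fact (b j)) * fact (b k - 2)"
      using k by (subst prod.remove[of _ k]) (auto simp: nat_diff_distrib mult.commute intro!: arg_cong2[where f = "(*)"] prod.cong)
    finally have 1: "?m k = fact (n - 2) / ((\<Prod>j\<in>{..<r} - {k}. fact (b j)) * fact (b k - 2))" .
    have "?B = fact (b k) * (\<Prod>j\<in>{..<r} - {k}. fact (b j))"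
      using k by (simp add: prod.remove)
    moreover have "(fact (b k) :: complex) = of_nat (b k * (b k - 1)) * fact (b k - 2)"
    proof -
      obtain m where "b k = Suc (Suc m)" using k(2) by (metis add_2_eq_Suc le_Suc_ex)
      then show ?thesis by (simp add: algebra_simps)
    qed
    ultimately have B: "?B = of_nat (b k * (b k - 1)) * ((\<Prod>j\<in>{..<r} - {k}. fact (b j)) * fact (b k - 2))"
      by simp
    have "of_nat (b k * (b k - 1)) \<noteq> (0 :: complex)"
      using k(2) unfolding of_nat_eq_0_iff by simp
    then show ?thesis unfolding 1 B by (simp only: mult_divide_mult_cancel_left simp_thms)
  qed
  have rest: "(\<Prod>j\<in>{..<r} - {k}. ?f j) = ?F / ?f k" if "k < r" for k
    using that f0 by (simp add: prod.remove[of "{..<r}" k])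
  have cancel: "f * q / 2 * (F / f) * (N * m / B) = F * m / B * (N * q) / 2" if "f \<noteq> 0"
    for f q F N m B :: complex using that by (simp add: divide_simps mult_ac)
  have g: "g_num (lam ! k) * (\<Prod>j\<in>{..<r} - {k}. ?f j) * ?m k =
    ?F * fact (n - 2) / ?B * (of_nat (b k * (b k - 1)) * (1 - ?c k / ?f k)) / 2" if k: "k < r" for k
  proof (cases "2 \<le> b k")
    case True
    then have "g_num (lam ! k) = ?f k * (1 - ?c k / ?f k) / 2"
      using f0[of k] by (simp add: g_num_def b_def right_diff_distrib)
    then show ?thesis unfolding rest[OF k] m[OF k True] using cancel[OF f0] by (simp only:)
  next
    case False
    \<comment> \<open>For blocks with fewer than two points this vanishing factor agrees with the
      convention \<open>g_num\<close> = 0.\<close>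
    then have b: "b k * (b k - 1) = 0" by (cases "b k") simp_all
    have "g_num (lam ! k) = 0" using False unfolding g_num_def b_def by (simp only: not_le if_True)
    then show ?thesis unfolding b by (simp only: mult_zero_left mult_zero_right div_0 of_nat_0)
  qed
  have n1: "of_nat (n * (n - 1)) = (of_nat n * (of_nat n - 1) :: complex)"
    using n by (simp add: of_nat_diff)
  have b1: "(of_nat (b k * (b k - 1)) :: complex) = of_nat (b k) * (of_nat (b k) - 1)" for k
    by (cases "b k") (simp_all add: algebra_simps)
  have pairs: "(of_nat (n * (n - 1)) :: complex) =
      (\<Sum>k<r. of_nat (b k * (b k - 1))) + 2 * (\<Sum>j<r. \<Sum>i<j. of_nat (b i * b j))"
    unfolding n1 b1 using square_sum_pairs[of "\<lambda>k. of_nat (b k) :: complex" r] nb by simp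
  have "y_num n r lam = ?F * (fact (n - 2) / ?B) * (\<Sum>j<r. \<Sum>i<j. of_nat (b i * b j)) +
    (\<Sum>k<r. g_num (lam ! k) * (\<Prod>j\<in>{..<r} - {k}. ?f j) * ?m k)"
    using n unfolding y_num_def Let_def b_def by simp
  also have "(\<Sum>k<r. g_num (lam ! k) * (\<Prod>j\<in>{..<r} - {k}. ?f j) * ?m k) =
    (\<Sum>k<r. ?F * fact (n - 2) / ?B * (of_nat (b k * (b k - 1)) * (1 - ?c k / ?f k)) / 2)"
    using g by (intro sum.cong refl) simp
  also have "\<dots> = ?F * fact (n - 2) / ?B * (\<Sum>k<r. of_nat (b k * (b k - 1)) * (1 - ?c k / ?f k)) / 2"
    by (simp only: sum_distrib_left sum_divide_distrib)
  also have "(\<Sum>k<r. of_nat (b k * (b k - 1)) * (1 - ?c k / ?f k)) =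
    (\<Sum>k<r. of_nat (b k * (b k - 1))) - (\<Sum>k<r. of_nat (b k * (b k - 1)) * (?c k / ?f k))"
    by (simp only: right_diff_distrib mult_1_right sum_subtractf)
  finally show ?thesis unfolding pairs by (simp add: algebra_simps add_divide_distrib diff_divide_distrib)
qed

section \<open>The determinant for a fixed tuple of partitions\<close>

context
  fixes \<zeta> :: complex and n r :: nat and lam :: "nat list list"
  assumes r: "r > 0" and root: "\<zeta> ^ r = 1" and lam: "lam \<in> Pnr n r"
begin

private abbreviation "bs \<equiv> map sum_list lam"
private abbreviation "G \<equiv> Gnr n r"
private abbreviation "H \<equiv> young_subgroup bs r"
private abbreviation "ts \<equiv> left_transversal G H"
private abbreviation "perm i \<equiv> snd (ts ! i)"
private abbreviation "dim_box \<equiv> \<Prod>k<r. f_dim (lam ! k)"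
private abbreviation "fact_prod \<equiv> \<Prod>k<r. fact (sum_list (lam ! k)) :: nat"

private lemma lam_sizes: "length lam = r" "length bs = r" "sum_list bs = n"
  "k < r \<Longrightarrow> bs ! k = sum_list (lam ! k)"
  using lam by (auto simp: Pnr_def)

private lemma zeta_nonzero: "\<zeta> \<noteq> 0"
  using r root by (auto simp: power_0_left)

private lemma group_G: "group G" and subgroup_H: "subgroup H G" and finite_G: "finite (carrier G)"
  using group_Gnr[OF r] subgroup_young[OF r, of bs] finite_Gnr[OF r] by (simp_all add: lam_sizes)

private lemma rho_box_eq:
  "rho_box \<zeta> lam h = foldr kronecker (map (\<lambda>k. rho_ext \<zeta> (lam ! k) k (proj_factor bs k h)) [0..<r]) (1\<^sub>m 1)"
  by (simp add: rho_box_def lam_sizes)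

private lemma matrix_rep_box: "matrix_rep G H dim_box (rho_box \<zeta> lam)"
proof -
  have "matrix_rep G H (\<Prod>k\<leftarrow>[0..<r]. f_dim (lam ! k))
    (\<lambda>h. foldr kronecker (map (\<lambda>k. rho_ext \<zeta> (lam ! k) k (proj_factor bs k h)) [0..<r]) (1\<^sub>m 1))"
    using matrix_rep_factor[OF r root, of _ bs] by (intro matrix_rep_kronecker) (simp add: lam_sizes)
  then show ?thesis unfolding prod_list_upt rho_box_eq[abs_def] .
qed

private lemmas rho_rep = matrix_rep_induced[OF group_G subgroup_H finite_G matrix_rep_box]

private lemma ts_carrier: "i < length ts \<Longrightarrow> ts ! i \<in> carrier G"
  using left_transversal(2)[OF group_G subgroup_H finite_G] nth_mem by blast

private lemma perm_permutes: "i < length ts \<Longrightarrow> perm i permutes {1..n}"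
  using ts_carrier[of i] carrier_Gnr[OF r, of "fst (ts ! i)" "perm i" n] by simp

text \<open>The condition ignores the diagonal part, so the factor r^n occurs both in |H| and in the
  number of group elements, and cancels.\<close>

private lemma card_transversal_perm_filter:
  assumes "\<And>w v. w permutes {1..n} \<Longrightarrow> v permutes {1..n} \<Longrightarrow>
    (\<forall>i\<in>{1..n}. block_index bs (v i) = block_index bs i) \<Longrightarrow> Q (w \<circ> v) \<longleftrightarrow> Q w"
  shows "card {i. i < length ts \<and> Q (perm i)} * fact_prod = card {w. w permutes {1..n} \<and> Q w}"
proof -
  have inv: "Q (snd (g \<otimes>\<^bsub>G\<^esub> h)) \<longleftrightarrow> Q (snd g)" if g: "g \<in> carrier G" and h: "h \<in> H" for g h
  proof -
    obtain x w y v where e: "g = (x, w)" "h = (y, v)" by (cases g; cases h)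
    then show ?thesis
      using g h assms[of w v] by (simp add: mult_Gnr young_subgroup_iff[OF r] carrier_Gnr[OF r] lam_sizes)
  qed
  have prod_eq: "(\<Prod>k<length bs. fact (bs ! k)) = fact_prod"
    unfolding lam_sizes(2) by (intro prod.cong refl) (simp add: lam_sizes)
  have "card {i. i < length ts \<and> Q (perm i)} * (r ^ n * fact_prod) = r ^ n * card {w. w permutes {1..n} \<and> Q w}"
    using card_transversal_filter[OF group_G subgroup_H finite_G, of "\<lambda>g. Q (snd g)"] inv
      card_young_subgroup[OF r, of bs] card_Gnr_filter[OF r, of n Q]
    unfolding prod_eq lam_sizes(3) by simp
  then show ?thesis using r by (simp add: mult.left_commute)
qed

private lemma length_transversal: "length ts * fact_prod = fact n"
  using card_transversal_perm_filter[of "\<lambda>_. True"] card_permutations[of "{1..n}" n] by simp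

text \<open>A coset of the Young subgroup distributes the points among labelled blocks, and
  \<open>block_index bs (inv' w j)\<close> is the label of j. Right multiplication by a
  block-preserving v does not change labels.\<close>

private lemma block_preserving_inv':
  assumes "w permutes {1..n}" "v permutes {1..n}" "\<forall>i\<in>{1..n}. block_index bs (v i) = block_index bs i"
    "j \<in> {1..n}"
  shows "block_index bs (inv' (w \<circ> v) j) = block_index bs (inv' w j)"
proof -
  have "inv' w j \<in> {1..n}" using permutes_in_image[OF permutes_inv[OF assms(1)]] assms(4) by blast
  then show ?thesis
    using block_preserving_inv[of v bs "inv' w j"] assms inv_comp_permutes[OF assms(1,2)]
    by (simp only: lam_sizes comp_apply)
qed

private lemma inv_perm_in_block_iff:
  assumes "w permutes {1..n}" "j \<in> {1..n}" "k < r"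
  shows "block_index bs (inv' w j) = k \<longleftrightarrow> inv' w j \<in> block bs k"
proof -
  have "inv' w j \<in> {1..n}" using permutes_in_image[OF permutes_inv[OF assms(1)]] assms(2) by blast
  then show ?thesis using block_eq[of k bs] assms(3) unfolding lam_sizes by blast
qed

private lemma card_block: "k < r \<Longrightarrow> card (block bs k) = sum_list (lam ! k)"
  by (simp add: block_def lam_sizes)

private lemma card_transversal_point:
  assumes "j \<in> {1..n}" "k < r"
  shows "card {i. i < length ts \<and> block_index bs (inv' (perm i) j) = k} * fact_prod =
    sum_list (lam ! k) * fact (n - 1)"
proof -
  have "card {i. i < length ts \<and> block_index bs (inv' (perm i) j) = k} * fact_prod =
    card {w. w permutes {1..n} \<and> block_index bs (inv' w j) = k}"
    using block_preserving_inv' assms(1) by (intro card_transversal_perm_filter) simp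
  also have "\<dots> = card {w. w permutes {1..n} \<and> inv' w j \<in> block bs k}"
    using inv_perm_in_block_iff[OF _ assms] by (intro arg_cong[where f = card]) blast
  also have "\<dots> = card {w. w permutes {1..n} \<and> w j \<in> block bs k}"
    by (rule card_permutes_inv)
  also have "\<dots> = sum_list (lam ! k) * fact (n - 1)"
    using card_permutes_point_in[OF assms(1), of "block bs k"] block_subset[of k bs] assms(2)
    by (simp only: lam_sizes card_block)
  finally show ?thesis .
qed

text \<open>Counts the cosets giving both 1 and 2 the label k. Passing to inverses turns this into
  counting permutations that send 1 and 2 into block k.\<close>

private lemma card_transversal_pair:
  assumes "2 \<le> n" "k < r"
  shows "card {i. i < length ts \<and> block_index bs (inv' (perm i) 1) = k \<and> block_index bs (inv' (perm i) 2) = k} * fact_prod =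
    sum_list (lam ! k) * (sum_list (lam ! k) - 1) * fact (n - 2)"
proof -
  have n12: "1 \<in> {1..n}" "2 \<in> {1..n}" using assms by auto
  let ?Q = "\<lambda>w. block_index bs (inv' w 1) = k \<and> block_index bs (inv' w 2) = k"
  have "card {i. i < length ts \<and> ?Q (perm i)} * fact_prod = card {w. w permutes {1..n} \<and> ?Q w}"
    using block_preserving_inv' n12 by (intro card_transversal_perm_filter) (simp only:)
  also have "\<dots> = card {w. w permutes {1..n} \<and> inv' w 1 \<in> block bs k \<and> inv' w 2 \<in> block bs k}"
    using inv_perm_in_block_iff[OF _ n12(1) assms(2)] inv_perm_in_block_iff[OF _ n12(2) assms(2)]
    by (intro arg_cong[where f = card]) blast
  also have "\<dots> = card {w. w permutes {1..n} \<and> w 1 \<in> block bs k \<and> w 2 \<in> block bs k}"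
    by (rule card_permutes_inv)
  also have "\<dots> = sum_list (lam ! k) * (sum_list (lam ! k) - 1) * fact (n - 2)"
    using card_permutes_pair_in[OF assms(1), of "block bs k"] block_subset[of k bs] assms(2)
    by (simp only: lam_sizes card_block)
  finally show ?thesis .
qed

text \<open>On the i-th diagonal block, tensor factor k acts by zeta to the power k times the
  coordinate sum over block k. With indices from 0, the position k is at once the label and the
  twist, so the total exponent is the sum of label times coordinate.\<close>

private lemma det_rho_diagonal_sum:
  assumes x: "(x, id) \<in> carrier G"
  shows "det (rho \<zeta> n r lam (x, id)) =
    \<zeta> powi (int dim_box * (\<Sum>i<length ts. \<Sum>j\<in>{1..n}. int (block_index bs (inv' (perm i) j)) * x j))"
proof -
  let ?s = "\<lambda>i. \<Sum>j\<in>{1..n}. int (block_index bs (inv' (perm i) j)) * x j"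
  interpret group G by (rule group_G)
  have conj: "inv\<^bsub>G\<^esub> (ts ! i) \<otimes>\<^bsub>G\<^esub> (x, id) \<otimes>\<^bsub>G\<^esub> ts ! i = ((\<lambda>j\<in>{1..n}. x (perm i j)), id)"
    if "i < length ts" for i
    using conj_Gnr_diagonal[OF r x, of "fst (ts ! i)" "perm i"] ts_carrier[OF that] by simp
  have "det (rho \<zeta> n r lam (x, id)) = (\<Prod>i<length ts. (\<zeta> powi ?s i) ^ dim_box)"
    unfolding rho_def
  proof (rule induced_rep_det_scalar[OF group_G subgroup_H finite_G matrix_rep_box x])
    fix i assume i: "i < length ts"
    have w: "perm i permutes {1..n}" using perm_permutes[OF i] .
    have "((\<lambda>j\<in>{1..n}. x (perm i j)), id) \<in> carrier G"
      using x ts_carrier[OF i] by (simp only: conj[OF i, symmetric] m_closed inv_closed)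
    then show "inv\<^bsub>G\<^esub> (ts ! i) \<otimes>\<^bsub>G\<^esub> (x, id) \<otimes>\<^bsub>G\<^esub> ts ! i \<in> H"
      unfolding conj[OF i] young_subgroup_iff[OF r] lam_sizes by simp
    let ?z = "\<lambda>k. (\<zeta> powi (\<Sum>j\<in>block bs k. x (perm i j))) ^ k"
    have "rho_ext \<zeta> (lam ! k) k (proj_factor bs k ((\<lambda>j\<in>{1..n}. x (perm i j)), id)) =
        ?z k \<cdot>\<^sub>m 1\<^sub>m (f_dim (lam ! k))" if "k < r" for k
    proof -
      have "(\<Sum>j\<in>block bs k. (\<lambda>j\<in>{1..n}. x (perm i j)) j) = (\<Sum>j\<in>block bs k. x (perm i j))"
        using block_subset[of k bs] that by (intro sum.cong refl) (auto simp: lam_sizes)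
      then show ?thesis
        using that by (simp only: rho_ext_proj_factor lam_sizes block_restrict_id rho_sym_id)
    qed
    then have "rho_box \<zeta> lam ((\<lambda>j\<in>{1..n}. x (perm i j)), id) = (\<Prod>k<r. ?z k) \<cdot>\<^sub>m 1\<^sub>m dim_box"
      unfolding rho_box_eq prod_list_upt[symmetric] by (intro foldr_kronecker_scalar) simp
    also have "(\<Prod>k<r. ?z k) = \<zeta> powi (\<Sum>k<r. \<Sum>j\<in>block bs k. int k * x (perm i j))"
      by (simp only: powi_sum[OF zeta_nonzero, of _ "{..<r}"] powi_power sum_distrib_left)
    also have "(\<Sum>k<r. \<Sum>j\<in>block bs k. int k * x (perm i j)) =
        (\<Sum>k<r. \<Sum>j\<in>block bs k. int (block_index bs j) * x (perm i j))"
      by (intro sum.cong refl) (simp add: block_indexI lam_sizes)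
    also have "\<dots> = (\<Sum>j\<in>{1..n}. int (block_index bs j) * x (perm i j))"
      using sum_blocks[of "\<lambda>j. int (block_index bs j) * x (perm i j)" bs] by (simp only: lam_sizes)
    \<comment> \<open>Substituting \<open>inv' (perm i) j\<close> for j moves the representative
      from x to the labels.\<close>
    also have "\<dots> = ?s i"
      using sum.permute[OF w, of "\<lambda>j. int (block_index bs (inv' (perm i) j)) * x j"]
      by (simp add: o_def permutes_inverses(2)[OF w])
    finally show "rho_box \<zeta> lam (inv\<^bsub>G\<^esub> (ts ! i) \<otimes>\<^bsub>G\<^esub> (x, id) \<otimes>\<^bsub>G\<^esub> ts ! i) = (\<zeta> powi ?s i) \<cdot>\<^sub>m 1\<^sub>m dim_box"
      by (simp only: conj[OF i])
  qed
  also have "\<dots> = \<zeta> powi (int dim_box * (\<Sum>i<length ts. ?s i))"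
    unfolding sum_distrib_left[of "int dim_box" ?s] powi_sum[OF zeta_nonzero, of _ "{..<length ts}"]
    by (simp only: powi_power)
  finally show ?thesis .
qed

text \<open>The total label \<open>?E j\<close> over all cosets is determined by a count that does
  not involve j. All coordinates thus get the same weight, and the exponent becomes a multiple of
  their sum.\<close>

private lemma det_rho_diagonal:
  assumes "1 \<le> n"
  obtains X where "\<forall>x. (x, id) \<in> carrier G \<longrightarrow> det (rho \<zeta> n r lam (x, id)) = (\<zeta> powi (\<Sum>j\<in>{1..n}. x j)) ^ X"
    "X * fact_prod = dim_box * fact (n - 1) * (\<Sum>k<r. k * sum_list (lam ! k))"
proof -
  let ?E = "\<lambda>j. \<Sum>i<length ts. block_index bs (inv' (perm i) j)"
  have E: "?E j * fact_prod = fact (n - 1) * (\<Sum>k<r. k * sum_list (lam ! k))" if j: "j \<in> {1..n}" for j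
  proof -
    have lt: "block_index bs (inv' (perm i) j) < r" if "i < length ts" for i
      using block_index(1)[of "inv' (perm i) j" bs] permutes_in_image[OF permutes_inv[OF perm_permutes[OF that]], of j] j
      by (simp only: lam_sizes)
    have "?E j = (\<Sum>k<r. k * card {i \<in> {..<length ts}. block_index bs (inv' (perm i) j) = k})"
      using lt by (intro sum_nat_by_value) auto
    then have "?E j * fact_prod = (\<Sum>k<r. k * (card {i. i < length ts \<and> block_index bs (inv' (perm i) j) = k} * fact_prod))"
      by (simp add: sum_distrib_right mult.assoc)
    also have "\<dots> = (\<Sum>k<r. k * (sum_list (lam ! k) * fact (n - 1)))"
      using card_transversal_point[OF j] by (intro sum.cong refl) simp
    finally show ?thesis by (simp add: sum_distrib_left mult_ac)
  qed
  have one: "1 \<in> {1..n}" using assms by simp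
  have E1: "?E j = ?E 1" if "j \<in> {1..n}" for j
  proof -
    have "?E j * fact_prod = ?E 1 * fact_prod" using E[OF that] E[OF one] by (simp only:)
    then show ?thesis by simp
  qed
  have A: "det (rho \<zeta> n r lam (x, id)) = (\<zeta> powi (\<Sum>j\<in>{1..n}. x j)) ^ (dim_box * ?E 1)"
    if x: "(x, id) \<in> carrier G" for x
  proof -
    have "(\<Sum>i<length ts. \<Sum>j\<in>{1..n}. int (block_index bs (inv' (perm i) j)) * x j) = (\<Sum>j\<in>{1..n}. int (?E j) * x j)"
      by (subst sum.swap) (simp add: sum_distrib_right)
    also have "\<dots> = (\<Sum>j\<in>{1..n}. int (?E 1) * x j)"
      using E1 by (intro sum.cong refl) (simp only:)
    finally have s: "(\<Sum>i<length ts. \<Sum>j\<in>{1..n}. int (block_index bs (inv' (perm i) j)) * x j) = int (?E 1) * (\<Sum>j\<in>{1..n}. x j)"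
      by (simp only: sum_distrib_left)
    have "int dim_box * (int (?E 1) * (\<Sum>j\<in>{1..n}. x j)) = (\<Sum>j\<in>{1..n}. x j) * int (dim_box * ?E 1)"
      by simp
    then show ?thesis
      unfolding det_rho_diagonal_sum[OF x] s by (simp only: power_int_mult power_int_of_nat)
  qed
  show thesis
    by (rule that[of "dim_box * ?E 1"]) (use A in blast, simp only: mult.assoc E[OF one])
qed

section \<open>Values on permutations\<close>

private lemma matrix_rep_rho: "matrix_rep G (carrier G) (length ts * dim_box) (rho \<zeta> n r lam)"
  using rho_rep unfolding rho_def[abs_def] .

private lemma det_rho_mult:
  "g \<in> carrier G \<Longrightarrow> h \<in> carrier G \<Longrightarrow>
   det (rho \<zeta> n r lam (g \<otimes>\<^bsub>G\<^esub> h)) = det (rho \<zeta> n r lam g) * det (rho \<zeta> n r lam h)"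
  using matrix_rep_rho det_mult unfolding matrix_rep_def by metis

private abbreviation "perm_elt w \<equiv> ((\<lambda>i\<in>{1..n}. 0 :: int), w :: nat \<Rightarrow> nat)"

private lemma perm_elt_carrier: "w permutes {1..n} \<Longrightarrow> perm_elt w \<in> carrier G"
  using r by (auto simp: carrier_Gnr)

private lemma perm_elt_mult: "w permutes {1..n} \<Longrightarrow> perm_elt w \<otimes>\<^bsub>G\<^esub> perm_elt v = perm_elt (w \<circ> v)"
  using permutes_in_image[OF permutes_inv, of w "{1..n}"]
  by (auto simp: mult_Gnr simp del: atLeastAtMost_iff intro!: restrict_ext)

private lemma decompose_G:
  assumes "(x, w) \<in> carrier G"
  shows "(x, id) \<in> carrier G" "(x, w) = (x, id) \<otimes>\<^bsub>G\<^esub> perm_elt w"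
proof -
  have x: "x \<in> {1..n} \<rightarrow>\<^sub>E {0..<int r}" using assms by (simp add: carrier_Gnr[OF r])
  show "(x, id) \<in> carrier G" using x by (simp add: carrier_Gnr[OF r] permutes_id)
  have "(\<lambda>i\<in>{1..n}. (x i + (\<lambda>i\<in>{1..n}. 0) (inv' id i)) mod int r) = x"
  proof (rule extensionalityI[of _ "{1..n}"])
    show "x \<in> extensional {1..n}" using x by (simp add: PiE_iff)
    fix i assume "i \<in> {1..n}"
    then show "(\<lambda>i\<in>{1..n}. (x i + (\<lambda>i\<in>{1..n}. 0) (inv' id i)) mod int r) i = x i"
      using PiE_mem[OF x, of i] by (simp add: inv_id)
  qed simp
  then show "(x, w) = (x, id) \<otimes>\<^bsub>G\<^esub> perm_elt w" unfolding mult_Gnr id_comp by simp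
qed

text \<open>The conjugate permutes by (a b), where a and b are the preimages of 1 and 2. It lies in
  H exactly when they share a block k; then factor k sees a transposition, every other factor sees
  the identity, and the powers of zeta are 1.\<close>

private lemma trace_conj_transposition:
  fixes i
  assumes n: "2 \<le> n" and i: "i < length ts"
  defines "h \<equiv> inv\<^bsub>G\<^esub> (ts ! i) \<otimes>\<^bsub>G\<^esub> perm_elt (transpose 1 2) \<otimes>\<^bsub>G\<^esub> ts ! i"
  defines "k \<equiv> block_index bs (inv' (perm i) 1)"
  shows "h \<in> H \<longleftrightarrow> block_index bs (inv' (perm i) 2) = k"
    and "h \<in> H \<Longrightarrow> mat_trace (rho_box \<zeta> lam h) =
      chi (lam ! k) (transpose 1 2) * (\<Prod>l\<in>{..<r} - {k}. of_nat (f_dim (lam ! l)))"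
proof -
  interpret group G by (rule group_G)
  define s where "s = transpose 1 (2::nat)"
  define w where "w = perm i"
  define y where "y = fst (ts ! i)"
  define a where "a = inv' w 1"
  define b where "b = inv' w 2"
  have n12: "1 \<in> {1..n}" "2 \<in> {1..n}" using n by auto
  have sperm: "s permutes {1..n}" unfolding s_def using n12 by (rule permutes_swap_id)
  have w: "w permutes {1..n}" unfolding w_def using perm_permutes[OF i] .
  have yw: "ts ! i = (y, w)" by (simp add: y_def w_def)
  have ab: "a \<in> {1..n}" "b \<in> {1..n}" "a \<noteq> b"
    using permutes_in_image[OF permutes_inv[OF w]] n12 permutes_inj[OF permutes_inv[OF w]]
    unfolding a_def b_def by (simp_all add: inj_eq del: atLeastAtMost_iff)
  have conj: "inv' w \<circ> s \<circ> w = transpose a b"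
    unfolding s_def a_def b_def by (rule conj_transpose[OF w])
  have h: "h = ((\<lambda>j\<in>{1..n}. (y (inv' s (w j)) - y (w j)) mod int r), transpose a b)"
    unfolding h_def yw s_def[symmetric]
    using conj_Gnr_permutation[OF r sperm, of y w] ts_carrier[OF i] by (simp only: yw conj)
  have hc: "h \<in> carrier G"
    unfolding h_def using ts_carrier[OF i] perm_elt_carrier[OF sperm] by (simp add: s_def)
  have k: "k = block_index bs a" by (simp add: k_def a_def w_def)
  have kr: "k < r" "a \<in> block bs k" using block_index[of a bs] ab k by (simp_all only: lam_sizes)
  have iff: "h \<in> H \<longleftrightarrow> block_index bs b = k"
  proof
    assume "h \<in> H"
    then have "block_index bs (transpose a b a) = block_index bs a"
      unfolding h young_subgroup_iff[OF r] lam_sizes using ab(1) by blast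
    then show "block_index bs b = k" by (simp add: k)
  next
    assume "block_index bs b = k"
    then have "\<forall>j\<in>{1..n}. block_index bs (transpose a b j) = block_index bs j"
      by (auto simp: transpose_def k)
    then show "h \<in> H" using hc unfolding h young_subgroup_iff[OF r] lam_sizes by blast
  qed
  then show "h \<in> H \<longleftrightarrow> block_index bs (inv' (perm i) 2) = k" by (simp add: b_def w_def)
  assume hH: "h \<in> H"
  then have bk: "b \<in> block bs k"
    using iff block_index(2)[of b bs] ab(2) by (simp only: lam_sizes)
  have ext: "rho_ext \<zeta> (lam ! l) l (proj_factor bs l h) = rho_sym (lam ! l) (block_restrict bs l (transpose a b))"
    if l: "l < r" for l
  proof -
    have im: "transpose a b ` block bs l = block bs l"
      using block_preserving_image[OF r hH[unfolded h], of l] l by (simp only: lam_sizes)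
    \<comment> \<open>From s w = w (a b) and s being an involution. The diagonal part at j becomes y
      (w (a b) j) - y (w j), whose two halves have equal sums over the stable block l.\<close>
    have swap: "inv' s (w j) = w (transpose a b j)" for j
    proof -
      have "w (transpose a b j) = w (inv' w (s (w j)))" by (simp add: conj[symmetric])
      also have "\<dots> = s (w j)" using w by (simp add: permutes_inverses)
      finally show ?thesis by (simp add: s_def)
    qed
    have bij: "bij_betw (transpose a b) (block bs l) (block bs l)"
      using im inj_transpose[of a b] by (auto simp: bij_betw_def intro: inj_on_subset)
    have "(\<Sum>j\<in>block bs l. (\<lambda>j\<in>{1..n}. (y (inv' s (w j)) - y (w j)) mod int r) j) =
      (\<Sum>j\<in>block bs l. (y (w (transpose a b j)) - y (w j)) mod int r)"
      using block_subset[of l bs] l unfolding swap by (intro sum.cong refl) (auto simp: lam_sizes)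
    then have "(\<Sum>j\<in>block bs l. (\<lambda>j\<in>{1..n}. (y (inv' s (w j)) - y (w j)) mod int r) j) mod int r =
      (\<Sum>j\<in>block bs l. y (w (transpose a b j)) - y (w j)) mod int r"
      by (simp only: mod_sum_eq)
    also have "\<dots> = 0 mod int r"
      using sum.reindex_bij_betw[OF bij, of "\<lambda>j. y (w j)"] by (simp add: sum_subtractf)
    finally have "\<zeta> powi (\<Sum>j\<in>block bs l. (\<lambda>j\<in>{1..n}. (y (inv' s (w j)) - y (w j)) mod int r) j) = 1"
      using powi_cong_mod[OF root r] by (metis power_int_0_right)
    moreover have "1 \<cdot>\<^sub>m A = A" for A :: "complex mat" by (intro eq_matI) auto
    ultimately show ?thesis
      unfolding h using l by (simp only: rho_ext_proj_factor lam_sizes power_one)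
  qed
  have "mat_trace (rho_box \<zeta> lam h) =
    (\<Prod>l\<leftarrow>[0..<r]. mat_trace (rho_ext \<zeta> (lam ! l) l (proj_factor bs l h)))"
    unfolding rho_box_eq
    by (rule foldr_kronecker_trace[where d = "\<lambda>l. f_dim (lam ! l)"]) (simp add: ext rho_sym_carrier)
  also have "\<dots> = (\<Prod>l<r. chi (lam ! l) (block_restrict bs l (transpose a b)))"
    unfolding prod_list_upt by (intro prod.cong refl) (simp add: ext chi_eq_trace)
  also have "\<dots> = chi (lam ! k) (block_restrict bs k (transpose a b)) *
      (\<Prod>l\<in>{..<r} - {k}. chi (lam ! l) (block_restrict bs l (transpose a b)))"
    using kr by (intro prod.remove) auto
  also have "chi (lam ! k) (block_restrict bs k (transpose a b)) = chi (lam ! k) (transpose 1 2)"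
    unfolding block_restrict_transpose[OF kr(2) bk]
    using kr bk ab(3) by (intro chi_transpose) (auto simp: block_def lam_sizes)
  also have "(\<Prod>l\<in>{..<r} - {k}. chi (lam ! l) (block_restrict bs l (transpose a b))) =
      (\<Prod>l\<in>{..<r} - {k}. of_nat (f_dim (lam ! l)))"
  proof (intro prod.cong refl)
    fix l assume l: "l \<in> {..<r} - {k}"
    then have "a \<notin> block bs l" "b \<notin> block bs l"
      using block_disjoint[of l bs k] kr bk by (auto simp: lam_sizes)
    then have "block_restrict bs l (transpose a b) = id"
      by (intro block_restrict_eq_id) (auto simp: transpose_def)
    then show "chi (lam ! l) (block_restrict bs l (transpose a b)) = of_nat (f_dim (lam ! l))"
      by (simp only: chi_id)
  qed
  finally show "mat_trace (rho_box \<zeta> lam h) =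
      chi (lam ! k) (transpose 1 2) * (\<Prod>l\<in>{..<r} - {k}. of_nat (f_dim (lam ! l)))" .
qed

private lemma trace_rho_transposition:
  assumes n: "2 \<le> n"
  shows "mat_trace (rho \<zeta> n r lam (perm_elt (transpose 1 2))) =
    (\<Sum>k<r. of_nat (card {i. i < length ts \<and> block_index bs (inv' (perm i) 1) = k \<and> block_index bs (inv' (perm i) 2) = k}) *
      (chi (lam ! k) (transpose 1 2) * (\<Prod>l\<in>{..<r} - {k}. of_nat (f_dim (lam ! l)))))"
proof -
  let ?v = "\<lambda>k. chi (lam ! k) (transpose 1 2) * (\<Prod>l\<in>{..<r} - {k}. of_nat (f_dim (lam ! l)))"
  let ?Q = "\<lambda>k i. block_index bs (inv' (perm i) 1) = k \<and> block_index bs (inv' (perm i) 2) = k"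
  let ?h = "\<lambda>i. inv\<^bsub>G\<^esub> (ts ! i) \<otimes>\<^bsub>G\<^esub> perm_elt (transpose 1 2) \<otimes>\<^bsub>G\<^esub> ts ! i"
  have tm: "(if ?h i \<in> H then mat_trace (rho_box \<zeta> lam (?h i)) else 0) = (\<Sum>k<r. if ?Q k i then ?v k else 0)"
    if i: "i < length ts" for i
  proof -
    let ?k = "block_index bs (inv' (perm i) 1)"
    have "1 \<in> {1..n}" using n by simp
    then have kr: "?k < r"
      using block_index(1)[of "inv' (perm i) 1" bs] permutes_in_image[OF permutes_inv[OF perm_permutes[OF i]], of 1]
      by (simp only: lam_sizes)
    have "(\<Sum>k<r. if ?Q k i then ?v k else 0) =
      (\<Sum>k<r. if k = ?k then (if block_index bs (inv' (perm i) 2) = ?k then ?v ?k else 0) else 0)"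
      by (intro sum.cong refl) auto
    also have "\<dots> = (if block_index bs (inv' (perm i) 2) = ?k then ?v ?k else 0)"
      using kr by simp
    finally show ?thesis
      using trace_conj_transposition[OF n i] by (simp only: if_True if_False split: if_split) simp
  qed
  have "mat_trace (rho \<zeta> n r lam (perm_elt (transpose 1 2))) =
    (\<Sum>i<length ts. if ?h i \<in> H then mat_trace (rho_box \<zeta> lam (?h i)) else 0)"
    unfolding rho_def induced_rep_trace[OF group_G subgroup_H finite_G matrix_rep_box] Let_def ..
  also have "\<dots> = (\<Sum>i<length ts. \<Sum>k<r. if ?Q k i then ?v k else 0)"
    using tm by (intro sum.cong refl) (simp only: lessThan_iff)
  also have "\<dots> = (\<Sum>k<r. \<Sum>i<length ts. if ?Q k i then ?v k else 0)"
    by (rule sum.swap)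
  also have "\<dots> = (\<Sum>k<r. of_nat (card {i. i < length ts \<and> ?Q k i}) * ?v k)"
  proof (intro sum.cong refl)
    fix k
    have "(\<Sum>i<length ts. if ?Q k i then ?v k else 0) = (\<Sum>i\<in>{i \<in> {..<length ts}. ?Q k i}. ?v k)"
      by (rule sum.inter_filter[symmetric]) simp
    then show "(\<Sum>i<length ts. if ?Q k i then ?v k else 0) = of_nat (card {i. i < length ts \<and> ?Q k i}) * ?v k"
      by (simp only: sum_constant lessThan_iff)
  qed
  finally show ?thesis .
qed

text \<open>Besides the sign this shows that \<open>y_num\<close> is a natural number, which makes
  the evenness and oddness predicates complementary.\<close>

private lemma det_rho_transposition:
  assumes n: "2 \<le> n"
  obtains Y where "det (rho \<zeta> n r lam (perm_elt (transpose 1 2))) = (-1) ^ Y" "y_num n r lam = of_nat Y"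
proof -
  let ?A = "rho \<zeta> n r lam (perm_elt (transpose 1 2))" and ?D = "length ts * dim_box"
  let ?F = "\<Prod>k<r. of_nat (f_dim (lam ! k)) :: complex" and ?f = "\<lambda>k. of_nat (f_dim (lam ! k)) :: complex"
  let ?b = "\<lambda>k. sum_list (lam ! k)" and ?c = "\<lambda>k. chi (lam ! k) (transpose 1 2)"
  let ?B = "of_nat fact_prod :: complex"
  have s: "transpose 1 2 permutes {1..n}" using n by (intro permutes_swap_id) auto
  have A: "?A \<in> carrier_mat ?D ?D"
    using matrix_rep_rho perm_elt_carrier[OF s] unfolding matrix_rep_def by blast
  have "?A * ?A = rho \<zeta> n r lam (perm_elt (transpose 1 2) \<otimes>\<^bsub>G\<^esub> perm_elt (transpose 1 2))"
    using matrix_rep_rho perm_elt_carrier[OF s] unfolding matrix_rep_def by simp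
  also have "\<dots> = rho \<zeta> n r lam \<one>\<^bsub>G\<^esub>"
    unfolding perm_elt_mult[OF s] one_Gnr by simp
  also have "\<dots> = 1\<^sub>m ?D" using matrix_rep_rho unfolding matrix_rep_def by simp
  finally have AA: "?A * ?A = 1\<^sub>m ?D" .
  obtain Y where Y: "mat_trace ?A = of_nat ?D - 2 * of_nat Y" "det ?A = (-1) ^ Y"
    by (rule involution_trace_det[OF A AA])
  have B0: "?B \<noteq> 0" by simp
  have f0: "?f k \<noteq> 0" for k using f_dim_pos[of "lam ! k"] by simp
  have card_k: "of_nat (card {i. i < length ts \<and> block_index bs (inv' (perm i) 1) = k \<and> block_index bs (inv' (perm i) 2) = k}) =
      (of_nat (?b k * (?b k - 1)) * fact (n - 2) / ?B :: complex)" if "k < r" for k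
    using arg_cong[OF card_transversal_pair[OF n that], of "of_nat :: nat \<Rightarrow> complex"]
    unfolding of_nat_mult of_nat_fact nonzero_eq_divide_eq[OF B0] .
  have "fact n = n * (n - 1) * (fact (n - 2) :: nat)"
  proof -
    obtain m where "n = Suc (Suc m)" using n by (metis add_2_eq_Suc le_Suc_ex)
    then show ?thesis by (simp add: algebra_simps)
  qed
  with length_transversal have "length ts * fact_prod = n * (n - 1) * fact (n - 2)" by (simp only:)
  from arg_cong[OF this, of "of_nat :: nat \<Rightarrow> complex"]
  have L: "of_nat (length ts) = of_nat (n * (n - 1)) * fact (n - 2) / ?B"
    unfolding of_nat_mult of_nat_fact nonzero_eq_divide_eq[OF B0] .
  have rest: "(\<Prod>l\<in>{..<r} - {k}. ?f l) = ?F / ?f k" if "k < r" for k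
    using that f0 by (simp add: prod.remove[of "{..<r}" k])
  have "mat_trace ?A = (\<Sum>k<r. ?F * fact (n - 2) / ?B * (of_nat (?b k * (?b k - 1)) * (?c k / ?f k)))"
    unfolding trace_rho_transposition[OF n]
    by (intro sum.cong refl) (simp only: lessThan_iff card_k rest, simp)
  then have tr: "mat_trace ?A = ?F * fact (n - 2) / ?B * (\<Sum>k<r. of_nat (?b k * (?b k - 1)) * (?c k / ?f k))"
    by (simp only: sum_distrib_left)
  have D: "of_nat ?D = ?F * fact (n - 2) / ?B * of_nat (n * (n - 1))"
    unfolding of_nat_mult[of "length ts"] L by simp
  have "2 * of_nat Y = of_nat ?D - mat_trace ?A" unfolding Y(1) by (simp only: diff_diff_eq2 add_diff_cancel_left')
  also have "\<dots> = ?F * fact (n - 2) / ?B * (of_nat (n * (n - 1)) -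
      (\<Sum>k<r. of_nat (?b k * (?b k - 1)) * (?c k / ?f k)))"
    unfolding tr D by (simp only: right_diff_distrib)
  also have "\<dots> = 2 * y_num n r lam"
    unfolding y_num_eq[OF n lam] by simp
  finally show thesis using that[OF Y(2)] by simp
qed

text \<open>The determinant is multiplicative with commuting values, so conjugate transpositions
  have equal determinants. Building w from transpositions then gives the power of the sign.\<close>

private lemma det_rho_permutation:
  assumes Y: "det (rho \<zeta> n r lam (perm_elt (transpose 1 2))) = (-1) ^ Y"
    and w: "w permutes {1..n}"
  shows "det (rho \<zeta> n r lam (perm_elt w)) = of_int (sign w) ^ Y"
proof -
  let ?D = "\<lambda>w. det (rho \<zeta> n r lam (perm_elt w))"
  have mult: "?D (u \<circ> v) = ?D u * ?D v" if "u permutes {1..n}" "v permutes {1..n}" for u v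
    using det_rho_mult[OF perm_elt_carrier perm_elt_carrier, OF that] by (simp only: perm_elt_mult[OF that(1)])
  have one: "?D id = 1"
    using matrix_rep_rho unfolding matrix_rep_def one_Gnr by simp
  have trans: "?D (transpose a b) = (-1) ^ Y" if ab: "a \<in> {1..n}" "b \<in> {1..n}" "a \<noteq> b" for a b
  proof -
    obtain u where u: "u permutes {1..n}" "u 1 = a" "u 2 = b" using exists_permutes_pair[OF ab] by blast
    have iu: "inv' u a = 1" "inv' u b = 2" using u permutes_inverses(2)[OF u(1)] by auto
    have s: "transpose 1 2 permutes {1..n}"
      using permutes_in_image[OF permutes_inv[OF u(1)]] ab iu by (intro permutes_swap_id) metis+
    have e: "u \<circ> transpose 1 2 \<circ> inv' u = transpose a b"
      using transpose_comp_permutes[OF u(1), of a b] unfolding iu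
      by (metis comp_assoc comp_id permutes_comp_inverses(2)[OF u(1)])
    have "?D (transpose a b) = ?D u * ?D (transpose 1 2) * ?D (inv' u)"
      unfolding e[symmetric] using mult permutes_compose[OF s u(1)] u(1) s permutes_inv[OF u(1)] by simp
    also have "\<dots> = ?D (transpose 1 2) * ?D (u \<circ> inv' u)"
      using mult[OF u(1) permutes_inv[OF u(1)]] by simp
    finally show ?thesis using one Y by (simp add: permutes_comp_inverses[OF u(1)])
  qed
  define D where "D w = ?D w" for w
  have "D w = of_int (sign w) ^ Y"
    using w finite_atLeastAtMost
  proof (induction rule: permutes_induct)
    case id
    show ?case unfolding D_def one by (simp only: sign_id of_int_1 power_one)
  next
    case (swap a b p)
    have "permutation p" using swap(4) by (rule permutes_imp_permutation[OF finite_atLeastAtMost])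
    then have sgn: "sign (transpose a b \<circ> p) = - sign p"
      using swap(3) by (simp add: sign_compose permutation_swap_id sign_swap_id)
    have "D (transpose a b \<circ> p) = (-1) ^ Y * D p"
      unfolding D_def mult[OF permutes_swap_id[OF swap(1,2)] swap(4)] trans[OF swap(1-3)] ..
    then show ?case
      unfolding sgn swap(5) by (simp only: of_int_minus power_minus[of "of_int (sign p)"])
  qed
  then show ?thesis by (simp only: D_def)
qed

lemma det_rho:
  assumes n: "1 \<le> n"
  obtains X Y where
    "\<forall>g\<in>carrier G. det (rho \<zeta> n r lam g) = zeta_char \<zeta> n g ^ X * sgn_char g ^ Y"
    "y_num n r lam = of_nat Y"
    "X * fact_prod = dim_box * fact (n - 1) * (\<Sum>k<r. k * sum_list (lam ! k))"
proof -
  obtain X where X: "\<forall>x. (x, id) \<in> carrier G \<longrightarrow> det (rho \<zeta> n r lam (x, id)) = (\<zeta> powi (\<Sum>j\<in>{1..n}. x j)) ^ X"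
    "X * fact_prod = dim_box * fact (n - 1) * (\<Sum>k<r. k * sum_list (lam ! k))"
    by (rule det_rho_diagonal[OF n])
  obtain Y where Y: "y_num n r lam = of_nat Y"
    "\<forall>w. w permutes {1..n} \<longrightarrow> det (rho \<zeta> n r lam (perm_elt w)) = of_int (sign w) ^ Y"
  proof (cases "2 \<le> n")
    case True
    obtain Y where "det (rho \<zeta> n r lam (perm_elt (transpose 1 2))) = (-1) ^ Y" "y_num n r lam = of_nat Y"
      by (rule det_rho_transposition[OF True])
    then show ?thesis using that[of Y] det_rho_permutation by blast
  next
    case False
    \<comment> \<open>The only permutation is the identity and \<open>y_num\<close> is 0 by its
      default, so Y = 0 serves.\<close>
    then have "n = 1" using n by simp
    have "w = id" if "w permutes {1..n}" for w
      using that unfolding \<open>n = 1\<close> by simp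
    moreover have "det (rho \<zeta> n r lam (perm_elt id)) = 1"
      using matrix_rep_rho unfolding matrix_rep_def one_Gnr by simp
    ultimately have "\<forall>w. w permutes {1..n} \<longrightarrow> det (rho \<zeta> n r lam (perm_elt w)) = of_int (sign w) ^ 0"
      by (metis power_0)
    then show ?thesis using that[of 0] False by (simp only: y_num_def not_le if_True of_nat_0)
  qed
  have "det (rho \<zeta> n r lam (x, w)) = zeta_char \<zeta> n (x, w) ^ X * sgn_char (x, w) ^ Y"
    if g: "(x, w) \<in> carrier G" for x w
  proof -
    have w: "w permutes {1..n}" using g by (simp add: carrier_Gnr[OF r])
    note d = decompose_G[OF g]
    show ?thesis
      unfolding d(2) det_rho_mult[OF d(1) perm_elt_carrier[OF w]] X(1)[rule_format, OF d(1)] Y(2)[rule_format, OF w]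
      unfolding d(2)[symmetric] by (simp add: zeta_char_def sgn_char_def)
  qed
  then show thesis using that[OF _ Y(1) X(2)] by fast
qed

end

section \<open>Counting\<close>

lemma prod_nth_eq_prod_list: "(\<Prod>k<length xs. h (xs ! k)) = (\<Prod>x\<leftarrow>xs. h x)"
  using prod_list_upt[of "\<lambda>k. h (xs ! k)" "length xs"] map_nth[of xs]
  by (metis (no_types, lifting) map_map comp_def map_eq_conv)

lemma sum_nth_eq_sum_list: "(\<Sum>k<length xs. h (xs ! k)) = (\<Sum>x\<leftarrow>xs. h x)"
  by (simp add: sum_list_sum_nth lessThan_atLeast0)

lemma prod_nth_mset_cong:
  fixes h :: "'a \<Rightarrow> 'b::comm_monoid_mult"
  assumes "mset xs = mset ys"
  shows "(\<Prod>k<length xs. h (xs ! k)) = (\<Prod>k<length ys. h (ys ! k))"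
  unfolding prod_nth_eq_prod_list using assms by (metis mset_map prod_mset_prod_list)

lemma sum_nth_mset_cong:
  fixes h :: "'a \<Rightarrow> 'b::comm_monoid_add"
  assumes "mset xs = mset ys"
  shows "(\<Sum>k<length xs. h (xs ! k)) = (\<Sum>k<length ys. h (ys ! k))"
  unfolding sum_nth_eq_sum_list using assms by (metis mset_map sum_mset_sum_list)

lemma Pnr_mset_cong:
  assumes "mset xs = mset ys" shows "xs \<in> Pnr n r \<longleftrightarrow> ys \<in> Pnr n r"
proof -
  have "sum_list (map sum_list xs) = sum_list (map sum_list ys)"
    using assms by (metis mset_map sum_mset_sum_list)
  then show ?thesis
    unfolding Pnr_def by (simp add: mset_eq_length[OF assms] mset_eq_setD[OF assms])
qed

text \<open>Immediate from the closed form \<open>y_num_eq\<close>, whose products and sum are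
  symmetric in the components.\<close>

lemma y_num_mset_cong:
  assumes "mset xs = mset ys" "xs \<in> Pnr n r"
  shows "y_num n r xs = y_num n r ys"
proof (cases "2 \<le> n")
  case True
  have ys: "ys \<in> Pnr n r" using assms Pnr_mset_cong by blast
  have len: "length xs = r" "length ys = r" using assms(2) ys by (auto simp: Pnr_def)
  show ?thesis
    unfolding y_num_eq[OF True assms(2)] y_num_eq[OF True ys]
    using prod_nth_mset_cong[OF assms(1), of "\<lambda>\<mu>. of_nat (f_dim \<mu>) :: complex"]
      prod_nth_mset_cong[OF assms(1), of "\<lambda>\<mu>. fact (sum_list \<mu>) :: complex"]
      sum_nth_mset_cong[OF assms(1), of "\<lambda>\<mu>. of_nat (sum_list \<mu> * (sum_list \<mu> - 1)) *
        (chi \<mu> (transpose 1 2) / of_nat (f_dim \<mu>)) :: complex"]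
    unfolding len by (simp only:)
qed (simp add: y_num_def)

lemma length_le_sum_list: "(0::nat) \<notin> set xs \<Longrightarrow> length xs \<le> sum_list xs"
  by (induction xs) auto

lemma finite_Pnr: "finite (Pnr n r)"
proof (rule finite_subset)
  let ?P = "{\<mu>. set \<mu> \<subseteq> {..n} \<and> length \<mu> \<le> n}"
  show "finite {lam. set lam \<subseteq> ?P \<and> length lam = r}"
    by (intro finite_lists_length_eq finite_lists_length_le) simp
  show "Pnr n r \<subseteq> {lam. set lam \<subseteq> ?P \<and> length lam = r}"
  proof
    fix lam assume lam: "lam \<in> Pnr n r"
    have "\<mu> \<in> ?P" if "\<mu> \<in> set lam" for \<mu>
    proof -
      have "sum_list \<mu> \<le> n"
        using lam member_le_sum_list[of "sum_list \<mu>" "map sum_list lam"] that by (simp add: Pnr_def)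
      moreover have "length \<mu> \<le> sum_list \<mu>"
        using lam that by (intro length_le_sum_list) (auto simp: Pnr_def is_partition_def)
      moreover have "x \<le> sum_list \<mu>" if "x \<in> set \<mu>" for x
        using that by (simp add: member_le_sum_list)
      ultimately show ?thesis by force
    qed
    then show "lam \<in> {lam. set lam \<subseteq> ?P \<and> length lam = r}" using lam by (auto simp: Pnr_def)
  qed
qed

section \<open>Rotations and residues modulo r\<close>

text \<open>The only ingredient of the exponent of zeta that depends on the order of the
  components.\<close>

definition rank_sum :: "nat list list \<Rightarrow> nat" where
  "rank_sum lam = (\<Sum>k<length lam. k * sum_list (lam ! k))"

text \<open>Every component moves down by one position, except that the first goes to position r -
  1, which is -1 modulo r. The exact discrepancy is r times the size of the first component.\<close>

lemma rank_sum_rotate1: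
  assumes "lam \<in> Pnr n r"
  shows "[rank_sum (rotate1 lam) + n = rank_sum lam] (mod r)"
proof (cases lam)
  case Nil
  then show ?thesis using assms by (simp add: Pnr_def cong_def)
next
  case (Cons \<mu> xs)
  have len: "r = Suc (length xs)" and n: "n = sum_list \<mu> + (\<Sum>k<length xs. sum_list (xs ! k))"
    using assms by (auto simp: Pnr_def Cons sum_nth_eq_sum_list)
  have "rank_sum (rotate1 lam) = (\<Sum>k<length xs. k * sum_list (xs ! k)) + length xs * sum_list \<mu>"
    by (simp add: rank_sum_def Cons nth_append)
  moreover have "rank_sum lam = (\<Sum>k<length xs. k * sum_list (xs ! k)) + (\<Sum>k<length xs. sum_list (xs ! k))"
    by (simp add: rank_sum_def Cons sum.lessThan_Suc_shift sum.distrib algebra_simps del: sum.lessThan_Suc)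
  ultimately have "rank_sum (rotate1 lam) + n = rank_sum lam + r * sum_list \<mu>"
    by (simp add: n len)
  then show ?thesis by (simp add: cong_def)
qed

lemma mset_rotate: "mset (rotate j xs) = mset xs"
proof (induction j)
  case (Suc j)
  have "mset (rotate1 ys) = mset ys" for ys :: "'a list" by (cases ys) simp_all
  then show ?case using Suc by simp
qed simp

lemma rank_sum_rotate:
  assumes "lam \<in> Pnr n r"
  shows "[rank_sum (rotate j lam) + j * n = rank_sum lam] (mod r)"
proof (induction j)
  case (Suc j)
  have "rotate j lam \<in> Pnr n r" using assms Pnr_mset_cong[OF mset_rotate] by blast
  from cong_add[OF rank_sum_rotate1[OF this] cong_refl[of "j * n"]]
  have "[rank_sum (rotate (Suc j) lam) + Suc j * n = rank_sum (rotate j lam) + j * n] (mod r)"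
    by (simp add: add.assoc)
  then show ?case using Suc by (rule cong_trans)
qed (simp add: rank_sum_def)

text \<open>Rotating by one step subtracts \<open>n\<close> from the rank sum modulo \<open>r\<close>, so that as long as
  \<open>c n\<close> is a unit every residue is attained exactly once along a rotation orbit.\<close>

lemma card_rotations_hitting:
  assumes lam: "lam \<in> Pnr n r" and c: "coprime c r" and n: "coprime n r" and r: "r > 0"
  shows "card {j. j < r \<and> [c * rank_sum (rotate j lam) = t] (mod r)} = 1"
proof -
  let ?g = "\<lambda>j. (c * rank_sum (rotate j lam)) mod r"
  have "inj_on ?g {..<r}"
  proof (rule inj_onI)
    fix i j assume ij: "i \<in> {..<r}" "j \<in> {..<r}" "?g i = ?g j"
    then have "[c * rank_sum (rotate i lam) = c * rank_sum (rotate j lam)] (mod r)" by (simp add: cong_def)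
    then have e: "[rank_sum (rotate i lam) = rank_sum (rotate j lam)] (mod r)"
      using c by (simp add: cong_mult_lcancel_nat)
    have "[rank_sum (rotate i lam) + i * n = rank_sum (rotate j lam) + j * n] (mod r)"
      using rank_sum_rotate[OF lam, of i] rank_sum_rotate[OF lam, of j] cong_trans cong_sym by blast
    moreover have "[rank_sum (rotate i lam) + j * n = rank_sum (rotate j lam) + j * n] (mod r)"
      using e by (intro cong_add cong_refl)
    ultimately have "[rank_sum (rotate i lam) + i * n = rank_sum (rotate i lam) + j * n] (mod r)"
      using cong_trans cong_sym by blast
    then have "[i * n = j * n] (mod r)" by (simp add: cong_add_lcancel_nat)
    then have "[i = j] (mod r)" using n by (simp add: cong_mult_rcancel_nat)
    then show "i = j" using ij by (simp add: cong_def)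
  qed
  moreover have "?g ` {..<r} \<subseteq> {..<r}" using r by auto
  ultimately have bij: "bij_betw ?g {..<r} {..<r}" by (simp add: bij_betw_def endo_inj_surj)
  have "t mod r \<in> ?g ` {..<r}" using bij r by (simp add: bij_betw_def)
  then obtain j where j: "j < r" "?g j = t mod r" by auto
  have "{i. i < r \<and> [c * rank_sum (rotate i lam) = t] (mod r)} = {j}"
  proof (rule equalityI; rule subsetI)
    fix i assume i: "i \<in> {i. i < r \<and> [c * rank_sum (rotate i lam) = t] (mod r)}"
    then have "?g i = ?g j" using j(2) by (simp add: cong_def)
    then show "i \<in> {j}" using inj_onD[OF bij_betw_imp_inj_on[OF bij], of i j] i j(1) by simp
  qed (use j in \<open>simp add: cong_def\<close>)
  then show ?thesis by simp
qed

text \<open>Double counting of the pairs (lam, j) such that \<open>rotate j lam\<close> satisfies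
  the congruence: each lam admits exactly one j, and each j admits equally many lam because
  \<open>rotate j\<close> permutes \<Omega>. The parameters c and t may vary with lam, but not along
  a rotation orbit.\<close>

lemma card_hitting:
  assumes O: "finite \<Omega>" "\<Omega> \<subseteq> Pnr n r" "\<And>lam. lam \<in> \<Omega> \<Longrightarrow> rotate1 lam \<in> \<Omega>"
    and c: "\<And>lam. lam \<in> \<Omega> \<Longrightarrow> coprime (c lam) r" and n: "coprime n r" and r: "r > 0"
    and inv: "\<And>lam. lam \<in> \<Omega> \<Longrightarrow> c (rotate1 lam) = c lam" "\<And>lam. lam \<in> \<Omega> \<Longrightarrow> t (rotate1 lam) = t lam"
  shows "r * card {lam \<in> \<Omega>. [c lam * rank_sum lam = t lam] (mod r)} = card \<Omega>"
proof -
  let ?hit = "\<lambda>lam. [c lam * rank_sum lam = t lam] (mod r)"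
  have rot: "rotate j lam \<in> \<Omega> \<and> c (rotate j lam) = c lam \<and> t (rotate j lam) = t lam" if "lam \<in> \<Omega>" for lam j
    by (induction j) (use that O inv in auto)
  have one: "card {j. j < r \<and> ?hit (rotate j lam)} = 1" if "lam \<in> \<Omega>" for lam
    using card_rotations_hitting[OF _ c[OF that] n r, of lam "t lam"] that O(2) rot[OF that] by auto
  have fixed: "card {lam \<in> \<Omega>. ?hit (rotate j lam)} = card {lam \<in> \<Omega>. ?hit lam}" for j
  proof -
    have inj: "inj_on (rotate j) A" for A :: "nat list list set"
      unfolding rotate_def by (rule inj_on_subset[OF inj_fn[OF inj_rotate1] subset_UNIV])
    have "rotate j ` \<Omega> = \<Omega>" using rot inj O(1) by (intro endo_inj_surj) auto
    then have "rotate j ` {lam \<in> \<Omega>. ?hit (rotate j lam)} = {lam \<in> \<Omega>. ?hit lam}"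
      using Compr_image_eq[of "rotate j" \<Omega> ?hit] by (simp only:)
    then show ?thesis using card_image[OF inj, of "{lam \<in> \<Omega>. ?hit (rotate j lam)}"] by (simp only:)
  qed
  have "card \<Omega> = (\<Sum>lam\<in>\<Omega>. card {j. j < r \<and> ?hit (rotate j lam)})" using one by simp
  also have "\<dots> = (\<Sum>lam\<in>\<Omega>. \<Sum>j<r. if ?hit (rotate j lam) then 1 else 0)"
    by (intro sum.cong refl) (simp add: sum.inter_filter[symmetric])
  also have "\<dots> = (\<Sum>j<r. \<Sum>lam\<in>\<Omega>. if ?hit (rotate j lam) then 1 else 0)" by (rule sum.swap)
  also have "\<dots> = (\<Sum>j<r. card {lam \<in> \<Omega>. ?hit (rotate j lam)})"
    using O(1) by (intro sum.cong refl) (simp add: sum.inter_filter[symmetric])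
  also have "\<dots> = r * card {lam \<in> \<Omega>. ?hit lam}" by (simp add: fixed)
  finally show ?thesis ..
qed

section \<open>Rearrangements of the sizes\<close>

text \<open>A permutation of positions carrying a to b also acts on tuples of partitions,
  injectively and respecting E. The inequality suffices, since it can be applied in both
  directions.\<close>

lemma card_fixed_sizes_mset_cong:
  assumes E: "\<And>xs ys. mset xs = mset ys \<Longrightarrow> xs \<in> Pnr n r \<Longrightarrow> E xs \<longleftrightarrow> E ys"
    and ab: "mset a = mset b"
  shows "card {lam \<in> Pnr n r. map sum_list lam = a \<and> E lam} \<le> card {lam \<in> Pnr n r. map sum_list lam = b \<and> E lam}"
proof -
  obtain p where p: "p permutes {..<length a}" "permute_list p a = b"
    using mset_eq_permutation[OF ab[symmetric]] by blast
  show ?thesis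
  proof (rule card_inj_on_le[of "permute_list p"])
    show "finite {lam \<in> Pnr n r. map sum_list lam = b \<and> E lam}" using finite_Pnr by simp
    show "inj_on (permute_list p) {lam \<in> Pnr n r. map sum_list lam = a \<and> E lam}"
    proof (rule inj_onI)
      fix xs ys assume "xs \<in> {lam \<in> Pnr n r. map sum_list lam = a \<and> E lam}"
        "ys \<in> {lam \<in> Pnr n r. map sum_list lam = a \<and> E lam}"
        and eq: "permute_list p xs = permute_list p ys"
      then have "map sum_list xs = a" "map sum_list ys = a" by auto
      then have len: "length xs = length a" "length ys = length a" by (metis length_map)+
      have "permute_list (inv' p) (permute_list p xs) = permute_list (inv' p) (permute_list p ys)"
        using eq by simp
      then show "xs = ys"
        using p len permutes_inv[OF p(1)]
        by (simp add: permute_list_compose[symmetric] permutes_comp_inverses)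
    qed
    show "permute_list p ` {lam \<in> Pnr n r. map sum_list lam = a \<and> E lam} \<subseteq> {lam \<in> Pnr n r. map sum_list lam = b \<and> E lam}"
    proof (rule image_subsetI)
      fix xs assume "xs \<in> {lam \<in> Pnr n r. map sum_list lam = a \<and> E lam}"
      then have xs: "xs \<in> Pnr n r" "map sum_list xs = a" "E xs" by auto
      have px: "p permutes {..<length xs}" using p xs by auto
      have m: "mset (permute_list p xs) = mset xs" using px by simp
      have "map sum_list (permute_list p xs) = b"
        using permute_list_map[OF px, of sum_list] xs p by simp
      moreover have "permute_list p xs \<in> Pnr n r" using Pnr_mset_cong[OF m] xs by blast
      moreover have "E (permute_list p xs)" using E[OF m[symmetric] xs(1)] xs(3) by blast
      ultimately show "permute_list p xs \<in> {lam \<in> Pnr n r. map sum_list lam = b \<and> E lam}" by blast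
    qed
  qed
qed

lemma card_rearranged_sizes:
  assumes E: "\<And>xs ys. mset xs = mset ys \<Longrightarrow> xs \<in> Pnr n r \<Longrightarrow> E xs \<longleftrightarrow> E ys"
  shows "card {lam \<in> Pnr n r. E lam \<and> mset (map sum_list lam) = mset a} =
    card (permutations_of_multiset (mset a)) * card {lam \<in> Pnr n r. map sum_list lam = a \<and> E lam}"
proof -
  let ?S = "{lam \<in> Pnr n r. E lam \<and> mset (map sum_list lam) = mset a}"
  have "card ?S = (\<Sum>b\<in>permutations_of_multiset (mset a). card {lam \<in> ?S. map sum_list lam = b})"
    unfolding card_eq_sum using finite_Pnr
    by (intro sum.group[symmetric]) (auto intro!: permutations_of_multisetI)
  also have "\<dots> = (\<Sum>b\<in>permutations_of_multiset (mset a). card {lam \<in> Pnr n r. map sum_list lam = a \<and> E lam})"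
  proof (intro sum.cong refl)
    fix b assume "b \<in> permutations_of_multiset (mset a)"
    then have b: "mset b = mset a" by (rule permutations_of_multisetD)
    then have "{lam \<in> ?S. map sum_list lam = b} = {lam \<in> Pnr n r. map sum_list lam = b \<and> E lam}" by auto
    then show "card {lam \<in> ?S. map sum_list lam = b} = card {lam \<in> Pnr n r. map sum_list lam = a \<and> E lam}"
      using card_fixed_sizes_mset_cong[OF E b] card_fixed_sizes_mset_cong[OF E b[symmetric]]
      by (simp add: le_antisym)
  qed
  finally show ?thesis by simp
qed

text \<open>The sequence a has r! divided by the product of the m_v! rearrangements;
  equidistribution of s divides this by r.\<close>

lemma coeff_of_eq:
  assumes "length a = r" "r > 0"
  shows "coeff_of r a = card (permutations_of_multiset (mset a)) / r"
proof -
  \<comment> \<open>Values v absent from a contribute 0! = 1, so the product over all naturals is a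
    finite one.\<close>
  have "(\<Prod>v. fact (count_list a v) :: real) = (\<Prod>v\<in>set a. fact (count_list a v))"
    by (rule Prod_any.expand_superset) (auto simp: count_list_0_iff intro: ccontr)
  then have "coeff_of r a = fact (r - 1) / (\<Prod>v\<in>set a. fact (count_list a v))"
    by (simp add: coeff_of_def)
  moreover have "real (card (permutations_of_multiset (mset a))) = fact r / (\<Prod>v\<in>set a. fact (count_list a v))"
    using card_permutations_of_multiset(2)[of "mset a"] assms(1)
    by (simp add: card_permutations_of_multiset(1) real_of_nat_div count_mset)
  moreover have "(fact r :: real) = of_nat r * fact (r - 1)" using assms(2) by (rule fact_reduce)
  ultimately show ?thesis using assms(2) by simp
qed

section \<open>From determinant characters to a congruence and a parity\<close>

lemma prime_coprime_fact: "prime r \<Longrightarrow> m < r \<Longrightarrow> coprime (fact m) r" for r :: nat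
  using prime_dvd_fact_iff[of r m] prime_imp_coprime_nat[of r "fact m"] by (auto simp: coprime_commute)

lemma power_cong_mod:
  fixes z :: "'a::comm_monoid_mult"
  assumes "z ^ r = 1" "[x = s] (mod r)"
  shows "z ^ x = z ^ s"
proof -
  have "z ^ m = z ^ (m mod r)" for m
  proof -
    have "z ^ m = z ^ (r * (m div r) + m mod r)" by simp
    then show ?thesis by (simp only: power_add power_mult assms(1) power_one mult_1_left)
  qed
  then show ?thesis using assms(2) unfolding cong_def by metis
qed

lemma primitive_root_power_eq_iff:
  assumes prim: "primitive_root_of_unity r \<zeta>" and r: "r > 0"
  shows "\<zeta> ^ x = \<zeta> ^ s \<longleftrightarrow> [x = s] (mod r)"
proof
  have root: "\<zeta> ^ r = 1" and ne: "\<And>k. 0 < k \<Longrightarrow> k < r \<Longrightarrow> \<zeta> ^ k \<noteq> 1"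
    using prim by (auto simp: primitive_root_of_unity_def)
  show "\<zeta> ^ x = \<zeta> ^ s" if "[x = s] (mod r)" using power_cong_mod[OF root that] .
  have z: "\<zeta> \<noteq> 0" using root r by (auto simp: power_0_left)
  have eq: "i = j" if "\<zeta> ^ i = \<zeta> ^ j" "i \<le> j" "j < r" for i j
  proof (rule ccontr)
    assume "i \<noteq> j"
    then have "\<zeta> ^ (j - i) \<noteq> 1" using ne[of "j - i"] that by simp
    then show False using that z by (simp add: power_diff)
  qed
  assume "\<zeta> ^ x = \<zeta> ^ s"
  moreover have "\<zeta> ^ m = \<zeta> ^ (m mod r)" for m
    by (rule power_cong_mod[OF root]) (simp add: cong_def)
  ultimately have "\<zeta> ^ (x mod r) = \<zeta> ^ (s mod r)" by metis
  moreover have "x mod r < r" "s mod r < r" using r by simp_all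
  ultimately have "x mod r = s mod r" using eq[of "x mod r" "s mod r"] eq[of "s mod r" "x mod r"]
    by (metis nat_le_linear)
  then show "[x = s] (mod r)" by (simp add: cong_def)
qed

lemma is_even_number_of_nat: "is_even_number (of_nat m) \<longleftrightarrow> even m"
  unfolding is_even_number_def
  by (metis even_of_nat of_int_eq_iff of_int_of_nat_eq)

lemma is_odd_number_of_nat: "is_odd_number (of_nat m) \<longleftrightarrow> odd m"
  unfolding is_odd_number_def
  by (metis even_of_nat of_int_eq_iff of_int_of_nat_eq)

definition prod_dims :: "nat list list \<Rightarrow> nat" where
  "prod_dims lam = (\<Prod>k<length lam. f_dim (lam ! k))"

definition prod_facts :: "nat list list \<Rightarrow> nat" where
  "prod_facts lam = (\<Prod>k<length lam. fact (sum_list (lam ! k)))"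

text \<open>The congruence saying that the exponent \<open>x\<close> in \<open>det \<rho>\<^sub>\<lambda> = \<zeta>\<^sup>x sgn\<^sup>y\<close> is \<open>s\<close> modulo \<open>r\<close>,
  cleared of the denominator \<open>b\<^sub>1! \<dots> b\<^sub>r!\<close>.\<close>

definition zeta_exponent_is :: "nat \<Rightarrow> nat \<Rightarrow> nat \<Rightarrow> nat list list \<Rightarrow> bool" where
  "zeta_exponent_is n r s lam \<longleftrightarrow>
     [prod_dims lam * fact (n - 1) * rank_sum lam = s * prod_facts lam] (mod r)"

lemma Pnr_nth_le:
  assumes "lam \<in> Pnr n r" "k < length lam"
  shows "sum_list (lam ! k) \<le> n"
  using member_le_sum_list[of "sum_list (lam ! k)" "map sum_list lam"] assms by (simp add: Pnr_def)

lemma coprime_prod_facts: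
  assumes "prime r" "n < r" "lam \<in> Pnr n r"
  shows "coprime (prod_facts lam) r"
  unfolding prod_facts_def
  using Pnr_nth_le[OF assms(3)] assms(1,2) by (intro prod_coprime_left prime_coprime_fact) (auto intro: le_less_trans)

lemma coprime_prod_dims:
  assumes "prime r" "n < r" "lam \<in> Pnr n r"
  shows "coprime (prod_dims lam) r"
  unfolding prod_dims_def
proof (rule prod_coprime_left)
  fix k assume "k \<in> {..<length lam}"
  then have "coprime (fact (sum_list (lam ! k))) r"
    using Pnr_nth_le[OF assms(3)] assms(1,2) by (intro prime_coprime_fact) (auto intro: le_less_trans)
  then show "coprime (f_dim (lam ! k)) r"
    using f_dim_dvd_fact by (rule coprime_divisors[OF _ dvd_refl, rotated])
qed

lemma zeta_char_power_order: "\<zeta> ^ r = 1 \<Longrightarrow> zeta_char \<zeta> n g ^ r = 1"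
  by (cases g) (simp add: zeta_char_def powi_power power_int_mult)

lemma sgn_char_power: "sgn_char g ^ y = (if even y then 1 else sgn_char g)"
proof -
  have "sgn_char g = 1 \<or> sgn_char g = -1" by (cases g) (auto simp: sgn_char_def sign_def)
  then show ?thesis by auto
qed

text \<open>The exponents x modulo r and y modulo 2 are recovered by evaluating at two elements on
  which zeta and sgn separate; conversely they determine the character.\<close>

lemma det_character_iff:
  assumes r: "prime r" and n: "1 \<le> n" "n < r" and prim: "primitive_root_of_unity r \<zeta>"
    and lam: "lam \<in> Pnr n r"
  shows "det_is_plus \<zeta> n r s lam \<longleftrightarrow> zeta_exponent_is n r s lam \<and> is_even_number (y_num n r lam)"
    and "2 \<le> n \<Longrightarrow> det_is_minus \<zeta> n r s lam \<longleftrightarrow> zeta_exponent_is n r s lam \<and> is_odd_number (y_num n r lam)"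
proof -
  have r0: "r > 0" using r by (simp add: prime_gt_0_nat)
  have root: "\<zeta> ^ r = 1" using prim by (simp add: primitive_root_of_unity_def)
  have len: "length lam = r" using lam by (simp add: Pnr_def)
  obtain x y where det: "\<forall>g\<in>carrier (Gnr n r). det (rho \<zeta> n r lam g) = zeta_char \<zeta> n g ^ x * sgn_char g ^ y"
    and y: "y_num n r lam = of_nat y"
    and x: "x * (\<Prod>k<r. fact (sum_list (lam ! k))) =
      (\<Prod>k<r. f_dim (lam ! k)) * fact (n - 1) * (\<Sum>k<r. k * sum_list (lam ! k))"
    by (rule det_rho[OF r0 root lam n(1)])
  have "x * prod_facts lam = prod_dims lam * fact (n - 1) * rank_sum lam"
    using x by (simp only: prod_facts_def prod_dims_def rank_sum_def len)
  then have hit: "zeta_exponent_is n r s lam \<longleftrightarrow> [x = s] (mod r)"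
    unfolding zeta_exponent_is_def
    using cong_mult_rcancel_nat[OF coprime_prod_facts[OF r n(2) lam], of x s] by simp
  \<comment> \<open>At e, with a single coordinate 1, the characters take the values zeta and 1; at
    the transposition t they take the values 1 and -1.\<close>
  define e where "e = ((\<lambda>i\<in>{1..n}. if i = 1 then 1 else 0 :: int), id :: nat \<Rightarrow> nat)"
  define t where "t = ((\<lambda>i\<in>{1..n}. 0 :: int), transpose 1 (2 :: nat))"
  have e: "e \<in> carrier (Gnr n r)" using n by (auto simp: e_def carrier_Gnr[OF r0] permutes_id)
  have t: "t \<in> carrier (Gnr n r)" if "2 \<le> n"
    using permutes_swap_id[of 1 "{1..n}" 2] that r0 by (auto simp: t_def carrier_Gnr[OF r0])
  have chars: "zeta_char \<zeta> n e = \<zeta>" "sgn_char e = 1" "zeta_char \<zeta> n t = 1" "sgn_char t = -1"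
    using n by (auto simp: e_def t_def zeta_char_def sgn_char_def sign_swap_id sum.delta)
  have zeta: "zeta_char \<zeta> n g ^ x = zeta_char \<zeta> n g ^ s" if "[x = s] (mod r)" for g
    using power_cong_mod[OF zeta_char_power_order[OF root] that] .
  note root_iff = primitive_root_power_eq_iff[OF prim r0]
  show "det_is_plus \<zeta> n r s lam \<longleftrightarrow> zeta_exponent_is n r s lam \<and> is_even_number (y_num n r lam)"
    unfolding hit y is_even_number_of_nat det_is_plus_def
  proof
    assume *: "\<forall>g\<in>carrier (Gnr n r). det (rho \<zeta> n r lam g) = zeta_char \<zeta> n g ^ s"
    have "[x = s] (mod r)"
      using bspec[OF * e] bspec[OF det e] by (simp add: chars root_iff)
    moreover have "even y"
    proof (cases "2 \<le> n")
      case True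
      then show ?thesis using bspec[OF * t] bspec[OF det t] by (cases "even y") (simp_all add: chars)
    next
      case False
      \<comment> \<open>For n = 1 there is no transposition to test, but \<open>y_num\<close> is 0
        and hence y = 0.\<close>
      then show ?thesis using y by (simp add: y_num_def)
    qed
    ultimately show "[x = s] (mod r) \<and> even y" ..
  next
    assume "[x = s] (mod r) \<and> even y"
    then show "\<forall>g\<in>carrier (Gnr n r). det (rho \<zeta> n r lam g) = zeta_char \<zeta> n g ^ s"
      using det zeta by (simp add: sgn_char_power)
  qed
  assume n2: "2 \<le> n"
  show "det_is_minus \<zeta> n r s lam \<longleftrightarrow> zeta_exponent_is n r s lam \<and> is_odd_number (y_num n r lam)"
    unfolding hit y is_odd_number_of_nat det_is_minus_def
  proof
    assume *: "\<forall>g\<in>carrier (Gnr n r). det (rho \<zeta> n r lam g) = zeta_char \<zeta> n g ^ s * sgn_char g"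
    have "[x = s] (mod r)"
      using bspec[OF * e] bspec[OF det e] by (simp add: chars root_iff)
    moreover have "odd y"
      using bspec[OF * t[OF n2]] bspec[OF det t[OF n2]] by (cases "even y") (simp_all add: chars)
    ultimately show "[x = s] (mod r) \<and> odd y" ..
  next
    assume "[x = s] (mod r) \<and> odd y"
    then show "\<forall>g\<in>carrier (Gnr n r). det (rho \<zeta> n r lam g) = zeta_char \<zeta> n g ^ s * sgn_char g"
      using det zeta by (simp add: sgn_char_power)
  qed
qed

section \<open>Assembling the counts\<close>

text \<open>E stands for either parity of \<open>y_num\<close>. Being invariant under rearrangement,
  it is compatible both with the rotations that equidistribute the exponent and with the
  permutations that exchange size sequences.\<close>

lemma card_zeta_exponent:
  assumes r: "prime r" and n: "1 \<le> n" "n < r"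
    and E: "\<And>xs ys. mset xs = mset ys \<Longrightarrow> xs \<in> Pnr n r \<Longrightarrow> E xs \<longleftrightarrow> E ys"
    and a: "length a = r"
  shows "real (card {lam \<in> Pnr n r. zeta_exponent_is n r s lam \<and> E lam \<and> mset (map sum_list lam) = mset a}) =
    coeff_of r a * real (card {lam \<in> Pnr n r. map sum_list lam = a \<and> E lam})"
proof -
  let ?O = "{lam \<in> Pnr n r. E lam \<and> mset (map sum_list lam) = mset a}"
  let ?c = "\<lambda>lam. prod_dims lam * fact (n - 1)" and ?t = "\<lambda>lam. s * prod_facts lam"
  have r0: "r > 0" using r by (simp add: prime_gt_0_nat)
  have mrot: "mset (rotate1 lam) = mset lam" for lam :: "nat list list"
    using mset_rotate[of 1 lam] by simp
  have "coprime n r"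
    using prime_imp_coprime_nat[OF r, of n] n nat_dvd_not_less[of n r] by (simp add: coprime_commute)
  have "r * card {lam \<in> ?O. [?c lam * rank_sum lam = ?t lam] (mod r)} = card ?O"
  proof (rule card_hitting)
    show "finite ?O" using finite_Pnr by simp
    show "rotate1 lam \<in> ?O" if "lam \<in> ?O" for lam
      using that E[OF mrot[symmetric], of lam] Pnr_mset_cong[OF mrot, of lam] by (simp add: rotate1_map[symmetric] mrot)
    show "coprime (?c lam) r" if "lam \<in> ?O" for lam
      using that coprime_prod_dims[OF r n(2)] prime_coprime_fact[OF r, of "n - 1"] n by simp
    show "?c (rotate1 lam) = ?c lam" "?t (rotate1 lam) = ?t lam" for lam
      using prod_nth_mset_cong[OF mrot, of f_dim lam] prod_nth_mset_cong[OF mrot, of "\<lambda>\<mu>. fact (sum_list \<mu>) :: nat" lam]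
      by (simp_all add: prod_dims_def prod_facts_def)
  qed (use r0 \<open>coprime n r\<close> in auto)
  also have "{lam \<in> ?O. [?c lam * rank_sum lam = ?t lam] (mod r)} =
    {lam \<in> Pnr n r. zeta_exponent_is n r s lam \<and> E lam \<and> mset (map sum_list lam) = mset a}"
    unfolding zeta_exponent_is_def by blast
  also note card_rearranged_sizes[OF E, where a = a]
  finally have N: "r * card {lam \<in> Pnr n r. zeta_exponent_is n r s lam \<and> E lam \<and> mset (map sum_list lam) = mset a} =
    card (permutations_of_multiset (mset a)) * card {lam \<in> Pnr n r. map sum_list lam = a \<and> E lam}" .
  have "real r * real (card {lam \<in> Pnr n r. zeta_exponent_is n r s lam \<and> E lam \<and> mset (map sum_list lam) = mset a}) =
    real (card (permutations_of_multiset (mset a))) * real (card {lam \<in> Pnr n r. map sum_list lam = a \<and> E lam})"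
    using arg_cong[OF N, of real] by (simp only: of_nat_mult)
  then show ?thesis using r0 unfolding coeff_of_eq[OF a r0] by (simp add: field_simps)
qed

lemma decreasing_rearrangement_iff:
  fixes a b :: "nat list"
  assumes "sorted_wrt (\<ge>) a"
  shows "mset b = mset a \<longleftrightarrow> rev (sort b) = a"
proof
  have "sorted (rev a)" using assms by (simp add: sorted_wrt_rev)
  assume "mset b = mset a"
  then have "sort b = rev a" using \<open>sorted (rev a)\<close> by (intro properties_for_sort) simp_all
  then show "rev (sort b) = a" by simp
next
  assume "rev (sort b) = a"
  then have "mset (rev (sort b)) = mset a" by simp
  then show "mset b = mset a" by simp
qed

lemma finite_decreasing_seqs: "finite (decreasing_seqs n r)"
proof (rule finite_subset)
  show "finite {a. set a \<subseteq> {..n} \<and> length a = r}" by (rule finite_lists_length_eq) simp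
  show "decreasing_seqs n r \<subseteq> {a. set a \<subseteq> {..n} \<and> length a = r}"
    by (auto simp: decreasing_seqs_def member_le_sum_list)
qed

text \<open>The sizes of a tuple have exactly one decreasing rearrangement, their reversed sort, so
  the fibres over these sequences partition the set.\<close>

lemma card_Pnr_by_sizes:
  "card {lam \<in> Pnr n r. Q lam} =
   (\<Sum>a\<in>decreasing_seqs n r. card {lam \<in> Pnr n r. Q lam \<and> mset (map sum_list lam) = mset a})"
proof -
  let ?S = "{lam \<in> Pnr n r. Q lam}" and ?g = "\<lambda>lam. rev (sort (map sum_list lam))"
  have "?g ` ?S \<subseteq> decreasing_seqs n r"
  proof (rule image_subsetI)
    fix lam assume "lam \<in> ?S"
    moreover have "sum_list (sort b) = sum_list b" for b :: "nat list"
      by (metis mset_sort sum_mset_sum_list)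
    ultimately show "?g lam \<in> decreasing_seqs n r"
      by (simp add: decreasing_seqs_def Pnr_def sorted_wrt_rev)
  qed
  then have "card ?S = (\<Sum>a\<in>decreasing_seqs n r. card {lam \<in> ?S. ?g lam = a})"
    unfolding card_eq_sum using finite_Pnr finite_decreasing_seqs
    by (intro sum.group[symmetric]) auto
  also have "\<dots> = (\<Sum>a\<in>decreasing_seqs n r. card {lam \<in> Pnr n r. Q lam \<and> mset (map sum_list lam) = mset a})"
  proof (intro sum.cong refl)
    fix a assume "a \<in> decreasing_seqs n r"
    then have "sorted_wrt (\<ge>) a" by (simp add: decreasing_seqs_def)
    then have "{lam \<in> ?S. ?g lam = a} = {lam \<in> Pnr n r. Q lam \<and> mset (map sum_list lam) = mset a}"
      using decreasing_rearrangement_iff by blast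
    then show "card {lam \<in> ?S. ?g lam = a} = card {lam \<in> Pnr n r. Q lam \<and> mset (map sum_list lam) = mset a}"
      by (simp only:)
  qed
  finally show ?thesis .
qed

theorem mainTheorem11:
  fixes r n :: nat and \<zeta> :: complex
  assumes "prime r" and "odd r" and "1 \<le> n" and "n < r"
    and "primitive_root_of_unity r \<zeta>"
  shows "(\<forall>a\<in>decreasing_seqs n r. \<forall>s\<in>{1..r}.
            real (N_plus_at \<zeta> n r s a) = coeff_of r a * real (A_zero n r a) \<and>
            real (N_minus_at \<zeta> n r s a) = coeff_of r a * real (A_one n r a))
       \<and> (\<forall>s\<in>{1..r}.
            real (N_plus \<zeta> n r s) = (\<Sum>a\<in>decreasing_seqs n r. coeff_of r a * real (A_zero n r a)) \<and>
            real (N_minus \<zeta> n r s) = (\<Sum>a\<in>decreasing_seqs n r. coeff_of r a * real (A_one n r a)))"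
proof -
  note det_iff = det_character_iff[OF assms(1,3-5)]
  have plus_at: "real (N_plus_at \<zeta> n r s a) = coeff_of r a * real (A_zero n r a)"
    if a: "a \<in> decreasing_seqs n r" for a s
  proof -
    have "N_plus_at \<zeta> n r s a = card {lam \<in> Pnr n r. zeta_exponent_is n r s lam \<and>
        is_even_number (y_num n r lam) \<and> mset (map sum_list lam) = mset a}"
      unfolding N_plus_at_def using det_iff(1) by (intro arg_cong[where f = card]) blast
    then show ?thesis
      unfolding A_zero_def using a y_num_mset_cong
      by (simp only:) (rule card_zeta_exponent[OF assms(1,3,4)], metis, simp add: decreasing_seqs_def)
  qed
  have minus_at: "real (N_minus_at \<zeta> n r s a) = coeff_of r a * real (A_one n r a)"
    if a: "a \<in> decreasing_seqs n r" for a s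
  proof (cases "n = 1")
    case True
    \<comment> \<open>For n = 1 every \<open>y_num\<close> is 0, so \<open>A_one\<close> vanishes in
      agreement with the convention for \<open>N_minus_at\<close>.\<close>
    have "\<not> is_odd_number 0" using is_odd_number_of_nat[of 0] by simp
    then show ?thesis using True by (simp add: N_minus_at_def A_one_def y_num_def)
  next
    case False
    then have n2: "2 \<le> n" using assms(3) by simp
    have "N_minus_at \<zeta> n r s a = card {lam \<in> Pnr n r. zeta_exponent_is n r s lam \<and>
        is_odd_number (y_num n r lam) \<and> mset (map sum_list lam) = mset a}"
      unfolding N_minus_at_def using det_iff(2)[OF _ n2] False
      by (simp only: if_False) (intro arg_cong[where f = card], blast)
    then show ?thesis
      unfolding A_one_def using a y_num_mset_cong
      by (simp only:) (rule card_zeta_exponent[OF assms(1,3,4)], metis, simp add: decreasing_seqs_def)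
  qed
  have "N_plus \<zeta> n r s = (\<Sum>a\<in>decreasing_seqs n r. N_plus_at \<zeta> n r s a)" for s
    unfolding N_plus_def N_plus_at_def by (rule card_Pnr_by_sizes)
  moreover have "N_minus \<zeta> n r s = (\<Sum>a\<in>decreasing_seqs n r. N_minus_at \<zeta> n r s a)" for s
    unfolding N_minus_def N_minus_at_def card_Pnr_by_sizes[of n r "det_is_minus \<zeta> n r s"] by simp
  ultimately show ?thesis
    using plus_at minus_at by simp
qed

end
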